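(* Let $m\ge1$ be an integer, $\lambda=(m-1)/2$, and let $f\in\Lambda_m$ be absolutely continuous on $[-1,1]$. If both functions $\mathcal D^\lambda_+f$ and $\mathcal D^\lambda_-f$ belong to $C[-1,1]$, then $\mathcal D^\lambda_+f\in\Lambda_{m+1}$ and $\mathcal D^\lambda_-f\in\Lambda_{m+1}$. If in addition $f\in\Lambda_m^+$, then $\mathcal D^\lambda_\pm f\in\Lambda^+_{m+1}$.
   Context: For an integer $k\ge1$, $\mathbb S^k\subset\mathbb R^{k+1}$ is the unit sphere and $\theta(x,y)=\arccos(x^Ty)$. A continuous $g:[0,\pi]\to\mathbb R$ is positive definite on $\mathbb S^k$ if $\sum_{i,j=1}^n c_ic_j g(\theta(x_i,x_j))\ge0$ for all $n$, all distinct $x_1,\dots,x_n\in\mathbb S^k$ and all real $c_i$; strictly positive definite if strict whenever the $c_i$ are not all zero. $\Lambda_k$ is the set of $f\in C[-1,1]$ with $f(\cos\cdot)$ positive definite on $\mathbb S^k$, and $\Lambda^+_k$ the subset with $f(\cos\cdot)$ strictly positive definite on $\mathbb S^k$. For $f$ absolutely continuous on $[-1,1]$ and $\lambda\ge0$: $D^\lambda_+f(x)=(1+x)\frac{d}{dx}\Big\{(1+x)^{-\lambda}\int_{-1}^x(x-\tau)^{-1/2}(1+\tau)^{\lambda-1/2}f(\tau)\,d\tau\Big\}$, $D^\lambda_-f(x)=(1-x)\frac{d}{dx}\Big\{(1-x)^{-\lambda}\int_x^1(\tau-x)^{-1/2}(1-\tau)^{\lambda-1/2}f(\tau)\,d\tau\Big\}$,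 and $\mathcal D^\lambda_+=D^\lambda_++D^\lambda_-$, $\mathcal D^\lambda_-=D^\lambda_+-D^\lambda_-$. *)

theory Defs
  imports "HOL-Analysis.Analysis"
begin

text \<open>Points of R^(k+1) are functions nat => real supported on indices 0..k.\<close>

definition sph :: "nat \<Rightarrow> (nat \<Rightarrow> real) set" where
  "sph k = {x. (\<forall>i>k. x i = 0) \<and> (\<Sum>i\<le>k. (x i)\<^sup>2) = 1}"

definition ip :: "nat \<Rightarrow> (nat \<Rightarrow> real) \<Rightarrow> (nat \<Rightarrow> real) \<Rightarrow> real" where
  "ip k x y = (\<Sum>i\<le>k. x i * y i)"

definition geo_dist :: "nat \<Rightarrow> (nat \<Rightarrow> real) \<Rightarrow> (nat \<Rightarrow> real) \<Rightarrow> real" where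
  "geo_dist k x y = arccos (ip k x y)"

definition pos_def_sphere :: "nat \<Rightarrow> (real \<Rightarrow> real) \<Rightarrow> bool" where
  "pos_def_sphere k g \<longleftrightarrow> continuous_on {0..pi} g \<and>
     (\<forall>n (x :: nat \<Rightarrow> nat \<Rightarrow> real) (c :: nat \<Rightarrow> real).
        (\<forall>i<n. x i \<in> sph k) \<and> inj_on x {..<n} \<longrightarrow>
        (\<Sum>i<n. \<Sum>j<n. c i * c j * g (geo_dist k (x i) (x j))) \<ge> 0)"

definition strictly_pos_def_sphere :: "nat \<Rightarrow> (real \<Rightarrow> real) \<Rightarrow> bool" where
  "strictly_pos_def_sphere k g \<longleftrightarrow> continuous_on {0..pi} g \<and>
     (\<forall>n (x :: nat \<Rightarrow> nat \<Rightarrow> real) (c :: nat \<Rightarrow> real).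
        (\<forall>i<n. x i \<in> sph k) \<and> inj_on x {..<n} \<and> (\<exists>i<n. c i \<noteq> 0) \<longrightarrow>
        (\<Sum>i<n. \<Sum>j<n. c i * c j * g (geo_dist k (x i) (x j))) > 0)"

definition Lambda :: "nat \<Rightarrow> (real \<Rightarrow> real) set" where
  "Lambda k = {f. continuous_on {-1..1} f \<and> pos_def_sphere k (\<lambda>t. f (cos t))}"

definition Lambda_plus :: "nat \<Rightarrow> (real \<Rightarrow> real) set" where
  "Lambda_plus k = {f. continuous_on {-1..1} f \<and> strictly_pos_def_sphere k (\<lambda>t. f (cos t))}"

definition abs_cont_on :: "real set \<Rightarrow> (real \<Rightarrow> real) \<Rightarrow> bool" where
  "abs_cont_on S f \<longleftrightarrow>
     (\<forall>e>0. \<exists>d>0. \<forall>n (a :: nat \<Rightarrow> real) b.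
        (\<forall>i<n. a i < b i \<and> a i \<in> S \<and> b i \<in> S \<and> {a i..b i} \<subseteq> S) \<and>
        (\<forall>i<n. \<forall>j<n. i \<noteq> j \<longrightarrow> b i \<le> a j \<or> b j \<le> a i) \<and>
        (\<Sum>i<n. b i - a i) < d \<longrightarrow>
        (\<Sum>i<n. \<bar>f (b i) - f (a i)\<bar>) < e)"

text \<open>The Abel-type operators; the integrals are (improper but absolutely convergent)
  integrals, taken as Henstock-Kurzweil integrals over the closed interval.\<close>

definition Dp :: "real \<Rightarrow> (real \<Rightarrow> real) \<Rightarrow> real \<Rightarrow> real" where
  "Dp lam f x = (1 + x) * deriv (\<lambda>t. (1 + t) powr (-lam) *
      integral {-1..t} (\<lambda>\<tau>. (t - \<tau>) powr (-1/2) * (1 + \<tau>) powr (lam - 1/2) * f \<tau>)) x"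

definition Dm :: "real \<Rightarrow> (real \<Rightarrow> real) \<Rightarrow> real \<Rightarrow> real" where
  "Dm lam f x = (1 - x) * deriv (\<lambda>t. (1 - t) powr (-lam) *
      integral {t..1} (\<lambda>\<tau>. (\<tau> - t) powr (-1/2) * (1 - \<tau>) powr (lam - 1/2) * f \<tau>)) x"

definition DDp :: "real \<Rightarrow> (real \<Rightarrow> real) \<Rightarrow> real \<Rightarrow> real" where
  "DDp lam f x = Dp lam f x + Dm lam f x"

definition DDm :: "real \<Rightarrow> (real \<Rightarrow> real) \<Rightarrow> real \<Rightarrow> real" where
  "DDm lam f x = Dp lam f x - Dm lam f x"

text \<open>A function defined almost everywhere on (-1,1) "belongs to C[-1,1]" if it agrees
  almost everywhere on (-1,1) with some function continuous on [-1,1]; that function is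
  its continuous representative.\<close>

definition cont_rep :: "(real \<Rightarrow> real) \<Rightarrow> (real \<Rightarrow> real) \<Rightarrow> bool" where
  "cont_rep h G \<longleftrightarrow> continuous_on {-1..1} G \<and>
     (AE x in lebesgue. x \<in> {-1<..<1} \<longrightarrow> G x = h x)"

end

theory Submission
  imports Defs "HOL-Computational_Algebra.Polynomial"
begin

text \<open>A zonal kernel \<open>f (x \<bullet> y)\<close> on the sphere \<open>S\<^sup>k\<close> is positive definite iff all coefficients of \<open>f\<close> in
  the ultraspherical polynomials of \<open>S\<^sup>k\<close> are nonnegative, and for \<open>k \<ge> 2\<close> it is strictly positive
  definite iff infinitely many coefficients of either parity are positive (only the necessity is needed
  for \<open>k = 1\<close>, where it remains true). With \<open>\<lambda> = (m - 1) / 2\<close> the Abel operators act on the normalised polynomials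
  \<open>U\<^sub>j\<close> of \<open>S\<^sup>m\<close> by \<open>D\<^sub>+ U\<^sub>j = c\<^sub>j (V\<^sub>j + V\<^sub>j\<^sub>-\<^sub>1)\<close> and \<open>D\<^sub>- U\<^sub>j = c\<^sub>j (V\<^sub>j\<^sub>-\<^sub>1 - V\<^sub>j)\<close>, where the \<open>V\<^sub>j\<close>
  belong to \<open>S\<^sup>m\<^sup>+\<^sup>1\<close> and \<open>c\<^sub>j > 0\<close> for \<open>j \<ge> 1\<close>. Hence the sum and the difference of the two
  operators multiply the coefficients of \<open>f\<close> by positive constants, the sum also lowering the index by one.
  Integration by parts turns the coefficients of \<open>D\<^sub>\<plusminus> f\<close> into functionals of \<open>f\<close> that are continuous in the
  supremum norm, so it suffices to compute them for polynomials; this uses that the absolutely continuous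
  Abel means of \<open>f\<close> are differentiable almost everywhere and are recovered from their derivatives.\<close>

section \<open>Ultraspherical polynomials\<close>

text \<open>No surface measure and no space of spherical harmonics is used: every integral is the
  one-dimensional \<open>zonal_int\<close>. Two facts usually drawn from them get direct proofs.
  Positive definiteness of the zonal polynomials comes from an explicit Gram factorisation, built by
  raising maps. Nonnegativity of the mean of a positive definite function comes from an induction
  over latitude slices that ends at the two points of S^0. The analytic obstacle is
  \<open>deriv\<close>: where no derivative exists its value is unspecified, so agreement almost
  everywhere with a continuous function says nothing before differentiability almost everywhere is
  known, and even then only absolute continuity excludes a singular part. Continuity is assumed for
  the sum and the difference of the operators; half the sum and half the difference of the
  representatives then represent D_+ f and D_- f, and D_- f is handled as D_+ of the reflected
  function. The step from S^m to S^(m+1) originates in Beta values: Abel means act diagonally on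
  powers of 1 + t, and the ratio of successive multipliers moves the hypergeometric parameter m/2 to
  (m+1)/2.\<close>

text \<open>These are the Gegenbauer polynomials of parameter (k - 1)/2, scaled to the value 1 at 1;
  for \<open>k = 1\<close> the Chebyshev polynomials. The raising recursion is chosen because the
  differential equation and later the kernel factorisation follow from it by induction. For
  \<open>k = 1\<close>, \<open>n = 0\<close> the factor is 1 / 0 = 0, and it multiplies the
  derivative of a constant.\<close>

primrec ultra :: "nat \<Rightarrow> nat \<Rightarrow> real poly" where
  "ultra k 0 = 1"
| "ultra k (Suc n) = [:0, 1:] * ultra k n
     - smult (1 / (real n + real k - 1)) ([:1, 0, -1:] * pderiv (ultra k n))"

lemma poly_ext_real: "(\<And>t. poly p t = poly q t) \<Longrightarrow> p = (q :: real poly)"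
  using poly_eq_poly_eq_iff[of p q] by auto

text \<open>With \<open>c\<close> in the role of n + k - 1, raising \<open>n\<close> and
  \<open>c\<close> together leaves \<open>c + 1 - n\<close>, the dimension k, unchanged, so the
  equation reproduces itself. The disjunction in the first hypothesis admits \<open>c = 0\<close>,
  that is k = 1 and n = 0.\<close>

lemma ultra_ode_aux:
  fixes p q :: "real poly" and n c :: real
  assumes k: "c \<noteq> 0 \<or> pderiv p = 0 \<and> n = 0"
    and ode: "[:1, 0, -1:] * pderiv (pderiv p) =
      smult (c + 1 - n) ([:0, 1:] * pderiv p) - smult (n * c) p"
    and q: "q = [:0, 1:] * p - smult (1 / c) ([:1, 0, -1:] * pderiv p)"
  shows "pderiv q = smult (n + 1) (p + smult (1 / c) ([:0, 1:] * pderiv p))"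
    and "[:1, 0, -1:] * pderiv (pderiv q) =
      smult (c + 1 - n) ([:0, 1:] * pderiv q) - smult ((n + 1) * (c + 1)) q"
proof -
  have ode': "(1 - t * t) * poly (pderiv (pderiv p)) t =
      (c + 1 - n) * (t * poly (pderiv p) t) - n * c * poly p t" for t
    using arg_cong[OF ode, of "\<lambda>r. poly r t"] by (simp add: algebra_simps)
  show d: "pderiv q = smult (n + 1) (p + smult (1 / c) ([:0, 1:] * pderiv p))"
  proof (rule poly_ext_real)
    fix t
    have "poly (pderiv q) t = poly p t + t * poly (pderiv p) t
      - (1 / c) * ((1 - t * t) * poly (pderiv (pderiv p)) t - 2 * t * poly (pderiv p) t)"
      unfolding q pderiv_diff pderiv_mult pderiv_smult
      by (simp add: pderiv_pCons algebra_simps add_divide_distrib diff_divide_distrib)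
    also have "\<dots> = poly (smult (n + 1) (p + smult (1 / c) ([:0, 1:] * pderiv p))) t"
      using k unfolding ode' by (auto simp: field_simps)
    finally show "poly (pderiv q) t = \<dots>" .
  qed
  show "[:1, 0, -1:] * pderiv (pderiv q) =
      smult (c + 1 - n) ([:0, 1:] * pderiv q) - smult ((n + 1) * (c + 1)) q"
  proof (rule poly_ext_real)
    fix t
    define A where "A = poly (pderiv p) t"
    define B where "B = poly p t"
    define D where "D = poly (pderiv (pderiv p)) t"
    have ABD: "(1 - t * t) * D = (c + 1 - n) * (t * A) - n * c * B"
      using ode' by (simp add: A_def B_def D_def)
    have AB: "A = 0" "n = 0" if "c = 0" using k that by (auto simp: A_def)
    have "poly (pderiv (pderiv q)) t = (n + 1) * (A + (1 / c) * (A + t * D))"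
      unfolding d pderiv_add pderiv_mult pderiv_smult
      by (simp add: pderiv_pCons algebra_simps A_def D_def)
    then have "(1 - t * t) * poly (pderiv (pderiv q)) t =
      (n + 1) * ((1 - t * t) * A + (1 / c) * ((1 - t * t) * A + t * ((1 - t * t) * D)))"
      by (simp only:) (simp add: algebra_simps add_divide_distrib diff_divide_distrib)
    also have "\<dots> = (c + 1 - n) * (t * ((n + 1) * (B + (1 / c) * (t * A))))
       - (n + 1) * (c + 1) * (t * B - (1 / c) * ((1 - t * t) * A))"
      unfolding ABD using AB by (cases "c = 0") (auto simp: field_simps)
    also have "\<dots> = poly (smult (c + 1 - n) ([:0, 1:] * pderiv q) - smult ((n + 1) * (c + 1)) q) t"
      unfolding d unfolding q by (simp add: A_def B_def algebra_simps diff_divide_distrib add_divide_distrib)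
    finally show "poly ([:1, 0, -1:] * pderiv (pderiv q)) t = \<dots>"
      by (simp add: algebra_simps)
  qed
qed

lemma ultra_ode:
  assumes "k \<ge> 1"
  shows "[:1, 0, -1:] * pderiv (pderiv (ultra k n)) =
      smult k ([:0, 1:] * pderiv (ultra k n)) - smult (n * (real n + real k - 1)) (ultra k n)"
proof (induction n)
  case (Suc n)
  have "real n + real k - 1 \<noteq> 0 \<or> pderiv (ultra k n) = 0 \<and> real n = 0"
    using assms by (cases n) auto
  from ultra_ode_aux(2)[OF this] Suc show ?case by (simp add: ultra.simps add_ac)
qed simp

lemma ultra_ode_eval:
  assumes "k \<ge> 1"
  shows "(1 - t\<^sup>2) * poly (pderiv (pderiv (ultra k n))) t =
      k * t * poly (pderiv (ultra k n)) t - n * (real n + real k - 1) * poly (ultra k n) t"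
  using arg_cong[OF ultra_ode[OF assms, of n], of "\<lambda>r. poly r t"]
  by (simp add: algebra_simps power2_eq_square)

lemma pderiv_ultra_Suc:
  assumes "k \<ge> 1"
  shows "poly (pderiv (ultra k (Suc n))) t = (real n + 1) *
    (poly (ultra k n) t + t * poly (pderiv (ultra k n)) t / (real n + real k - 1))"
proof -
  have "real n + real k - 1 \<noteq> 0 \<or> pderiv (ultra k n) = 0 \<and> real n = 0"
    using assms by (cases n) auto
  from ultra_ode_aux(1)[OF this _ ultra.simps(2)] ultra_ode[OF assms, of n] show ?thesis by simp
qed

lemma poly_ultra_Suc:
  "poly (ultra k (Suc n)) t = t * poly (ultra k n) t
     - (1 - t\<^sup>2) * poly (pderiv (ultra k n)) t / (real n + real k - 1)"
  by (simp add: power2_eq_square left_diff_distrib diff_divide_distrib)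

declare ultra.simps(2) [simp del]

lemma ultra_at_1 [simp]: "poly (ultra k n) 1 = 1"
  by (induction n) (auto simp: poly_ultra_Suc)

lemma ultra_parity: "poly (ultra k n) (- t) = (-1) ^ n * poly (ultra k n) t"
proof (induction n arbitrary: t)
  case (Suc n)
  have "pcompose (ultra k n) [:0, -1:] = smult ((-1) ^ n) (ultra k n)"
    by (rule poly_ext_real) (simp add: poly_pcompose Suc)
  from arg_cong[OF this, of pderiv]
  have "pcompose (pderiv (ultra k n)) [:0, -1:] * [:-1:] = smult ((-1) ^ n) (pderiv (ultra k n))"
    by (simp add: pderiv_pcompose pderiv_smult pderiv_pCons)
  from arg_cong[OF this, of "\<lambda>r. poly r t"]
  have "poly (pderiv (ultra k n)) (-t) = - ((-1) ^ n * poly (pderiv (ultra k n)) t)"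
    by (simp add: poly_pcompose)
  then have "poly (ultra k (Suc n)) (- t) = - (t * ((-1) ^ n * poly (ultra k n) t)
     - (1 - t\<^sup>2) * ((-1) ^ n * poly (pderiv (ultra k n)) t) / (real n + real k - 1))"
    unfolding poly_ultra_Suc Suc by simp
  also have "\<dots> = (-1) ^ Suc n * poly (ultra k (Suc n)) t"
    unfolding poly_ultra_Suc by (simp add: right_diff_distrib)
  finally show ?case .
qed simp

lemma ultra_degree:
  assumes "k \<ge> 1"
  shows "degree (ultra k n) \<le> n \<and> coeff (ultra k n) n > 0"
proof (induction n)
  case (Suc n)
  let ?c = "real n + real k - 1"
  have c: "?c \<ge> 0" using assms by auto
  have co: "coeff (ultra k (Suc n)) i = (if i = 0 then 0 else coeff (ultra k n) (i - 1))
     - (coeff (pderiv (ultra k n)) i - (if i < 2 then 0 else coeff (pderiv (ultra k n)) (i - 2))) / ?c" for i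
    by (auto simp: ultra.simps coeff_pCons' numeral_2_eq_2 split: if_splits)
  have z: "coeff (ultra k n) i = 0" if "i > n" for i using Suc that by (auto intro: coeff_eq_0)
  have "degree (ultra k (Suc n)) \<le> Suc n"
    by (intro degree_le allI impI) (auto simp: co coeff_pderiv z)
  moreover have "coeff (ultra k (Suc n)) (Suc n) =
    coeff (ultra k n) n + (if n = 0 then 0 else n * coeff (ultra k n) n / ?c)"
    by (auto simp: co coeff_pderiv z numeral_2_eq_2)
  then have "coeff (ultra k (Suc n)) (Suc n) > 0"
    using Suc c by (auto intro!: add_pos_nonneg divide_nonneg_nonneg mult_nonneg_nonneg)
  ultimately show ?case by blast
qed simp

lemma ultra_span:
  assumes "k \<ge> 1" and "degree p \<le> d"
  obtains b where "p = (\<Sum>n\<le>d. smult (b n) (ultra k n))"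
proof -
  have "\<exists>b. p = (\<Sum>n\<le>d. smult (b n) (ultra k n))" using assms(2)
  proof (induction d arbitrary: p)
    case 0
    then obtain a where "p = [:a:]" by (metis degree_eq_zeroE le_zero_eq)
    then show ?case by (intro exI[of _ "\<lambda>_. a"]) simp
  next
    case (Suc d)
    define a where "a = coeff p (Suc d) / coeff (ultra k (Suc d)) (Suc d)"
    have u: "degree (ultra k (Suc d)) \<le> Suc d" "coeff (ultra k (Suc d)) (Suc d) > 0"
      using ultra_degree[OF assms(1)] by auto
    have "degree (p - smult a (ultra k (Suc d))) \<le> d"
    proof (intro degree_le allI impI)
      fix i assume "d < i"
      show "coeff (p - smult a (ultra k (Suc d))) i = 0"
      proof (cases "i = Suc d")
        case True then show ?thesis using u by (simp add: a_def)
      next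
        case False
        with \<open>d < i\<close> have "i > Suc d" by simp
        then show ?thesis using u Suc.prems by (simp add: coeff_eq_0)
      qed
    qed
    from Suc.IH[OF this] obtain b where b: "p - smult a (ultra k (Suc d)) = (\<Sum>n\<le>d. smult (b n) (ultra k n))" ..
    have "p = (\<Sum>n\<le>Suc d. smult ((b(Suc d := a)) n) (ultra k n))"
      using b by (simp add: algebra_simps)
    then show ?case by blast
  qed
  then show ?thesis using that by blast
qed

section \<open>Integration of zonal functions, orthogonality and norms\<close>

text \<open>For \<open>k > 0\<close> this is the integral of a zonal function over S^k in the polar
  angle, up to the volume of S^(k-1). For \<open>k = 0\<close> it is counting measure on S^0, the
  base of the later induction on the dimension and the slice of the circle.\<close>

definition zonal_int :: "nat \<Rightarrow> (real \<Rightarrow> real) \<Rightarrow> real" where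
  "zonal_int k g = (if k = 0 then g 1 + g (-1)
     else integral {0..pi} (\<lambda>\<theta>. g (cos \<theta>) * sin \<theta> ^ (k - 1)))"

lemma continuous_on_compose_cos:
  fixes g :: "real \<Rightarrow> real"
  shows "continuous_on {-1..1} g \<Longrightarrow> continuous_on S (\<lambda>\<theta>. g (cos \<theta>))"
  by (rule continuous_on_compose2[of "{-1..1}" g]) (auto intro!: continuous_intros)

lemma zonal_integrable:
  fixes g :: "real \<Rightarrow> real"
  assumes "continuous_on {-1..1} g"
  shows "(\<lambda>\<theta>. g (cos \<theta>) * sin \<theta> ^ j) integrable_on {0..pi}"
  by (intro integrable_continuous_real continuous_intros continuous_on_compose_cos assms)

lemma zonal_int_cong:
  assumes "\<And>t. -1 \<le> t \<Longrightarrow> t \<le> 1 \<Longrightarrow> f t = g t"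
  shows "zonal_int k f = zonal_int k g"
  using assms by (auto simp: zonal_int_def intro!: integral_cong)

lemma zonal_int_add:
  assumes "continuous_on {-1..1} f" "continuous_on {-1..1} g"
  shows "zonal_int k (\<lambda>t. f t + g t) = zonal_int k f + zonal_int k g"
  using zonal_integrable[OF assms(1)] zonal_integrable[OF assms(2)]
  by (auto simp: zonal_int_def distrib_right integral_add)

lemma zonal_int_cmult: "zonal_int k (\<lambda>t. c * f t) = c * zonal_int k f"
  by (auto simp: zonal_int_def mult.assoc distrib_left)

lemma zonal_int_diff:
  assumes "continuous_on {-1..1} f" "continuous_on {-1..1} g"
  shows "zonal_int k (\<lambda>t. f t - g t) = zonal_int k f - zonal_int k g"
  using zonal_int_add[OF assms(1), of "\<lambda>t. (-1) * g t" k] assms zonal_int_cmult[of k "-1" g]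
  by (auto intro!: continuous_intros)

lemma zonal_int_sum:
  assumes "finite I" "\<And>i. i \<in> I \<Longrightarrow> continuous_on {-1..1} (f i)"
  shows "zonal_int k (\<lambda>t. \<Sum>i\<in>I. f i t) = (\<Sum>i\<in>I. zonal_int k (f i))"
  using assms
proof (induction I rule: finite_induct)
  case empty show ?case by (simp add: zonal_int_def)
next
  case (insert x F)
  then show ?case
    by (simp, subst zonal_int_add) (auto intro!: continuous_on_sum)
qed

lemma zonal_int_mono:
  assumes "continuous_on {-1..1} f" "continuous_on {-1..1} g"
    and "\<And>t. -1 \<le> t \<Longrightarrow> t \<le> 1 \<Longrightarrow> f t \<le> g t"
  shows "zonal_int k f \<le> zonal_int k g"
  using zonal_integrable[OF assms(1)] zonal_integrable[OF assms(2)] assms(3)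
  by (auto simp: zonal_int_def intro!: integral_le mult_right_mono add_mono zero_le_power sin_ge_zero)

lemma zonal_int_nonneg:
  assumes "continuous_on {-1..1} f" "\<And>t. -1 \<le> t \<Longrightarrow> t \<le> 1 \<Longrightarrow> f t \<ge> 0"
  shows "zonal_int k f \<ge> 0"
  using zonal_int_mono[OF continuous_on_const assms(1), of 0 k] assms(2) zonal_int_cmult[of k 0 f]
  by simp

lemma zonal_int_abs_le:
  assumes "continuous_on {-1..1} f" "\<And>t. -1 \<le> t \<Longrightarrow> t \<le> 1 \<Longrightarrow> \<bar>f t\<bar> \<le> B"
  shows "\<bar>zonal_int k f\<bar> \<le> B * zonal_int k (\<lambda>_. 1)"
proof -
  have B: "f t \<le> B * 1" "(-B) * 1 \<le> f t" if "-1 \<le> t" "t \<le> 1" for t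
    using assms(2)[OF that] by linarith+
  have "zonal_int k f \<le> zonal_int k (\<lambda>_. B * 1)"
    by (intro zonal_int_mono assms continuous_on_const B)
  moreover have "zonal_int k (\<lambda>_. (-B) * 1) \<le> zonal_int k f"
    by (intro zonal_int_mono assms continuous_on_const B)
  ultimately show ?thesis unfolding zonal_int_cmult by (simp add: abs_le_iff)
qed

lemma zonal_int_pos:
  assumes f: "continuous_on {-1..1} f" "\<And>t. -1 \<le> t \<Longrightarrow> t \<le> 1 \<Longrightarrow> f t \<ge> 0"
    and s: "-1 < s" "s < 1" "f s > 0" and k: "k \<ge> 1"
  shows "zonal_int k f > 0"
proof (rule ccontr)
  assume "\<not> ?thesis"
  with zonal_int_nonneg[OF f] have "zonal_int k f = 0" by (metis less_eq_real_def)
  then have "integral {0..pi} (\<lambda>\<theta>. f (cos \<theta>) * sin \<theta> ^ (k - 1)) = 0"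
    using k by (simp add: zonal_int_def)
  moreover have "continuous_on {0..pi} (\<lambda>\<theta>. f (cos \<theta>) * sin \<theta> ^ (k - 1))"
    by (intro continuous_intros continuous_on_compose_cos f)
  moreover have "f (cos \<theta>) * sin \<theta> ^ (k - 1) \<ge> 0" if "\<theta> \<in> {0..pi}" for \<theta>
    using that by (intro mult_nonneg_nonneg f zero_le_power sin_ge_zero) auto
  ultimately have "\<forall>\<theta>\<in>{0..pi}. f (cos \<theta>) * sin \<theta> ^ (k - 1) = 0"
    using integral_eq_0_iff[of 0 pi] by auto
  moreover have "arccos s \<in> {0..pi}" "cos (arccos s) = s" "sin (arccos s) > 0"
    using s by (auto simp: arccos_lbound arccos_ubound intro!: sin_gt_zero arccos_lt_bounded[THEN conjunct1] arccos_lt_bounded[THEN conjunct2])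
  ultimately show False using s by fastforce
qed

lemma zonal_int_one_pos: "k \<ge> 1 \<Longrightarrow> zonal_int k (\<lambda>_. 1) > 0"
  by (rule zonal_int_pos[of _ 0]) auto

text \<open>The integrand is the derivative of
  \<open>sin \<theta> ^ k * poly p (cos \<theta>)\<close>, which vanishes at both ends. This
  identity takes the place of Green's formula: moments, orthogonality, norms and the concentration
  of the bumps below all arise from a choice of \<open>p\<close>.\<close>

lemma zonal_int_by_parts:
  assumes "k \<ge> 1"
  shows "zonal_int k (\<lambda>t. k * t * poly p t - (1 - t\<^sup>2) * poly (pderiv p) t) = 0"
proof -
  define F where "F \<theta> = sin \<theta> ^ k * poly p (cos \<theta>)" for \<theta> :: real
  have "(F has_real_derivative
      (k * cos \<theta> * poly p (cos \<theta>) - (1 - (cos \<theta>)\<^sup>2) * poly (pderiv p) (cos \<theta>)) * sin \<theta> ^ (k - 1)) (at \<theta> within S)" for \<theta> S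
  proof -
    obtain j where j: "k = Suc j" using assms by (cases k) auto
    have s: "1 - (cos \<theta>)\<^sup>2 = sin \<theta> * sin \<theta>" by (simp add: sin_squared_eq flip: power2_eq_square)
    show ?thesis unfolding F_def
      by (rule derivative_eq_intros DERIV_chain2[OF poly_DERIV] refl | simp)+
         (simp add: j s algebra_simps)
  qed
  then have "((\<lambda>\<theta>. (k * cos \<theta> * poly p (cos \<theta>) - (1 - (cos \<theta>)\<^sup>2) * poly (pderiv p) (cos \<theta>)) * sin \<theta> ^ (k - 1))
     has_integral F pi - F 0) {0..pi}"
    by (intro fundamental_theorem_of_calculus) (auto simp: has_real_derivative_iff_has_vector_derivative)
  then show ?thesis using assms by (simp add: zonal_int_def F_def integral_unique zero_power)
qed

text \<open>Integration by parts for a monomial. At \<open>j = 0\<close> the truncated exponent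
  \<open>j - 1\<close> is paired with the coefficient 0, and the identity says that the mean of t
  vanishes for \<open>k > 0\<close>.\<close>

lemma zonal_int_moment:
  "j * zonal_int k (\<lambda>t. t ^ (j - 1)) = (real j + k) * zonal_int k (\<lambda>t. t ^ (j + 1))"
proof (cases "k = 0 \<or> j = 0")
  case True
  have "zonal_int k (\<lambda>t. t) = 0" if "k \<ge> 1"
    using zonal_int_by_parts[OF that, of 1] zonal_int_cmult[of k k "\<lambda>t. t"] that by simp
  then show ?thesis using True by (cases "k = 0") (auto simp: zonal_int_def uminus_power_if)
next
  case False
  then have k: "k \<ge> 1" and j: "j \<ge> 1" by auto
  have "0 = zonal_int k (\<lambda>t. k * t * poly (monom 1 j) t - (1 - t\<^sup>2) * poly (pderiv (monom 1 j)) t)"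
    using zonal_int_by_parts[OF k] by simp
  also have "\<dots> = zonal_int k (\<lambda>t. (real j + k) * t ^ (j + 1) - j * t ^ (j - 1))"
    using j by (intro zonal_int_cong)
      (cases j, auto simp: poly_monom pderiv_monom algebra_simps power2_eq_square)
  also have "\<dots> = (real j + k) * zonal_int k (\<lambda>t. t ^ (j + 1)) - j * zonal_int k (\<lambda>t. t ^ (j - 1))"
    by (subst zonal_int_diff) (auto intro!: continuous_intros simp: zonal_int_cmult simp del: power_Suc)
  finally show ?thesis by simp
qed

lemma ultra_orthogonal:
  assumes k: "k \<ge> 1" and "i \<noteq> j"
  shows "zonal_int k (\<lambda>t. poly (ultra k i) t * poly (ultra k j) t) = 0"
proof -
  define u v where "u = ultra k i" and "v = ultra k j"
  \<comment> \<open>The Wronskian makes the products of two first derivatives cancel, so that only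
    the difference of the eigenvalues survives.\<close>
  define p where "p = u * pderiv v - v * pderiv u"
  define \<nu> where "\<nu> n = n * (real n + real k - 1)" for n :: nat
  have "0 = zonal_int k (\<lambda>t. k * t * poly p t - (1 - t\<^sup>2) * poly (pderiv p) t)"
    using zonal_int_by_parts[OF k] by simp
  also have "\<dots> = zonal_int k (\<lambda>t. (\<nu> j - \<nu> i) * (poly u t * poly v t))"
  proof (rule zonal_int_cong)
    fix t :: real
    have "k * t * poly p t - (1 - t\<^sup>2) * poly (pderiv p) t =
      poly u t * (k * t * poly (pderiv v) t - (1 - t\<^sup>2) * poly (pderiv (pderiv v)) t)
      - poly v t * (k * t * poly (pderiv u) t - (1 - t\<^sup>2) * poly (pderiv (pderiv u)) t)"
      unfolding p_def by (simp add: pderiv_diff pderiv_mult algebra_simps)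
    also have "\<dots> = (\<nu> j - \<nu> i) * (poly u t * poly v t)"
      unfolding u_def v_def ultra_ode_eval[OF k] by (simp add: \<nu>_def algebra_simps)
    finally show "k * t * poly p t - (1 - t\<^sup>2) * poly (pderiv p) t = \<dots>" .
  qed
  also have "\<dots> = (\<nu> j - \<nu> i) * zonal_int k (\<lambda>t. poly u t * poly v t)"
    by (rule zonal_int_cmult)
  finally have "\<nu> j = \<nu> i \<or> ?thesis" by (simp add: u_def v_def)
  moreover have "\<nu> j \<noteq> \<nu> i"
  proof
    assume "\<nu> j = \<nu> i"
    then have "(real j - real i) * (real j + real i + real k - 1) = 0"
      by (simp add: \<nu>_def algebra_simps)
    then show False using assms by auto
  qed
  ultimately show ?thesis by blast
qed

definition ultra_norm :: "nat \<Rightarrow> nat \<Rightarrow> real" where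
  "ultra_norm k n = zonal_int k (\<lambda>t. (poly (ultra k n) t)\<^sup>2)"

lemma ultra_norm_pos:
  assumes "k \<ge> 1"
  shows "ultra_norm k n > 0"
proof -
  have "ultra k n \<noteq> 0" using ultra_at_1[of k n] by (metis poly_0 zero_neq_one)
  then have "finite {t. poly (ultra k n) t = 0}" by (rule poly_roots_finite)
  moreover have "infinite {-1<..<1::real}" by simp
  ultimately obtain s where "s \<in> {-1<..<1}" "poly (ultra k n) s \<noteq> 0"
    by (metis (mono_tags, lifting) finite_subset mem_Collect_eq subsetI)
  then show ?thesis unfolding ultra_norm_def
    by (intro zonal_int_pos[of _ s] assms) (auto intro!: continuous_intros)
qed

text \<open>Integration by parts with the product of the polynomial and its derivative. The identity
  evaluates the integral of the energy function in \<open>ultra_tendsto_0\<close>.\<close>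

lemma ultra_derivative_norm:
  assumes k: "k \<ge> 1"
  shows "zonal_int k (\<lambda>t. (1 - t\<^sup>2) * (poly (pderiv (ultra k n)) t)\<^sup>2) =
     n * (real n + real k - 1) * ultra_norm k n"
proof -
  define u where "u = ultra k n"
  have "0 = zonal_int k (\<lambda>t. k * t * poly (u * pderiv u) t - (1 - t\<^sup>2) * poly (pderiv (u * pderiv u)) t)"
    using zonal_int_by_parts[OF k, of "u * pderiv u"] by (rule sym)
  also have "\<dots> = zonal_int k (\<lambda>t. n * (real n + real k - 1) * (poly u t)\<^sup>2 - (1 - t\<^sup>2) * (poly (pderiv u) t)\<^sup>2)"
  proof (rule zonal_int_cong)
    fix t :: real
    have "k * t * poly (u * pderiv u) t - (1 - t\<^sup>2) * poly (pderiv (u * pderiv u)) t =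
      poly u t * (k * t * poly (pderiv u) t - (1 - t\<^sup>2) * poly (pderiv (pderiv u)) t)
      - (1 - t\<^sup>2) * (poly (pderiv u) t)\<^sup>2"
      by (simp add: pderiv_mult algebra_simps power2_eq_square)
    also have "\<dots> = n * (real n + real k - 1) * (poly u t)\<^sup>2 - (1 - t\<^sup>2) * (poly (pderiv u) t)\<^sup>2"
      unfolding u_def ultra_ode_eval[OF k] by (simp add: algebra_simps power2_eq_square)
    finally show "k * t * poly (u * pderiv u) t - (1 - t\<^sup>2) * poly (pderiv (u * pderiv u)) t = \<dots>" .
  qed
  also have "\<dots> = n * (real n + real k - 1) * ultra_norm k n
      - zonal_int k (\<lambda>t. (1 - t\<^sup>2) * (poly (pderiv u) t)\<^sup>2)"
    by (subst zonal_int_diff) (auto intro!: continuous_intros simp: zonal_int_cmult ultra_norm_def u_def)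
  finally show ?thesis by (simp add: u_def)
qed

text \<open>Inserting the formulas for the polynomial of degree n + 1 and for its derivative makes
  the terms with the derivative of \<open>ultra k n\<close> cancel, and t^2 + (1 - t^2) = 1
  remains.\<close>

lemma ultra_lowering:
  assumes "k \<ge> 1"
  shows "t * poly (ultra k (Suc n)) t + (1 - t\<^sup>2) * poly (pderiv (ultra k (Suc n))) t / (real n + 1)
    = poly (ultra k n) t"
proof -
  let ?E = "poly (ultra k n) t + t * poly (pderiv (ultra k n)) t / (real n + real k - 1)"
  have "(1 - t\<^sup>2) * ((real n + 1) * ?E) / (real n + 1) = (1 - t\<^sup>2) * ?E"
    by (simp add: add_nonneg_eq_0_iff)
  then show ?thesis unfolding poly_ultra_Suc pderiv_ultra_Suc[OF assms]
    by (simp add: power2_eq_square algebra_simps diff_divide_distrib add_divide_distrib)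
qed

text \<open>Three integrals X, Y, Z are linked by four relations: integration by parts gives Y + Z =
  k X, the raising recursion expresses the norm of degree n + 1, the lowering formula the norm of
  degree n, and orthogonality of the degrees n + 2 and n gives Z in terms of X. Eliminating Y and Z
  leaves both norms as multiples of X.\<close>

lemma ultra_norm_Suc:
  assumes k: "k \<ge> 1"
  shows "(real n + real k - 1) * (2 * n + k + 1) * ultra_norm k (Suc n)
    = (real n + 1) * (2 * real n + k - 1) * ultra_norm k n"
proof -
  define u v where "u = ultra k n" and "v = ultra k (Suc n)"
  define c where "c = real n + real k - 1"
  define X where "X = zonal_int k (\<lambda>t. t * poly u t * poly v t)"
  define Y where "Y = zonal_int k (\<lambda>t. (1 - t\<^sup>2) * poly (pderiv u) t * poly v t)"
  define Z where "Z = zonal_int k (\<lambda>t. (1 - t\<^sup>2) * poly (pderiv v) t * poly u t)"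
  note ci = continuous_intros
  have YZ: "Y + Z = k * X"
  proof -
    have "0 = zonal_int k (\<lambda>t. k * t * poly (u * v) t - (1 - t\<^sup>2) * poly (pderiv (u * v)) t)"
      using zonal_int_by_parts[OF k, of "u * v"] by (rule sym)
    also have "\<dots> = zonal_int k (\<lambda>t. k * (t * poly u t * poly v t) -
        ((1 - t\<^sup>2) * poly (pderiv u) t * poly v t + (1 - t\<^sup>2) * poly (pderiv v) t * poly u t))"
      by (rule zonal_int_cong) (simp add: pderiv_mult algebra_simps)
    also have "\<dots> = k * X - (Y + Z)"
      unfolding X_def Y_def Z_def
      by (subst zonal_int_diff, (intro ci)+, subst zonal_int_add, (intro ci)+) (simp add: zonal_int_cmult)
    finally show ?thesis by simp
  qed
  have eq1: "c * ultra_norm k (Suc n) = c * X - Y"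
  proof (cases "c = 0")
    case True
    then have "n = 0" using k by (simp add: c_def)
    then show ?thesis using True by (simp add: Y_def u_def zonal_int_def)
  next
    case False
    have "ultra_norm k (Suc n) = zonal_int k (\<lambda>t. t * poly u t * poly v t -
        (1 / c) * ((1 - t\<^sup>2) * poly (pderiv u) t * poly v t))"
      unfolding ultra_norm_def
    proof (rule zonal_int_cong)
      fix t
      have "(poly (ultra k (Suc n)) t)\<^sup>2 = (t * poly u t - (1 - t\<^sup>2) * poly (pderiv u) t / c) * poly v t"
        unfolding power2_eq_square[of "poly _ _"] v_def[symmetric]
        unfolding v_def poly_ultra_Suc u_def c_def by simp
      then show "(poly (ultra k (Suc n)) t)\<^sup>2 = t * poly u t * poly v t - (1 / c) * ((1 - t\<^sup>2) * poly (pderiv u) t * poly v t)"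
        by (simp add: left_diff_distrib)
    qed
    also have "\<dots> = X - (1 / c) * Y" unfolding X_def Y_def
      by (subst zonal_int_diff, (intro ci)+, subst zonal_int_cmult) simp
    finally show ?thesis using False by (simp add: field_simps)
  qed
  have eq2: "(real n + 1) * ultra_norm k n = (real n + 1) * X + Z"
  proof -
    have "ultra_norm k n = zonal_int k (\<lambda>t. t * poly u t * poly v t +
        (1 / (real n + 1)) * ((1 - t\<^sup>2) * poly (pderiv v) t * poly u t))"
      unfolding ultra_norm_def
    proof (rule zonal_int_cong)
      fix t
      have "(poly (ultra k n) t)\<^sup>2 = (t * poly v t + (1 - t\<^sup>2) * poly (pderiv v) t / (real n + 1)) * poly u t"
        unfolding v_def ultra_lowering[OF k] u_def by (simp add: power2_eq_square)
      then show "(poly (ultra k n) t)\<^sup>2 = t * poly u t * poly v t + (1 / (real n + 1)) * ((1 - t\<^sup>2) * poly (pderiv v) t * poly u t)"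
        by (simp add: distrib_right)
    qed
    also have "\<dots> = X + (1 / (real n + 1)) * Z" unfolding X_def Z_def
      by (subst zonal_int_add, (intro ci)+, subst zonal_int_cmult) simp
    finally show ?thesis by (simp add: field_simps)
  qed
  have eq3: "(c + 1) * X = Z"
  proof -
    have c1: "c + 1 > 0" using k by (simp add: c_def)
    have "0 = zonal_int k (\<lambda>t. poly (ultra k (Suc (Suc n))) t * poly (ultra k n) t)"
      by (subst ultra_orthogonal[OF k]) auto
    also have "\<dots> = zonal_int k (\<lambda>t. t * poly u t * poly v t -
        (1 / (c + 1)) * ((1 - t\<^sup>2) * poly (pderiv v) t * poly u t))"
    proof (rule zonal_int_cong)
      fix t
      have "poly (ultra k (Suc (Suc n))) t * poly (ultra k n) t =
         (t * poly v t - (1 - t\<^sup>2) * poly (pderiv v) t / (c + 1)) * poly u t"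
        unfolding poly_ultra_Suc[of k "Suc n"] v_def u_def c_def by (simp add: add_ac)
      then show "poly (ultra k (Suc (Suc n))) t * poly (ultra k n) t =
         t * poly u t * poly v t - (1 / (c + 1)) * ((1 - t\<^sup>2) * poly (pderiv v) t * poly u t)"
        by (simp add: left_diff_distrib)
    qed
    also have "\<dots> = X - (1 / (c + 1)) * Z" unfolding X_def Z_def
      by (subst zonal_int_diff, (intro ci)+, subst zonal_int_cmult) simp
    finally show ?thesis using c1 by (simp add: field_simps)
  qed
  have h0: "(real n + 1) * ultra_norm k n = (2 * real n + k + 1) * X"
    using eq2 eq3 by (simp add: c_def algebra_simps)
  have h1: "c * ultra_norm k (Suc n) = (2 * real n + k - 1) * X"
    using eq1 eq3 YZ by (simp add: c_def algebra_simps)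
  have "c * (2 * n + k + 1) * ultra_norm k (Suc n) = (2 * real n + k + 1) * (c * ultra_norm k (Suc n))"
    by simp
  also have "\<dots> = (2 * real n + k - 1) * ((real n + 1) * ultra_norm k n)"
    unfolding h1 h0 by simp
  finally show ?thesis by (simp add: c_def algebra_simps)
qed

text \<open>The product (2n + k - 1) times the norm does not increase, because n + 1 is at most n +
  k - 1 for \<open>k \<ge> 2\<close>. On the circle the norms of cos(n theta) do not decay.\<close>

lemma ultra_norm_tendsto_0:
  assumes k: "k \<ge> 2"
  shows "ultra_norm k \<longlonglongrightarrow> 0"
proof -
  have bound: "(2 * real n + k - 1) * ultra_norm k n \<le> (real k - 1) * ultra_norm k 0" for n
  proof (induction n)
    case (Suc n)
    have pos: "ultra_norm k n > 0" "ultra_norm k (Suc n) > 0" using k by (auto intro!: ultra_norm_pos)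
    have "(real n + real k - 1) * ((2 * n + k + 1) * ultra_norm k (Suc n))
      = (real n + 1) * ((2 * real n + k - 1) * ultra_norm k n)"
      using ultra_norm_Suc[of k n] k by (simp add: mult_ac)
    also have "\<dots> \<le> (real n + real k - 1) * ((2 * real n + k - 1) * ultra_norm k n)"
      using k pos by (intro mult_right_mono) auto
    finally have "(2 * n + k + 1) * ultra_norm k (Suc n) \<le> (2 * real n + k - 1) * ultra_norm k n"
      using k by (subst (asm) mult_le_cancel_left_pos) auto
    also note Suc
    finally show ?case by (simp add: algebra_simps)
  qed simp
  have "ultra_norm k n \<le> (real k - 1) * ultra_norm k 0 / real n" if "n \<ge> 1" for n
  proof -
    have "real n * ultra_norm k n \<le> (2 * real n + k - 1) * ultra_norm k n"
      using k that ultra_norm_pos[of k n] by (intro mult_right_mono) auto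
    also note bound
    finally show ?thesis using that by (simp add: field_simps)
  qed
  then have "\<forall>\<^sub>F n in sequentially. ultra_norm k n \<le> (real k - 1) * ultra_norm k 0 / real n"
    by (rule eventually_mono[OF eventually_ge_at_top[of 1]])
  moreover have "\<forall>\<^sub>F n in sequentially. 0 \<le> ultra_norm k n"
    using ultra_norm_pos[of k] k by (intro always_eventually) (auto intro: less_imp_le)
  moreover have "(\<lambda>n. (real k - 1) * ultra_norm k 0 / real n) \<longlonglongrightarrow> 0"
    by (rule lim_const_over_n)
  ultimately show ?thesis
    using tendsto_sandwich[of "\<lambda>_. 0" "ultra_norm k" sequentially] by auto
qed

section \<open>Factorisation of ultraspherical kernels on the sphere\<close>

text \<open>An algebra that is closed under partial derivatives away from the origin. It guarantees
  that functions produced by one raising step can be differentiated again in the next.\<close>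

inductive smooth_fun :: "nat \<Rightarrow> ((nat \<Rightarrow> real) \<Rightarrow> real) \<Rightarrow> bool" for k where
  const: "smooth_fun k (\<lambda>x. c)"
| coord: "smooth_fun k (\<lambda>x. x i)"
| norm: "smooth_fun k (\<lambda>x. sqrt (ip k x x))"
| inv_norm: "smooth_fun k (\<lambda>x. 1 / sqrt (ip k x x))"
| add: "smooth_fun k f \<Longrightarrow> smooth_fun k g \<Longrightarrow> smooth_fun k (\<lambda>x. f x + g x)"
| mult: "smooth_fun k f \<Longrightarrow> smooth_fun k g \<Longrightarrow> smooth_fun k (\<lambda>x. f x * g x)"

lemma ip_upd:
  assumes "i \<le> k"
  shows "ip k (x(i := s)) y = ip k x y + (s - x i) * y i"
    and "ip k y (x(i := s)) = ip k y x + (s - x i) * y i"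
    and "ip k (x(i := s)) (x(i := s)) = ip k x x + s\<^sup>2 - (x i)\<^sup>2"
proof -
  have *: "(\<Sum>j\<le>k. f j) = f i + (\<Sum>j\<in>{..k} - {i}. f j)" for f :: "nat \<Rightarrow> real"
    using assms by (subst sum.remove[of _ i]) auto
  have **: "(\<Sum>j\<in>{..k} - {i}. f (x(i := s)) j) = (\<Sum>j\<in>{..k} - {i}. f x j)"
    if "\<And>j z. j \<noteq> i \<Longrightarrow> f (z(i := s)) j = f z j" for f :: "(nat \<Rightarrow> real) \<Rightarrow> nat \<Rightarrow> real"
    using that by (intro sum.cong) auto
  show "ip k (x(i := s)) y = ip k x y + (s - x i) * y i"
    unfolding ip_def * using **[of "\<lambda>z j. z j * y j"] by (simp add: algebra_simps)
  show "ip k y (x(i := s)) = ip k y x + (s - x i) * y i"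
    unfolding ip_def * using **[of "\<lambda>z j. y j * z j"] by (simp add: algebra_simps)
  show "ip k (x(i := s)) (x(i := s)) = ip k x x + s\<^sup>2 - (x i)\<^sup>2"
    unfolding ip_def * using **[of "\<lambda>z j. z j * z j"] by (simp add: algebra_simps power2_eq_square)
qed

lemma ip_commute: "ip k x y = ip k y x"
  by (simp add: ip_def mult.commute)

lemma DERIV_norm_upd:
  assumes "i \<le> k" and x: "ip k x x > 0"
  shows "((\<lambda>s. sqrt (ip k (x(i := s)) (x(i := s)))) has_real_derivative x i / sqrt (ip k x x)) (at (x i))"
  unfolding ip_upd(3)[OF assms(1)] using x
  by (auto intro!: derivative_eq_intros simp: field_simps)

lemma DERIV_inv_norm_upd:
  assumes "i \<le> k" and x: "ip k x x > 0"
  shows "((\<lambda>s. 1 / sqrt (ip k (x(i := s)) (x(i := s)))) has_real_derivative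
     - (x i / sqrt (ip k x x)) / ip k x x) (at (x i))"
  using DERIV_inverse_fun[OF DERIV_norm_upd[OF assms]] x
  by (simp add: field_simps)

lemma smooth_fun_deriv:
  assumes "smooth_fun k f" and i: "i \<le> k"
  shows "\<exists>g. smooth_fun k g \<and> (\<forall>x. ip k x x > 0 \<longrightarrow>
     ((\<lambda>s. f (x(i := s))) has_real_derivative g x) (at (x i)))"
  using assms(1)
proof induction
  case (const c)
  show ?case by (intro exI[of _ "\<lambda>_. 0"]) (auto intro: smooth_fun.const)
next
  case (coord j)
  show ?case
    by (rule exI[of _ "\<lambda>_. if j = i then 1 else 0"])
       (cases "j = i"; auto intro!: derivative_eq_intros smooth_fun.const)
next
  case norm
  show ?case
  proof (intro exI conjI allI impI)
    show "smooth_fun k (\<lambda>x. x i * (1 / sqrt (ip k x x)))"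
      by (rule smooth_fun.mult[OF smooth_fun.coord smooth_fun.inv_norm])
    show "((\<lambda>s. sqrt (ip k (x(i := s)) (x(i := s)))) has_real_derivative x i * (1 / sqrt (ip k x x))) (at (x i))"
      if "ip k x x > 0" for x
      using DERIV_norm_upd[OF i that] by (simp only: times_divide_eq_right mult_1_right)
  qed
next
  case inv_norm
  have "- (x i / sqrt (ip k x x)) / ip k x x =
    (-1) * x i * (1 / sqrt (ip k x x)) * (1 / sqrt (ip k x x)) * (1 / sqrt (ip k x x))"
    if "ip k x x > 0" for x using that by simp
  then have e: "(-1) * x i * (1 / sqrt (ip k x x)) * (1 / sqrt (ip k x x)) * (1 / sqrt (ip k x x)) =
    - (x i / sqrt (ip k x x)) / ip k x x" if "ip k x x > 0" for x using that by metis
  show ?case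
  proof (intro exI conjI allI impI)
    show "smooth_fun k (\<lambda>x. (-1) * x i * (1 / sqrt (ip k x x)) * (1 / sqrt (ip k x x)) * (1 / sqrt (ip k x x)))"
      by (intro smooth_fun.intros)
    show "((\<lambda>s. 1 / sqrt (ip k (x(i := s)) (x(i := s)))) has_real_derivative
       (-1) * x i * (1 / sqrt (ip k x x)) * (1 / sqrt (ip k x x)) * (1 / sqrt (ip k x x))) (at (x i))"
      if "ip k x x > 0" for x
      unfolding e[OF that] by (rule DERIV_inv_norm_upd[OF i that])
  qed
next
  case (add f g)
  obtain f' g' where *: "smooth_fun k f'" "smooth_fun k g'"
    "\<And>x. ip k x x > 0 \<Longrightarrow> ((\<lambda>s. f (x(i := s))) has_real_derivative f' x) (at (x i))"
    "\<And>x. ip k x x > 0 \<Longrightarrow> ((\<lambda>s. g (x(i := s))) has_real_derivative g' x) (at (x i))"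
    using add.IH by blast
  then show ?case by (intro exI[of _ "\<lambda>x. f' x + g' x"] conjI allI impI smooth_fun.add DERIV_add)
next
  case (mult f g)
  obtain f' g' where *: "smooth_fun k f'" "smooth_fun k g'"
    "\<And>x. ip k x x > 0 \<Longrightarrow> ((\<lambda>s. f (x(i := s))) has_real_derivative f' x) (at (x i))"
    "\<And>x. ip k x x > 0 \<Longrightarrow> ((\<lambda>s. g (x(i := s))) has_real_derivative g' x) (at (x i))"
    using mult.IH by blast
  have "((\<lambda>s. f (x(i := s)) * g (x(i := s))) has_real_derivative f' x * g x + g' x * f x) (at (x i))"
    if "ip k x x > 0" for x using DERIV_mult[OF *(3,4)[OF that]] by simp
  with * mult.hyps show ?case
    by (intro exI[of _ "\<lambda>x. f' x * g x + g' x * f x"] conjI allI impI smooth_fun.add smooth_fun.mult)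
qed

text \<open>The extension of the inner product from the sphere that is homogeneous of degree 0 in
  each variable; it lives on an open set, so coordinate derivatives make sense.\<close>

definition normalized_ip :: "nat \<Rightarrow> (nat \<Rightarrow> real) \<Rightarrow> (nat \<Rightarrow> real) \<Rightarrow> real" where
  "normalized_ip k x y = ip k x y / (sqrt (ip k x x) * sqrt (ip k y y))"

text \<open>A Gram factorisation with the same functions in both variables, hence a certificate of
  positive definiteness. The index lists record the coordinate directions of the raising maps
  applied so far.\<close>

definition smooth_factors :: "nat \<Rightarrow> (nat list set) \<Rightarrow> (nat list \<Rightarrow> (nat \<Rightarrow> real) \<Rightarrow> real) \<Rightarrow> real poly \<Rightarrow> bool" where
  "smooth_factors k I \<phi> p \<longleftrightarrow> finite I \<and> (\<forall>a\<in>I. smooth_fun k (\<phi> a)) \<and>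
     (\<forall>x y. ip k x x > 0 \<longrightarrow> ip k y y > 0 \<longrightarrow>
        poly p (normalized_ip k x y) = (\<Sum>a\<in>I. \<phi> a x * \<phi> a y))"

lemma normalized_ip_commute: "normalized_ip k x y = normalized_ip k y x"
  by (simp add: normalized_ip_def ip_commute mult.commute)

lemma DERIV_normalized_ip:
  assumes i: "i \<le> k" and x: "ip k x x > 0" and y: "ip k y y > 0"
  shows "((\<lambda>s. normalized_ip k (x(i := s)) y) has_real_derivative
     (y i / sqrt (ip k y y) - normalized_ip k x y * (x i / sqrt (ip k x x))) / sqrt (ip k x x)) (at (x i))"
proof -
  define nx where "nx = sqrt (ip k x x)"
  have nx: "nx > 0" "ip k x x = nx * nx" using x by (auto simp: nx_def)
  have "((\<lambda>s. ip k (x(i := s)) y) has_real_derivative y i) (at (x i))"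
    unfolding ip_upd(1)[OF i] by (auto intro!: derivative_eq_intros)
  from DERIV_cmult_right[OF DERIV_mult[OF this DERIV_inv_norm_upd[OF i x]], of "1 / sqrt (ip k y y)"]
  have "((\<lambda>s. ip k (x(i := s)) y * (1 / sqrt (ip k (x(i := s)) (x(i := s)))) * (1 / sqrt (ip k y y)))
    has_real_derivative (y i * (1 / nx) + (- (x i / nx) / (nx * nx)) * ip k x y) * (1 / sqrt (ip k y y))) (at (x i))"
    unfolding nx(2)[symmetric] by (simp only: fun_upd_triv nx_def)
  moreover have "(y i * (1 / nx) + (- (x i / nx) / (nx * nx)) * ip k x y) * (1 / sqrt (ip k y y))
     = (y i / sqrt (ip k y y) - normalized_ip k x y * (x i / nx)) / nx"
    using nx(1) y unfolding normalized_ip_def nx_def[symmetric] by (simp add: field_simps)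
  moreover have "ip k (x(i := s)) y * (1 / sqrt (ip k (x(i := s)) (x(i := s)))) * (1 / sqrt (ip k y y))
     = normalized_ip k (x(i := s)) y" for s
    by (simp add: normalized_ip_def)
  ultimately show ?thesis by (simp only: nx_def)
qed

lemma eventually_ip_upd_pos:
  assumes i: "i \<le> k" and x: "ip k x x > 0"
  shows "\<forall>\<^sub>F s in nhds (x i). ip k (x(i := s)) (x(i := s)) > 0"
proof -
  have "isCont (\<lambda>s. ip k (x(i := s)) (x(i := s))) (x i)"
    unfolding ip_upd(3)[OF i] by (intro continuous_intros)
  then have "\<forall>\<^sub>F s in at (x i). ip k (x(i := s)) (x(i := s)) > 0"
    using order_tendstoD(1)[of _ _ "at (x i)" 0] x by (auto simp: isCont_def)
  then show ?thesis using x by (simp add: eventually_nhds_conv_at)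
qed

text \<open>The factorisation holds on an open set. Differentiating it in the i-th coordinate of
  \<open>x\<close>, then also in that of \<open>y\<close>, and comparing with the chain rule through
  \<open>normalized_ip\<close> determines these sums although the individual factors are
  unknown.\<close>

lemma smooth_factors_deriv:
  assumes S: "smooth_factors k I \<phi> p"
    and i: "i \<le> k"
    and d: "\<And>a x. a \<in> I \<Longrightarrow> ip k x x > 0 \<Longrightarrow> ((\<lambda>s. \<phi> a (x(i := s))) has_real_derivative d a x) (at (x i))"
    and x: "ip k x x > 0" and y: "ip k y y > 0"
  defines "t \<equiv> normalized_ip k x y" and "X \<equiv> x i / sqrt (ip k x x)" and "Y \<equiv> y i / sqrt (ip k y y)"
  shows "sqrt (ip k x x) * (\<Sum>a\<in>I. d a x * \<phi> a y) = poly (pderiv p) t * (Y - t * X)" (is ?A)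
    and "sqrt (ip k x x) * sqrt (ip k y y) * (\<Sum>a\<in>I. d a x * d a y) =
      poly (pderiv (pderiv p)) t * (X - t * Y) * (Y - t * X) + poly (pderiv p) t * (1 - Y\<^sup>2 - (X - t * Y) * X)" (is ?B)
proof -
  have fin: "finite I" using S by (simp add: smooth_factors_def)
  have eq: "poly p (normalized_ip k x y) = (\<Sum>a\<in>I. \<phi> a x * \<phi> a y)"
    if "ip k x x > 0" "ip k y y > 0" for x y using S that by (auto simp: smooth_factors_def)
  have A: "(\<Sum>a\<in>I. d a x * \<phi> a y) = poly (pderiv p) (normalized_ip k x y) *
      ((y i / sqrt (ip k y y) - normalized_ip k x y * (x i / sqrt (ip k x x))) / sqrt (ip k x x))"
    if x: "ip k x x > 0" and y: "ip k y y > 0" for x y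
  proof (rule DERIV_unique)
    show "((\<lambda>s. \<Sum>a\<in>I. \<phi> a (x(i := s)) * \<phi> a y) has_real_derivative (\<Sum>a\<in>I. d a x * \<phi> a y)) (at (x i))"
      by (intro DERIV_sum DERIV_cmult_right d x)
    have "((\<lambda>s. poly p (normalized_ip k (x(i := s)) y)) has_real_derivative poly (pderiv p) (normalized_ip k x y) *
      ((y i / sqrt (ip k y y) - normalized_ip k x y * (x i / sqrt (ip k x x))) / sqrt (ip k x x))) (at (x i))"
      by (rule DERIV_chain2[of "poly p"]) (use poly_DERIV DERIV_normalized_ip[OF i x y] in auto)
    moreover have "\<forall>\<^sub>F s in nhds (x i). poly p (normalized_ip k (x(i := s)) y) = (\<Sum>a\<in>I. \<phi> a (x(i := s)) * \<phi> a y)"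
      using eventually_ip_upd_pos[OF i x] by eventually_elim (rule eq[OF _ y])
    ultimately show "((\<lambda>s. \<Sum>a\<in>I. \<phi> a (x(i := s)) * \<phi> a y) has_real_derivative poly (pderiv p) (normalized_ip k x y) *
      ((y i / sqrt (ip k y y) - normalized_ip k x y * (x i / sqrt (ip k x x))) / sqrt (ip k x x))) (at (x i))"
      by (subst (asm) DERIV_cong_ev[OF refl _ refl]) auto
  qed
  show ?A using A[OF x y] x by (simp add: t_def X_def Y_def)
  let ?nx = "sqrt (ip k x x)" and ?ny = "sqrt (ip k y y)"
  have nx: "?nx > 0" "?ny > 0" using x y by auto
  have "(\<Sum>a\<in>I. d a x * d a y) =
      (poly (pderiv (pderiv p)) t * ((X - t * Y) / ?ny) * ((Y - t * X) / ?nx)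
       + ((1 / ?ny - Y * Y / ?ny) - (X - t * Y) / ?ny * X) / ?nx * poly (pderiv p) t)"
  proof (rule DERIV_unique)
    show "((\<lambda>s. \<Sum>a\<in>I. d a x * \<phi> a (y(i := s))) has_real_derivative (\<Sum>a\<in>I. d a x * d a y)) (at (y i))"
      by (intro DERIV_sum DERIV_cmult d y)
    have t': "((\<lambda>s. normalized_ip k x (y(i := s))) has_real_derivative (X - t * Y) / ?ny) (at (y i))"
      using DERIV_normalized_ip[OF i y x] by (simp add: normalized_ip_commute t_def X_def Y_def)
    have "((\<lambda>s. s * (1 / sqrt (ip k (y(i := s)) (y(i := s))))) has_real_derivative
        1 * (1 / sqrt (ip k (y(i := y i)) (y(i := y i)))) + - (y i / ?ny) / ip k y y * y i) (at (y i))"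
      by (rule DERIV_mult[OF DERIV_ident DERIV_inv_norm_upd[OF i y]])
    moreover have "1 * (1 / sqrt (ip k (y(i := y i)) (y(i := y i)))) + - (y i / ?ny) / ip k y y * y i = 1 / ?ny - Y * Y / ?ny"
      using y by (simp add: Y_def field_simps)
    ultimately have Y': "((\<lambda>s. s / sqrt (ip k (y(i := s)) (y(i := s)))) has_real_derivative (1 / ?ny - Y * Y / ?ny)) (at (y i))"
      by simp
    have P': "((\<lambda>s. poly (pderiv p) (normalized_ip k x (y(i := s)))) has_real_derivative
       poly (pderiv (pderiv p)) t * ((X - t * Y) / ?ny)) (at (y i))"
      by (rule DERIV_chain2[of "poly (pderiv p)"]) (use poly_DERIV[of "pderiv p"] t' in \<open>auto simp: t_def\<close>)
    have "((\<lambda>s. poly (pderiv p) (normalized_ip k x (y(i := s))) *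
        ((s / sqrt (ip k (y(i := s)) (y(i := s))) - normalized_ip k x (y(i := s)) * X) / ?nx)) has_real_derivative
        (poly (pderiv (pderiv p)) t * ((X - t * Y) / ?ny) * ((Y - t * X) / ?nx)
       + ((1 / ?ny - Y * Y / ?ny) - (X - t * Y) / ?ny * X) / ?nx * poly (pderiv p) t)) (at (y i))"
      using DERIV_mult[OF P' DERIV_cdivide[OF DERIV_diff[OF Y' DERIV_cmult_right[OF t', of X]], of ?nx]]
      by (simp add: t_def Y_def)
    moreover have "\<forall>\<^sub>F s in nhds (y i). poly (pderiv p) (normalized_ip k x (y(i := s))) *
        ((s / sqrt (ip k (y(i := s)) (y(i := s))) - normalized_ip k x (y(i := s)) * X) / ?nx) =
        (\<Sum>a\<in>I. d a x * \<phi> a (y(i := s)))"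
      using eventually_ip_upd_pos[OF i y] by eventually_elim (simp add: A[OF x] X_def)
    ultimately show "((\<lambda>s. \<Sum>a\<in>I. d a x * \<phi> a (y(i := s))) has_real_derivative
        (poly (pderiv (pderiv p)) t * ((X - t * Y) / ?ny) * ((Y - t * X) / ?nx)
       + ((1 / ?ny - Y * Y / ?ny) - (X - t * Y) / ?ny * X) / ?nx * poly (pderiv p) t)) (at (y i))"
      by (subst (asm) DERIV_cong_ev[OF refl _ refl]) auto
  qed
  moreover have "a * b * (P * (U / b) * (V / a) + ((1 / b - Y * Y / b) - U / b * X) / a * Q)
      = P * U * V + Q * (1 - Y\<^sup>2 - U * X)" if "a > 0" "b > 0" for a b P Q U V
    using that by (simp add: field_simps power2_eq_square)
  from this[OF nx] have "?nx * ?ny * (poly (pderiv (pderiv p)) t * ((X - t * Y) / ?ny) * ((Y - t * X) / ?nx)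
       + ((1 / ?ny - Y * Y / ?ny) - (X - t * Y) / ?ny * X) / ?nx * poly (pderiv p) t) =
       poly (pderiv (pderiv p)) t * (X - t * Y) * (Y - t * X) + poly (pderiv p) t * (1 - Y\<^sup>2 - (X - t * Y) * X)" .
  ultimately show ?B by (simp only:)
qed

lemma sum_normalized:
  assumes x: "ip k x x > 0" and y: "ip k y y > 0"
  shows "(\<Sum>i\<le>k. (x i / sqrt (ip k x x))\<^sup>2) = 1"
    and "(\<Sum>i\<le>k. (x i / sqrt (ip k x x)) * (y i / sqrt (ip k y y))) = normalized_ip k x y"
proof -
  have "(\<Sum>i\<le>k. (x i / sqrt (ip k x x))\<^sup>2) = (\<Sum>i\<le>k. x i * x i) / ip k x x"
    using x by (simp add: power_divide sum_divide_distrib power2_eq_square)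
  then show "(\<Sum>i\<le>k. (x i / sqrt (ip k x x))\<^sup>2) = 1" using x by (simp add: ip_def)
  show "(\<Sum>i\<le>k. (x i / sqrt (ip k x x)) * (y i / sqrt (ip k y y))) = normalized_ip k x y"
    by (simp add: normalized_ip_def ip_def sum_divide_distrib)
qed

text \<open>The maps \<open>x \<mapsto> c x\<^sub>i \<phi> - |x| \<partial>\<^sub>i \<phi>\<close> raise the degree of a spherical harmonic by one;
  summing over \<open>i\<close> produces exactly the raising recursion that defines \<^const>\<open>ultra\<close>.\<close>

lemma ultra_smooth_factors:
  assumes k: "k \<ge> 1"
  shows "\<exists>I \<phi>. smooth_factors k I \<phi> (ultra k n)"
proof (induction n)
  case 0
  show ?case
    by (intro exI[of _ "{[]}"] exI[of _ "\<lambda>_ _. 1"])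
       (auto simp: smooth_factors_def intro: smooth_fun.const)
next
  case (Suc n)
  show ?case
  proof (cases "n = 0")
    \<comment> \<open>Degree 1 is factored directly by the normalised coordinates: for
      \<open>k = 1\<close> and \<open>n = 0\<close> the constant \<open>c\<close> of the general
      step would be 0 and the scaling by \<open>K\<close> would break down.\<close>
    case True
    have "smooth_factors k ((\<lambda>i. [i]) ` {..k}) (\<lambda>a x. x (hd a) * (1 / sqrt (ip k x x))) (ultra k 1)"
      unfolding smooth_factors_def
    proof (intro conjI allI impI ballI)
      fix x y assume "0 < ip k x x" "0 < ip k y y"
      then show "poly (ultra k 1) (normalized_ip k x y) =
         (\<Sum>a\<in>(\<lambda>i. [i]) ` {..k}. x (hd a) * (1 / sqrt (ip k x x)) * (y (hd a) * (1 / sqrt (ip k y y))))"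
        using sum_normalized(2)[of k x y]
        by (subst sum.reindex) (auto simp: inj_on_def ultra.simps)
    qed (simp, rule smooth_fun.mult[OF smooth_fun.coord smooth_fun.inv_norm])
    then show ?thesis unfolding True by auto
  next
    case False
    from Suc obtain I \<phi> where S: "smooth_factors k I \<phi> (ultra k n)" by blast
    define p where "p = ultra k n"
    define c where "c = real n + real k - 1"
    have c: "c > 0" using k False by (simp add: c_def)
    have sm: "smooth_fun k (\<phi> a)" if "a \<in> I" for a using S that by (auto simp: smooth_factors_def)
    have fin: "finite I" using S by (auto simp: smooth_factors_def)
    have "\<forall>i a. \<exists>g. i \<le> k \<longrightarrow> a \<in> I \<longrightarrow> smooth_fun k g \<and> (\<forall>x. ip k x x > 0 \<longrightarrow>
         ((\<lambda>s. \<phi> a (x(i := s))) has_real_derivative g x) (at (x i)))"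
      using smooth_fun_deriv[OF sm] by blast
    then obtain d where d: "\<And>i a. i \<le> k \<Longrightarrow> a \<in> I \<Longrightarrow> smooth_fun k (d i a)"
      "\<And>i a x. i \<le> k \<Longrightarrow> a \<in> I \<Longrightarrow> ip k x x > 0 \<Longrightarrow> ((\<lambda>s. \<phi> a (x(i := s))) has_real_derivative d i a x) (at (x i))"
      by metis
    \<comment> \<open>The sum over all directions turns out to be \<open>c * (c + n)\<close> times
      the next polynomial, and \<open>K\<close> removes this factor evenly from both
      variables.\<close>
    define K where "K = 1 / sqrt (c * (c + n))"
    define \<psi> where "\<psi> b x = K * (c * (x (hd b) * (1 / sqrt (ip k x x)) * \<phi> (tl b) x)
        + (-1) * (sqrt (ip k x x) * d (hd b) (tl b) x))" for b x
    define J where "J = (\<lambda>(i, a). i # a) ` ({..k} \<times> I)"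
    have "smooth_factors k J \<psi> (ultra k (Suc n))"
      unfolding smooth_factors_def
    proof (intro conjI allI impI ballI)
      show "finite J" using fin by (simp add: J_def)
      show "smooth_fun k (\<psi> b)" if bJ: "b \<in> J" for b
      proof -
        obtain i a where b: "b = i # a" and i: "i \<le> k" "a \<in> I"
          using bJ by (auto simp: J_def)
        have "\<psi> b = (\<lambda>x. K * (c * (x i * (1 / sqrt (ip k x x)) * \<phi> a x) + (-1) * (sqrt (ip k x x) * d i a x)))"
          by (rule ext) (simp add: \<psi>_def b)
        then show ?thesis
          by (simp only:) (intro smooth_fun.intros d(1) sm i)
      qed
    next
      fix x y assume xy: "0 < ip k x x" "0 < ip k y y"
      define t where "t = normalized_ip k x y"
      define X where "X i = x i / sqrt (ip k x x)" for i
      define Y where "Y i = y i / sqrt (ip k y y)" for i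
      define q q' q'' where "q = poly p t" and "q' = poly (pderiv p) t" and "q'' = poly (pderiv (pderiv p)) t"
      define nx ny where "nx = sqrt (ip k x x)" and "ny = sqrt (ip k y y)"
      have K2: "K * K = 1 / (c * (c + n))" using c by (simp add: K_def)
      have T: "(\<Sum>a\<in>I. \<psi> (i # a) x * \<psi> (i # a) y) = K * K * (c\<^sup>2 * q * (X i * Y i)
          - c * q' * (X i * X i - t * (X i * Y i)) - c * q' * (Y i * Y i - t * (X i * Y i))
          + q'' * (X i * Y i - t * (X i * X i) - t * (Y i * Y i) + t\<^sup>2 * (X i * Y i))
          + q' * (1 - Y i * Y i - X i * X i + t * (X i * Y i)))"
        if i: "i \<le> k" for i
      proof -
        note D = smooth_factors_deriv[OF S i d(2)[OF i]]
        have 0: "(\<Sum>a\<in>I. \<phi> a x * \<phi> a y) = q"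
          using S xy by (auto simp: smooth_factors_def q_def p_def t_def)
        have 1: "nx * (\<Sum>a\<in>I. d i a x * \<phi> a y) = q' * (Y i - t * X i)"
          using D(1)[OF _ _ xy] by (simp add: nx_def q'_def p_def t_def X_def Y_def)
        have 2: "ny * (\<Sum>a\<in>I. \<phi> a x * d i a y) = q' * (X i - t * Y i)"
          using D(1)[OF _ _ xy(2,1)]
          by (simp add: ny_def q'_def p_def t_def X_def Y_def normalized_ip_commute[of k x y] mult.commute)
        have 3: "nx * ny * (\<Sum>a\<in>I. d i a x * d i a y) =
          q'' * (X i - t * Y i) * (Y i - t * X i) + q' * (1 - (Y i)\<^sup>2 - (X i - t * Y i) * X i)"
          using D(2)[OF _ _ xy] by (simp add: nx_def ny_def q'_def q''_def p_def t_def X_def Y_def)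
        have "(\<Sum>a\<in>I. \<psi> (i # a) x * \<psi> (i # a) y) = (\<Sum>a\<in>I. K * K * (c\<^sup>2 * X i * Y i * (\<phi> a x * \<phi> a y)
            - c * Y i * (nx * (d i a x * \<phi> a y)) - c * X i * (ny * (\<phi> a x * d i a y))
            + nx * ny * (d i a x * d i a y)))"
          by (intro sum.cong) (auto simp: \<psi>_def X_def Y_def nx_def ny_def algebra_simps power2_eq_square)
        also have "\<dots> = K * K * (c\<^sup>2 * X i * Y i * (\<Sum>a\<in>I. \<phi> a x * \<phi> a y)
            - c * Y i * (nx * (\<Sum>a\<in>I. d i a x * \<phi> a y)) - c * X i * (ny * (\<Sum>a\<in>I. \<phi> a x * d i a y))
            + nx * ny * (\<Sum>a\<in>I. d i a x * d i a y))"
          by (simp add: sum.distrib sum_subtractf flip: sum_distrib_left)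
        also have "\<dots> = K * K * (c\<^sup>2 * q * (X i * Y i)
          - c * q' * (X i * X i - t * (X i * Y i)) - c * q' * (Y i * Y i - t * (X i * Y i))
          + q'' * (X i * Y i - t * (X i * X i) - t * (Y i * Y i) + t\<^sup>2 * (X i * Y i))
          + q' * (1 - Y i * Y i - X i * X i + t * (X i * Y i)))"
          unfolding 0 1 2 3 by (simp add: algebra_simps power2_eq_square)
        finally show ?thesis .
      qed
      have XX: "(\<Sum>i\<le>k. X i * X i) = 1" and YY: "(\<Sum>i\<le>k. Y i * Y i) = 1" and XY: "(\<Sum>i\<le>k. X i * Y i) = t"
        using sum_normalized[OF xy] sum_normalized(1)[OF xy(2) xy(1)] by (auto simp: X_def Y_def t_def power2_eq_square)
      have "(\<Sum>b\<in>J. \<psi> b x * \<psi> b y) = (\<Sum>i\<le>k. \<Sum>a\<in>I. \<psi> (i # a) x * \<psi> (i # a) y)"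
        unfolding J_def by (subst sum.reindex) (auto simp: inj_on_def sum.cartesian_product intro!: sum.cong)
      also have "\<dots> = (\<Sum>i\<le>k. K * K * (c\<^sup>2 * q * (X i * Y i)
          - c * q' * (X i * X i - t * (X i * Y i)) - c * q' * (Y i * Y i - t * (X i * Y i))
          + q'' * (X i * Y i - t * (X i * X i) - t * (Y i * Y i) + t\<^sup>2 * (X i * Y i))
          + q' * (1 - Y i * Y i - X i * X i + t * (X i * Y i))))"
        by (intro sum.cong T) auto
      also have "\<dots> = K * K * (c\<^sup>2 * q * t - c * q' * (1 - t * t) - c * q' * (1 - t * t)
          + q'' * (t - t - t + t\<^sup>2 * t) + q' * (real (Suc k) - 1 - 1 + t * t))"
        by (simp add: sum.distrib sum_subtractf XX YY XY flip: sum_distrib_left)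
      also have "\<dots> = K * K * (c\<^sup>2 * q * t - 2 * c * q' * (1 - t\<^sup>2) - t * ((1 - t\<^sup>2) * q'') + q' * (real k - 1 + t\<^sup>2))"
        by (simp add: algebra_simps power2_eq_square)
      also have "\<dots> = K * K * ((c * (c + n)) * (t * q - (1 - t\<^sup>2) * q' / c))"
      proof -
        \<comment> \<open>The mixed derivatives leave a term with \<open>q''\<close>; the
          differential equation eliminates it, and the rest is the raising recursion times
          \<open>c * (c + n)\<close>.\<close>
        have ode: "(1 - t\<^sup>2) * q'' = k * t * q' - n * c * q"
          unfolding q''_def p_def ultra_ode_eval[OF k] by (simp add: q_def q'_def p_def c_def)
        have k': "real k = c + 1 - n" by (simp add: c_def)
        have "c * (c + n) * (t * q - (1 - t\<^sup>2) * q' / c) = (c + n) * (c * t * q - (1 - t\<^sup>2) * q')"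
          using c by (simp add: field_simps)
        then show ?thesis
          unfolding ode k' by (simp add: algebra_simps power2_eq_square)
      qed
      also have "\<dots> = poly (ultra k (Suc n)) t"
        unfolding K2 poly_ultra_Suc using c by (simp add: q_def q'_def p_def c_def)
      finally show "poly (ultra k (Suc n)) (normalized_ip k x y) = (\<Sum>b\<in>J. \<psi> b x * \<psi> b y)"
        by (simp add: t_def)
    qed
    then show ?thesis by blast
  qed
qed

lemma sph_ip: "x \<in> sph k \<Longrightarrow> ip k x x = 1"
  by (simp add: sph_def ip_def power2_eq_square)

lemma ultra_factors:
  assumes "k \<ge> 1"
  obtains I :: "nat list set" and \<phi> where "finite I"
    "\<And>x y. x \<in> sph k \<Longrightarrow> y \<in> sph k \<Longrightarrow> poly (ultra k n) (ip k x y) = (\<Sum>a\<in>I. \<phi> a x * \<phi> a y)"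
proof -
  obtain I \<phi> where *: "smooth_factors k I \<phi> (ultra k n)" using ultra_smooth_factors[OF assms] by blast
  show ?thesis
  proof (rule that[of I \<phi>])
    show "finite I" using * by (simp add: smooth_factors_def)
    show "poly (ultra k n) (ip k x y) = (\<Sum>a\<in>I. \<phi> a x * \<phi> a y)"
      if "x \<in> sph k" "y \<in> sph k" for x y
    proof -
      have "poly (ultra k n) (normalized_ip k x y) = (\<Sum>a\<in>I. \<phi> a x * \<phi> a y)"
        using * that unfolding smooth_factors_def by (metis sph_ip zero_less_one)
      then show ?thesis using that by (simp add: normalized_ip_def sph_ip)
    qed
  qed
qed

section \<open>Positive definite zonal functions\<close>

text \<open>Finite sets of points with weight functions stand in for injective sequences, and the
  inner product for the arccosine; sums over images and products of point sets are then easy to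
  rearrange.\<close>

definition zonal_pd :: "nat \<Rightarrow> (real \<Rightarrow> real) \<Rightarrow> bool" where
  "zonal_pd k g \<longleftrightarrow> (\<forall>A c. finite A \<and> A \<subseteq> sph k \<longrightarrow>
     (\<Sum>x\<in>A. \<Sum>y\<in>A. c x * c y * g (ip k x y)) \<ge> 0)"

definition zonal_spd :: "nat \<Rightarrow> (real \<Rightarrow> real) \<Rightarrow> bool" where
  "zonal_spd k g \<longleftrightarrow> (\<forall>A c. finite A \<and> A \<subseteq> sph k \<and> (\<exists>x\<in>A. c x \<noteq> 0) \<longrightarrow>
     (\<Sum>x\<in>A. \<Sum>y\<in>A. c x * c y * g (ip k x y)) > 0)"

lemma ip_bounds:
  assumes "x \<in> sph k" "y \<in> sph k"
  shows "-1 \<le> ip k x y" "ip k x y \<le> 1"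
proof -
  have "0 \<le> (\<Sum>i\<le>k. (x i + y i)\<^sup>2)" "0 \<le> (\<Sum>i\<le>k. (x i - y i)\<^sup>2)" by (auto intro: sum_nonneg)
  moreover have "(\<Sum>i\<le>k. (x i + y i)\<^sup>2) = 2 + 2 * ip k x y" "(\<Sum>i\<le>k. (x i - y i)\<^sup>2) = 2 - 2 * ip k x y"
    using assms by (auto simp: power2_sum power2_diff sum.distrib sum_subtractf sph_def ip_def mult.assoc simp flip: sum_distrib_left)
  ultimately show "-1 \<le> ip k x y" "ip k x y \<le> 1" by auto
qed

lemma cos_geo_dist:
  assumes "x \<in> sph k" "y \<in> sph k"
  shows "cos (geo_dist k x y) = ip k x y"
  using ip_bounds[OF assms] by (simp add: geo_dist_def)

lemma sum_sum_reindex: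
  assumes "inj_on h I"
  shows "(\<Sum>x\<in>h ` I. \<Sum>y\<in>h ` I. F x y) = (\<Sum>i\<in>I. \<Sum>j\<in>I. F (h i) (h j))"
  using assms by (simp add: sum.reindex)

lemma pos_def_sphere_iff:
  assumes f: "continuous_on {-1..1} f"
  shows "pos_def_sphere k (\<lambda>t. f (cos t)) \<longleftrightarrow> zonal_pd k f"
    and "strictly_pos_def_sphere k (\<lambda>t. f (cos t)) \<longleftrightarrow> zonal_spd k f"
proof -
  have cont: "continuous_on {0..pi} (\<lambda>t. f (cos t))" by (rule continuous_on_compose_cos[OF f])
  have eq: "(\<Sum>i<n. \<Sum>j<n. c i * c j * f (cos (geo_dist k (x i) (x j)))) =
      (\<Sum>i<n. \<Sum>j<n. c i * c j * f (ip k (x i) (x j)))"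
    if "\<forall>i<n. x i \<in> sph k" for n c and x :: "nat \<Rightarrow> nat \<Rightarrow> real"
    using that by (intro sum.cong refl) (simp add: cos_geo_dist)
  have to_set: "(\<Sum>i<n. \<Sum>j<n. c i * c j * f (ip k (x i) (x j))) =
      (\<Sum>u\<in>x ` {..<n}. \<Sum>v\<in>x ` {..<n}. c (inv_into {..<n} x u) * c (inv_into {..<n} x v) * f (ip k u v))"
    if "inj_on x {..<n}" for n c and x :: "nat \<Rightarrow> nat \<Rightarrow> real"
    unfolding sum_sum_reindex[OF that] using that by (intro sum.cong refl) (simp add: inv_into_f_f)
  have of_set: "\<exists>x. inj_on x {..<card A} \<and> x ` {..<card A} = A \<and>
     (\<Sum>u\<in>A. \<Sum>v\<in>A. c u * c v * f (ip k u v)) = (\<Sum>i<card A. \<Sum>j<card A. c (x i) * c (x j) * f (ip k (x i) (x j)))"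
    if finA: "finite A" for A c
  proof -
    obtain x where "bij_betw x {0..<card A} A" using ex_bij_betw_nat_finite[OF finA] by blast
    then have x: "inj_on x {..<card A}" "x ` {..<card A} = A"
      by (auto simp: bij_betw_def atLeast0LessThan)
    with sum_sum_reindex[OF x(1), of "\<lambda>u v. c u * c v * f (ip k u v)"] show ?thesis by auto
  qed
  show "pos_def_sphere k (\<lambda>t. f (cos t)) \<longleftrightarrow> zonal_pd k f"
  proof
    assume L: "pos_def_sphere k (\<lambda>t. f (cos t))"
    show "zonal_pd k f" unfolding zonal_pd_def
    proof (intro allI impI)
      fix A :: "(nat \<Rightarrow> real) set" and c :: "(nat \<Rightarrow> real) \<Rightarrow> real" assume A: "finite A \<and> A \<subseteq> sph k"
      then obtain x where x: "inj_on x {..<card A}" "x ` {..<card A} = A" "(\<Sum>u\<in>A. \<Sum>v\<in>A. c u * c v * f (ip k u v)) =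
        (\<Sum>i<card A. \<Sum>j<card A. c (x i) * c (x j) * f (ip k (x i) (x j)))" using of_set by blast
      then have xs: "\<forall>i<card A. x i \<in> sph k" using A by auto
      have "0 \<le> (\<Sum>i<card A. \<Sum>j<card A. c (x i) * c (x j) * f (cos (geo_dist k (x i) (x j))))"
        by (rule mp[OF spec[OF spec[OF spec[OF conjunct2[OF L[unfolded pos_def_sphere_def]]]]]]) (use x(1) xs in blast)
      then show "0 \<le> (\<Sum>u\<in>A. \<Sum>v\<in>A. c u * c v * f (ip k u v))"
        using x(3) eq[OF xs, of "\<lambda>i. c (x i)"] by simp
    qed
  next
    assume R: "zonal_pd k f"
    show "pos_def_sphere k (\<lambda>t. f (cos t))" unfolding pos_def_sphere_def
    proof (intro conjI allI impI cont)
      fix n and x :: "nat \<Rightarrow> nat \<Rightarrow> real" and c :: "nat \<Rightarrow> real"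
      assume x: "(\<forall>i<n. x i \<in> sph k) \<and> inj_on x {..<n}"
      then have "finite (x ` {..<n}) \<and> x ` {..<n} \<subseteq> sph k" by auto
      then show "0 \<le> (\<Sum>i<n. \<Sum>j<n. c i * c j * f (cos (geo_dist k (x i) (x j))))"
        unfolding eq[OF conjunct1[OF x]] to_set[OF conjunct2[OF x]]
        using R[unfolded zonal_pd_def, THEN spec, of "x ` {..<n}", THEN spec, of "\<lambda>u. c (inv_into {..<n} x u)"] by blast 
    qed
  qed
  show "strictly_pos_def_sphere k (\<lambda>t. f (cos t)) \<longleftrightarrow> zonal_spd k f"
  proof
    assume L: "strictly_pos_def_sphere k (\<lambda>t. f (cos t))"
    show "zonal_spd k f" unfolding zonal_spd_def
    proof (intro allI impI)
      fix A :: "(nat \<Rightarrow> real) set" and c :: "(nat \<Rightarrow> real) \<Rightarrow> real" assume A: "finite A \<and> A \<subseteq> sph k \<and> (\<exists>x\<in>A. c x \<noteq> 0)"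
      then obtain x where x: "inj_on x {..<card A}" "x ` {..<card A} = A" "(\<Sum>u\<in>A. \<Sum>v\<in>A. c u * c v * f (ip k u v)) =
        (\<Sum>i<card A. \<Sum>j<card A. c (x i) * c (x j) * f (ip k (x i) (x j)))" using of_set by blast
      then have xs: "\<forall>i<card A. x i \<in> sph k" using A by auto
      have "\<exists>u\<in>x ` {..<card A}. c u \<noteq> 0" using A x(2) by simp
      then have ne: "\<exists>i<card A. c (x i) \<noteq> 0" by auto
      have "0 < (\<Sum>i<card A. \<Sum>j<card A. c (x i) * c (x j) * f (cos (geo_dist k (x i) (x j))))"
        by (rule mp[OF spec[OF spec[OF spec[OF conjunct2[OF L[unfolded strictly_pos_def_sphere_def]]]]]]) (use x(1) xs ne in blast)
      then show "0 < (\<Sum>u\<in>A. \<Sum>v\<in>A. c u * c v * f (ip k u v))"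
        using x(3) eq[OF xs, of "\<lambda>i. c (x i)"] by simp
    qed
  next
    assume R: "zonal_spd k f"
    show "strictly_pos_def_sphere k (\<lambda>t. f (cos t))" unfolding strictly_pos_def_sphere_def
    proof (intro conjI allI impI cont)
      fix n and x :: "nat \<Rightarrow> nat \<Rightarrow> real" and c :: "nat \<Rightarrow> real"
      assume x: "(\<forall>i<n. x i \<in> sph k) \<and> inj_on x {..<n} \<and> (\<exists>i<n. c i \<noteq> 0)"
      then have "finite (x ` {..<n}) \<and> x ` {..<n} \<subseteq> sph k \<and> (\<exists>u\<in>x ` {..<n}. c (inv_into {..<n} x u) \<noteq> 0)"
        by (auto simp: inv_into_f_f)
      then show "0 < (\<Sum>i<n. \<Sum>j<n. c i * c j * f (cos (geo_dist k (x i) (x j))))"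
        unfolding eq[OF conjunct1[OF x]] to_set[OF conjunct1[OF conjunct2[OF x]]]
        using R[unfolded zonal_spd_def, THEN spec, of "x ` {..<n}", THEN spec, of "\<lambda>u. c (inv_into {..<n} x u)"] by blast
    qed
  qed
qed

lemma Lambda_iff: "f \<in> Lambda k \<longleftrightarrow> continuous_on {-1..1} f \<and> zonal_pd k f"
  using pos_def_sphere_iff(1) by (auto simp: Lambda_def)

lemma Lambda_plus_iff: "f \<in> Lambda_plus k \<longleftrightarrow> continuous_on {-1..1} f \<and> zonal_spd k f"
  using pos_def_sphere_iff(2) by (auto simp: Lambda_plus_def)

text \<open>The weights of coinciding points are added up. Coincidences do occur later: all lifts to
  height 1 or -1 meet at a pole.\<close>

lemma zonal_pd_family:
  assumes g: "zonal_pd k g" and I: "finite I" and x: "\<And>i. i \<in> I \<Longrightarrow> x i \<in> sph k"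
  shows "(\<Sum>i\<in>I. \<Sum>j\<in>I. c i * c j * g (ip k (x i) (x j))) \<ge> 0"
proof -
  define C where "C z = (\<Sum>i\<in>{i \<in> I. x i = z}. c i)" for z
  have "(\<Sum>i\<in>I. \<Sum>j\<in>I. c i * c j * g (ip k (x i) (x j))) =
    (\<Sum>z\<in>x ` I. \<Sum>i\<in>{i \<in> I. x i = z}. \<Sum>w\<in>x ` I. \<Sum>j\<in>{j \<in> I. x j = w}. c i * c j * g (ip k (x i) (x j)))"
    by (simp only: sum.image_gen[OF I, of _ x])
  also have "\<dots> = (\<Sum>z\<in>x ` I. \<Sum>w\<in>x ` I. C z * C w * g (ip k z w))"
  proof (rule sum.cong[OF refl])
    fix z
    have "(\<Sum>i\<in>{i \<in> I. x i = z}. \<Sum>w\<in>x ` I. \<Sum>j\<in>{j \<in> I. x j = w}. c i * c j * g (ip k (x i) (x j)))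
      = (\<Sum>i\<in>{i \<in> I. x i = z}. \<Sum>w\<in>x ` I. c i * (C w * g (ip k z w)))"
      by (intro sum.cong refl) (simp add: C_def sum_distrib_left sum_distrib_right mult.assoc)
    also have "\<dots> = (\<Sum>w\<in>x ` I. C z * C w * g (ip k z w))"
      by (subst sum.swap) (simp add: C_def sum_distrib_right mult.assoc)
    finally show "(\<Sum>i\<in>{i \<in> I. x i = z}. \<Sum>w\<in>x ` I. \<Sum>j\<in>{j \<in> I. x j = w}. c i * c j * g (ip k (x i) (x j)))
      = (\<Sum>w\<in>x ` I. C z * C w * g (ip k z w))" .
  qed
  also have "\<dots> \<ge> 0" using g I x by (auto simp: zonal_pd_def)
  finally show ?thesis .
qed

text \<open>The Schur product theorem for a kernel that is already factored: each factor is absorbed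
  into the weights.\<close>

lemma zonal_pd_mult_factors:
  assumes g: "zonal_pd k g" and I: "finite I"
    and h: "\<And>x y. x \<in> sph k \<Longrightarrow> y \<in> sph k \<Longrightarrow> h (ip k x y) = (\<Sum>a\<in>I. \<phi> a x * \<phi> a y)"
  shows "zonal_pd k (\<lambda>t. g t * h t)"
  unfolding zonal_pd_def
proof (intro allI impI)
  fix A :: "(nat \<Rightarrow> real) set" and c :: "(nat \<Rightarrow> real) \<Rightarrow> real" assume A: "finite A \<and> A \<subseteq> sph k"
  have "(\<Sum>x\<in>A. \<Sum>y\<in>A. c x * c y * (g (ip k x y) * h (ip k x y))) =
    (\<Sum>x\<in>A. \<Sum>y\<in>A. \<Sum>a\<in>I. (c x * \<phi> a x) * (c y * \<phi> a y) * g (ip k x y))"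
  proof (intro sum.cong refl)
    fix x y assume "x \<in> A" "y \<in> A"
    with A have "h (ip k x y) = (\<Sum>a\<in>I. \<phi> a x * \<phi> a y)" by (intro h) auto
    then show "c x * c y * (g (ip k x y) * h (ip k x y)) = (\<Sum>a\<in>I. (c x * \<phi> a x) * (c y * \<phi> a y) * g (ip k x y))"
      by (simp add: sum_distrib_left mult_ac)
  qed
  also have "\<dots> = (\<Sum>x\<in>A. \<Sum>a\<in>I. \<Sum>y\<in>A. (c x * \<phi> a x) * (c y * \<phi> a y) * g (ip k x y))"
    by (intro sum.cong refl sum.swap)
  also have "\<dots> = (\<Sum>a\<in>I. \<Sum>x\<in>A. \<Sum>y\<in>A. (c x * \<phi> a x) * (c y * \<phi> a y) * g (ip k x y))"
    by (rule sum.swap)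
  also have "\<dots> \<ge> 0"
  proof (rule sum_nonneg)
    fix a
    show "0 \<le> (\<Sum>x\<in>A. \<Sum>y\<in>A. (c x * \<phi> a x) * (c y * \<phi> a y) * g (ip k x y))"
      using g[unfolded zonal_pd_def, THEN spec, of A, THEN spec, of "\<lambda>x. c x * \<phi> a x"] A by blast
  qed
  finally show "0 \<le> (\<Sum>x\<in>A. \<Sum>y\<in>A. c x * c y * (g (ip k x y) * h (ip k x y)))" .
qed

lemma zonal_pd_mult_ultra:
  assumes "zonal_pd k g" "k \<ge> 1"
  shows "zonal_pd k (\<lambda>t. g t * poly (ultra k n) t)"
proof (rule ultra_factors[OF assms(2), of n])
  fix I :: "nat list set" and \<phi> assume "finite I"
    "\<And>x y. x \<in> sph k \<Longrightarrow> y \<in> sph k \<Longrightarrow> poly (ultra k n) (ip k x y) = (\<Sum>a\<in>I. \<phi> a x * \<phi> a y)"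
  then show ?thesis by (rule zonal_pd_mult_factors[OF assms(1)])
qed

lemma zonal_pd_one: "zonal_pd k (\<lambda>_. 1)"
  unfolding zonal_pd_def
proof (intro allI impI)
  fix A :: "(nat \<Rightarrow> real) set" and c :: "(nat \<Rightarrow> real) \<Rightarrow> real"
  have "(\<Sum>x\<in>A. \<Sum>y\<in>A. c x * c y * 1) = (\<Sum>x\<in>A. c x)\<^sup>2"
    by (simp add: power2_eq_square sum_product)
  then show "0 \<le> (\<Sum>x\<in>A. \<Sum>y\<in>A. c x * c y * 1)" by simp
qed

lemma zonal_pd_ultra: "k \<ge> 1 \<Longrightarrow> zonal_pd k (poly (ultra k n))"
  using zonal_pd_mult_ultra[OF zonal_pd_one] by simp

lemma sph_points:
  assumes k: "k \<ge> 1" and t: "-1 \<le> t" "t \<le> 1"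
  obtains x y where "x \<in> sph k" "y \<in> sph k" "ip k x y = t"
proof
  define x where "x i = (if i = 0 then 1 else 0 :: real)" for i :: nat
  define y where "y i = (if i = 0 then t else if i = 1 then sqrt (1 - t\<^sup>2) else 0)" for i :: nat
  have t2: "t\<^sup>2 \<le> 1" using t by (simp add: abs_square_le_1 abs_le_iff)
  have s: "(\<Sum>i\<le>k. f i) = f 0 + f 1" if "\<And>i. i \<ge> 2 \<Longrightarrow> f i = 0" for f :: "nat \<Rightarrow> real"
  proof -
    have "(\<Sum>i\<le>k. f i) = (\<Sum>i\<in>{0, 1}. f i)"
      using k that by (intro sum.mono_neutral_right) auto
    then show ?thesis by simp
  qed
  show "x \<in> sph k" using k s[of "\<lambda>i. (x i)\<^sup>2"] by (auto simp: sph_def x_def)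
  show "y \<in> sph k" using k s[of "\<lambda>i. (y i)\<^sup>2"] t2 by (auto simp: sph_def y_def)
  show "ip k x y = t" using s[of "\<lambda>i. x i * y i"] by (auto simp: ip_def x_def y_def)
qed

text \<open>Positive definiteness on two points with weights (1, 1) and (1, -1); the diagonal
  entries are 1.\<close>

lemma ultra_abs_le_1:
  assumes k: "k \<ge> 1" and t: "-1 \<le> t" "t \<le> 1"
  shows "\<bar>poly (ultra k n) t\<bar> \<le> 1"
proof -
  obtain x y where xy: "x \<in> sph k" "y \<in> sph k" "ip k x y = t" using sph_points[OF assms] .
  have yx: "ip k y x = t" using xy(3) by (simp add: ip_commute)
  have "0 \<le> (\<Sum>i\<in>{True, False}. \<Sum>j\<in>{True, False}. (\<lambda>b. if b then 1 else s) i * (\<lambda>b. if b then 1 else s) j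
      * poly (ultra k n) (ip k ((\<lambda>b. if b then x else y) i) ((\<lambda>b. if b then x else y) j)))" for s :: real
    using xy by (intro zonal_pd_family[OF zonal_pd_ultra[OF k]]) auto
  from this[of 1] this[of "-1"] show ?thesis by (auto simp: xy sph_ip yx)
qed

lemma weierstrass_poly:
  fixes g :: "real \<Rightarrow> real"
  assumes "continuous_on {-1..1} g" "e > 0"
  obtains p where "\<And>t. -1 \<le> t \<Longrightarrow> t \<le> 1 \<Longrightarrow> \<bar>g t - poly p t\<bar> < e"
proof -
  obtain q where q: "real_polynomial_function q" "\<And>t. t \<in> {-1..1} \<Longrightarrow> \<bar>g t - q t\<bar> < e"
    using Stone_Weierstrass_real_polynomial_function[OF compact_Icc assms] by blast
  then obtain a n where "q = (\<lambda>x. \<Sum>i\<le>n. a i * x ^ i)" by (auto simp: real_polynomial_function_iff_sum)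
  then have "poly (\<Sum>i\<le>n. monom (a i) i) t = q t" for t by (simp add: poly_sum poly_monom)
  with q that[of "\<Sum>i\<le>n. monom (a i) i"] show ?thesis by auto
qed

section \<open>Nonnegative means of positive definite functions, by slicing\<close>

text \<open>Two points of S^(k+1) at heights \<open>s\<close> and \<open>t\<close>, whose directions
  in S^k have inner product \<open>w\<close>, have the argument of \<open>g\<close> as their inner
  product. The integral thus averages the kernel over the relative direction of two
  parallels.\<close>

definition slice_int :: "nat \<Rightarrow> (real \<Rightarrow> real) \<Rightarrow> real \<Rightarrow> real \<Rightarrow> real" where
  "slice_int k g s t = zonal_int k (\<lambda>w. g (s * t + sqrt (1 - s\<^sup>2) * sqrt (1 - t\<^sup>2) * w))"

lemma slice_arg_bounds:
  assumes "s \<in> {-1..1}" "t \<in> {-1..1}" "w \<in> {-1..1::real}"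
  shows "s * t + sqrt (1 - s\<^sup>2) * sqrt (1 - t\<^sup>2) * w \<in> {-1..1}"
proof -
  let ?r = "sqrt (1 - s\<^sup>2) * sqrt (1 - t\<^sup>2)"
  have s2: "s\<^sup>2 \<le> 1" "t\<^sup>2 \<le> 1" using assms by (auto simp: abs_square_le_1 abs_le_iff)
  have r: "?r \<ge> 0" using s2 by auto
  have am: "a * b \<le> (a\<^sup>2 + b\<^sup>2) / 2" for a b :: real
    using sum_squares_bound[of a b] by (simp add: mult.assoc)
  have "\<bar>s * t\<bar> + ?r \<le> (s\<^sup>2 + t\<^sup>2) / 2 + ((sqrt (1 - s\<^sup>2))\<^sup>2 + (sqrt (1 - t\<^sup>2))\<^sup>2) / 2"
    using am[of "\<bar>s\<bar>" "\<bar>t\<bar>"] am[of "sqrt (1 - s\<^sup>2)" "sqrt (1 - t\<^sup>2)"]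
    unfolding abs_mult power2_abs by (rule add_mono)
  also have "\<dots> = (s\<^sup>2 + t\<^sup>2) / 2 + ((1 - s\<^sup>2) + (1 - t\<^sup>2)) / 2"
    using s2 by (simp only: real_sqrt_pow2 diff_ge_0_iff_ge)
  also have "\<dots> = 1" by (simp add: field_simps)
  finally have "\<bar>s * t\<bar> + ?r \<le> 1" .
  moreover have "\<bar>?r * w\<bar> \<le> ?r"
    using mult_left_mono[OF _ r, of "\<bar>w\<bar>" 1] assms(3)
    unfolding abs_mult[of ?r w] abs_of_nonneg[OF r] by (simp add: abs_le_iff)
  ultimately show ?thesis by (auto simp: abs_le_iff)
qed

lemma zonal_int_continuous_param:
  fixes F :: "'a::metric_space \<Rightarrow> real \<Rightarrow> real"
  assumes F: "continuous_on (U \<times> {-1..1}) (\<lambda>(s, w). F s w)"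
  shows "continuous_on U (\<lambda>s. zonal_int k (F s))"
proof (cases "k = 0")
  case True
  have "continuous_on U (\<lambda>s. (\<lambda>(s, w). F s w) (s, w))" if "w \<in> {-1..1}" for w
    by (rule continuous_on_compose2[OF F]) (use that in \<open>auto intro!: continuous_intros\<close>)
  from this[of 1] this[of "-1"] show ?thesis
    unfolding zonal_int_def using True by (auto intro!: continuous_intros)
next
  case False
  have "continuous_on (U \<times> cbox 0 pi) (\<lambda>z. (\<lambda>(s, w). F s w) (fst z, cos (snd z)))"
    by (rule continuous_on_compose2[OF F]) (auto intro!: continuous_intros)
  then have "continuous_on (U \<times> cbox 0 pi) (\<lambda>(s, \<theta>). F s (cos \<theta>) * sin \<theta> ^ (k - 1))"
    by (simp add: split_beta continuous_intros)
  from integral_continuous_on_param[OF this] show ?thesis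
    using False by (simp add: zonal_int_def)
qed

lemma slice_int_continuous:
  assumes g: "continuous_on {-1..1} g"
  shows "continuous_on ({-1..1} \<times> {-1..1}) (\<lambda>(s, t). slice_int k g s t)"
proof -
  have "continuous_on (({-1..1} \<times> {-1..1}) \<times> {-1..1})
     (\<lambda>z. g (fst (fst z) * snd (fst z) + sqrt (1 - (fst (fst z))\<^sup>2) * sqrt (1 - (snd (fst z))\<^sup>2) * snd z))"
    by (rule continuous_on_compose2[OF g])
      (auto intro!: continuous_intros slice_arg_bounds simp del: atLeastAtMost_iff)
  then have "continuous_on (({-1..1} \<times> {-1..1}) \<times> {-1..1})
     (\<lambda>(z, w). g (fst z * snd z + sqrt (1 - (fst z)\<^sup>2) * sqrt (1 - (snd z)\<^sup>2) * w))"
    by (simp add: split_beta)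
  from zonal_int_continuous_param[OF this, of k] show ?thesis
    by (simp add: slice_int_def split_beta)
qed

lemma slice_int_continuous1:
  assumes g: "continuous_on {-1..1} g" and t: "t \<in> {-1..1}"
  shows "continuous_on {-1..1} (\<lambda>s. slice_int k g s t)"
proof -
  have "continuous_on {-1..1} (\<lambda>s. (\<lambda>(s, t). slice_int k g s t) (s, t))"
    by (rule continuous_on_compose2[OF slice_int_continuous[OF g]])
       (use t in \<open>auto intro!: continuous_intros\<close>)
  then show ?thesis by simp
qed

lemma slice_arg_continuous:
  assumes g: "continuous_on {-1..1} g" and "s \<in> {-1..1}" "t \<in> {-1..1}"
  shows "continuous_on {-1..1} (\<lambda>w. g (s * t + sqrt (1 - s\<^sup>2) * sqrt (1 - t\<^sup>2) * w))"
  by (rule continuous_on_compose2[OF g]) (use slice_arg_bounds[OF assms(2,3)] in \<open>auto intro!: continuous_intros\<close>)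

lemma zonal_int_raise:
  assumes "k \<ge> 1"
  shows "zonal_int (k + 2) g = zonal_int k (\<lambda>t. (1 - t\<^sup>2) * g t)"
proof -
  obtain j where "k = Suc j" using assms by (cases k) auto
  moreover have "1 - (cos \<theta>)\<^sup>2 = sin \<theta> * sin \<theta>" for \<theta> :: real
    by (simp add: sin_squared_eq flip: power2_eq_square)
  ultimately show ?thesis by (simp add: zonal_int_def mult_ac)
qed

lemma zonal_int_moment_raise:
  assumes "k \<ge> 1"
  shows "i * zonal_int (k + 2) (\<lambda>t. t ^ (i - 1)) = k * zonal_int k (\<lambda>t. t ^ (i + 1))"
proof -
  have "i * zonal_int (k + 2) (\<lambda>t. t ^ (i - 1)) = i * zonal_int k (\<lambda>t. t ^ (i - 1) - t ^ (i + 1))"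
    unfolding zonal_int_raise[OF assms]
    by (cases i) (auto simp: algebra_simps power2_eq_square)
  also have "\<dots> = i * zonal_int k (\<lambda>t. t ^ (i - 1)) - i * zonal_int k (\<lambda>t. t ^ (i + 1))"
    by (subst zonal_int_diff) (auto intro!: continuous_intros simp: right_diff_distrib)
  finally show ?thesis unfolding zonal_int_moment by (simp add: algebra_simps)
qed

text \<open>The monomial moments of the rotation invariant weight on the disc behind the next lemma
  satisfy a recursion that makes the rotated integral constant in the rotation angle.\<close>

lemma rotated_moment:
  fixes k n :: nat
  defines "M \<equiv> \<lambda>j. zonal_int k (\<lambda>t. t ^ j) * zonal_int (j + k + 1) (\<lambda>t. t ^ (n - j))"
  shows "(\<Sum>j\<le>n. (n choose j) * cos \<beta> ^ (n - j) * sin \<beta> ^ j * M j) = M 0"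
proof -
  have rel: "real (n - l) * M (l + 1) = real l * M (l - 1)" if ln: "l \<le> n" for l
  proof -
    consider "l = 0" | "l = n" "l \<noteq> 0" | "l \<noteq> 0" "l < n" using ln by linarith
    then show ?thesis
    proof cases
      case 1
      have "zonal_int k (\<lambda>t. t) = 0" if "k \<ge> 1"
        using zonal_int_moment[of 0 k] that by simp
      moreover have "zonal_int 0 (\<lambda>t. t) = 0" by (simp add: zonal_int_def)
      ultimately have "zonal_int k (\<lambda>t. t) = 0" by (cases "k = 0") auto
      then show ?thesis using 1 by (simp add: M_def)
    next
      case 2
      then have "zonal_int (n - 1 + k + 1) (\<lambda>t. t) = 0"
        using zonal_int_moment[of 0 "n - 1 + k + 1"] by simp
      then show ?thesis using 2 by (simp add: M_def)
    next
      case 3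
      then have idx: "l + 1 + k + 1 = (l + k) + 2" "l - 1 + k + 1 = l + k" "n - (l + 1) = n - l - 1" "n - (l - 1) = n - l + 1"
        by auto
      have "real (n - l) * M (l + 1) = zonal_int k (\<lambda>t. t ^ (l + 1)) *
         (real (n - l) * zonal_int ((l + k) + 2) (\<lambda>t. t ^ (n - l - 1)))"
        unfolding M_def idx by simp
      also have "\<dots> = ((real l + k) * zonal_int k (\<lambda>t. t ^ (l + 1))) * zonal_int (l + k) (\<lambda>t. t ^ (n - l + 1))"
        using 3 by (subst zonal_int_moment_raise) auto
      also have "\<dots> = real l * M (l - 1)"
        unfolding M_def idx zonal_int_moment[symmetric] by simp
      finally show ?thesis .
    qed
  qed
  define S where "S \<beta> = (\<Sum>j\<le>n. (n choose j) * cos \<beta> ^ (n - j) * sin \<beta> ^ j * M j)" for \<beta> :: real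
  have deriv: "(S has_real_derivative 0) (at \<beta>)" for \<beta>
  proof -
    define c s where "c = cos \<beta>" and "s = sin \<beta>"
    have dj: "((\<lambda>\<beta>. (n choose j) * cos \<beta> ^ (n - j) * sin \<beta> ^ j * M j) has_real_derivative
       (n choose j) * M j * (real j * c ^ (n - j + 1) * s ^ (j - 1) - real (n - j) * c ^ (n - j - 1) * s ^ (j + 1))) (at \<beta>)" for j
      unfolding c_def s_def
      by (rule derivative_eq_intros refl)+ (simp add: algebra_simps)
    have D: "(S has_real_derivative (\<Sum>j\<le>n. (n choose j) * M j *
        (real j * c ^ (n - j + 1) * s ^ (j - 1) - real (n - j) * c ^ (n - j - 1) * s ^ (j + 1)))) (at \<beta>)"
      unfolding S_def by (rule DERIV_sum) (rule dj)
    define P where "P l = (n choose l) * c ^ (n - l) * s ^ l" for l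
    \<comment> \<open>The summation index is shifted by one through the absorption identities for
      binomial coefficients, so that \<open>rel\<close> can be applied to each coefficient;
      \<open>B\<close> does the same for the other half of the derivative.\<close>
    have A: "(\<Sum>j\<le>n. (n choose j) * M j * (real j * c ^ (n - j + 1) * s ^ (j - 1))) = (\<Sum>l\<le>n. real (n - l) * M (l + 1) * P l)"
    proof (cases n)
      case (Suc n')
      have "(\<Sum>j\<le>n. (n choose j) * M j * (real j * c ^ (n - j + 1) * s ^ (j - 1))) =
        (\<Sum>l\<le>n'. real ((n choose (Suc l)) * Suc l) * M (Suc l) * (c ^ (n - l) * s ^ l))"
      proof -
        have "(n choose Suc l) * M (Suc l) * (real (Suc l) * c ^ (n - Suc l + 1) * s ^ (Suc l - 1)) =
          real ((n choose (Suc l)) * Suc l) * M (Suc l) * (c ^ (n - l) * s ^ l)" if "l \<le> n'" for l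
        proof -
          have "n - Suc l + 1 = n - l" using that Suc by simp
          then show ?thesis by (simp only: of_nat_mult mult_ac diff_Suc_1)
        qed
        then have "(\<Sum>l\<le>n'. (n choose Suc l) * M (Suc l) * (real (Suc l) * c ^ (n - Suc l + 1) * s ^ (Suc l - 1))) =
           (\<Sum>l\<le>n'. real ((n choose (Suc l)) * Suc l) * M (Suc l) * (c ^ (n - l) * s ^ l))"
          by (intro sum.cong refl) blast
        moreover have "(\<Sum>j\<le>n. F j) = F 0 + (\<Sum>l\<le>n'. F (Suc l))" for F :: "nat \<Rightarrow> real"
          unfolding Suc by (rule sum.atMost_Suc_shift)
        ultimately show ?thesis by simp
      qed
      also have "\<dots> = (\<Sum>l\<le>n'. real (n - l) * M (l + 1) * P l)"
      proof (intro sum.cong refl)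
        fix l assume "l \<in> {..n'}"
        have "(n choose (Suc l)) * Suc l = (n - l) * (n choose l)"
          using binomial_absorb_comp[of n l] binomial_absorption[of l n] by (simp only: mult.commute)
        then show "real ((n choose (Suc l)) * Suc l) * M (Suc l) * (c ^ (n - l) * s ^ l) = real (n - l) * M (l + 1) * P l"
          by (simp add: P_def)
      qed
      also have "\<dots> = (\<Sum>l\<le>n. real (n - l) * M (l + 1) * P l)" unfolding Suc by simp
      finally show ?thesis .
    qed simp
    have B: "(\<Sum>j\<le>n. (n choose j) * M j * (real (n - j) * c ^ (n - j - 1) * s ^ (j + 1))) = (\<Sum>l\<le>n. real l * M (l - 1) * P l)"
    proof (cases n)
      case (Suc n')
      have "(\<Sum>l\<le>n. real l * M (l - 1) * P l) = (\<Sum>j\<le>n'. real (Suc j) * M j * P (Suc j))"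
        unfolding Suc by (subst sum.atMost_Suc_shift) simp
      also have "\<dots> = (\<Sum>j\<le>n'. (n choose j) * M j * (real (n - j) * c ^ (n - j - 1) * s ^ (j + 1)))"
      proof (intro sum.cong refl)
        fix j assume "j \<in> {..n'}"
        have "real (Suc j) * (n choose (Suc j)) = real (n - j) * (n choose j)"
          using binomial_absorb_comp[of n j] binomial_absorption[of j n]
          by (simp only: flip: of_nat_mult)
        then show "real (Suc j) * M j * P (Suc j) = (n choose j) * M j * (real (n - j) * c ^ (n - j - 1) * s ^ (j + 1))"
          by (simp add: P_def mult_ac)
      qed
      also have "\<dots> = (\<Sum>j\<le>n. (n choose j) * M j * (real (n - j) * c ^ (n - j - 1) * s ^ (j + 1)))"
        unfolding Suc by simp
      finally show ?thesis by simp
    qed simp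
    have "(\<Sum>j\<le>n. (n choose j) * M j * (real j * c ^ (n - j + 1) * s ^ (j - 1) - real (n - j) * c ^ (n - j - 1) * s ^ (j + 1)))
       = (\<Sum>l\<le>n. real (n - l) * M (l + 1) * P l) - (\<Sum>l\<le>n. real l * M (l - 1) * P l)"
      unfolding A[symmetric] B[symmetric] by (simp add: sum_subtractf right_diff_distrib)
    also have "\<dots> = 0" using rel by (simp add: sum_subtractf[symmetric])
    finally show ?thesis using D by simp
  qed
  have "S \<beta> = S 0" using DERIV_isconst_all[of S] deriv by blast
  also have "S 0 = (\<Sum>j\<in>{0}. (n choose j) * cos 0 ^ (n - j) * sin 0 ^ j * M j)"
    unfolding S_def by (rule sum.mono_neutral_right) auto
  finally show ?thesis by (simp add: S_def)
qed

text \<open>In the binomial expansion the factor \<open>sqrt (1 - s\<^sup>2) ^ j\<close> is absorbed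
  into the weight and lifts the dimension from k + 1 to j + k + 1. What remains is the rotated
  moment at the angle with cosine \<open>t\<close>, and that moment does not depend on the
  angle.\<close>

lemma slice_int_power:
  assumes t: "t \<in> {-1..1}"
  shows "zonal_int (k + 1) (\<lambda>s. slice_int k (\<lambda>x. x ^ n) s t) = zonal_int k (\<lambda>_. 1) * zonal_int (k + 1) (\<lambda>x. x ^ n)"
proof -
  define \<beta> where "\<beta> = arccos t"
  have \<beta>: "cos \<beta> = t" "sin \<beta> = sqrt (1 - t\<^sup>2)" using t by (auto simp: \<beta>_def sin_arccos)
  have "zonal_int (k + 1) (\<lambda>s. slice_int k (\<lambda>x. x ^ n) s t) =
    zonal_int (k + 1) (\<lambda>s. \<Sum>j\<le>n. ((n choose j) * t ^ (n - j) * sqrt (1 - t\<^sup>2) ^ j * zonal_int k (\<lambda>w. w ^ j)) * (s ^ (n - j) * sqrt (1 - s\<^sup>2) ^ j))"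
  proof (rule zonal_int_cong)
    fix s :: real
    have "slice_int k (\<lambda>x. x ^ n) s t = zonal_int k (\<lambda>w. \<Sum>j\<le>n. ((n choose j) * (s * t) ^ (n - j) * (sqrt (1 - s\<^sup>2) * sqrt (1 - t\<^sup>2)) ^ j) * w ^ j)"
      unfolding slice_int_def
      by (subst add.commute, subst binomial_ring) (simp add: mult_ac power_mult_distrib)
    also have "\<dots> = (\<Sum>j\<le>n. ((n choose j) * (s * t) ^ (n - j) * (sqrt (1 - s\<^sup>2) * sqrt (1 - t\<^sup>2)) ^ j) * zonal_int k (\<lambda>w. w ^ j))"
      by (subst zonal_int_sum) (auto intro!: continuous_intros simp: zonal_int_cmult)
    finally show "slice_int k (\<lambda>x. x ^ n) s t = (\<Sum>j\<le>n. ((n choose j) * t ^ (n - j) * sqrt (1 - t\<^sup>2) ^ j * zonal_int k (\<lambda>w. w ^ j)) * (s ^ (n - j) * sqrt (1 - s\<^sup>2) ^ j))"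
      by (simp add: mult_ac power_mult_distrib)
  qed
  also have "\<dots> = (\<Sum>j\<le>n. ((n choose j) * t ^ (n - j) * sqrt (1 - t\<^sup>2) ^ j * zonal_int k (\<lambda>w. w ^ j)) * zonal_int (k + 1) (\<lambda>s. s ^ (n - j) * sqrt (1 - s\<^sup>2) ^ j))"
    by (subst zonal_int_sum) (auto intro!: continuous_intros simp: zonal_int_cmult)
  also have "\<dots> = (\<Sum>j\<le>n. (n choose j) * cos \<beta> ^ (n - j) * sin \<beta> ^ j *
     (zonal_int k (\<lambda>t. t ^ j) * zonal_int (j + k + 1) (\<lambda>t. t ^ (n - j))))"
  proof (intro sum.cong refl)
    fix j
    have "zonal_int (k + 1) (\<lambda>s. s ^ (n - j) * sqrt (1 - s\<^sup>2) ^ j) = zonal_int (j + k + 1) (\<lambda>t. t ^ (n - j))"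
      unfolding zonal_int_def
      by (auto intro!: integral_cong simp: sin_squared_eq[symmetric] sin_ge_zero power_add)
    then show "((n choose j) * t ^ (n - j) * sqrt (1 - t\<^sup>2) ^ j * zonal_int k (\<lambda>w. w ^ j)) * zonal_int (k + 1) (\<lambda>s. s ^ (n - j) * sqrt (1 - s\<^sup>2) ^ j)
      = (n choose j) * cos \<beta> ^ (n - j) * sin \<beta> ^ j * (zonal_int k (\<lambda>t. t ^ j) * zonal_int (j + k + 1) (\<lambda>t. t ^ (n - j)))"
      by (simp add: \<beta>)
  qed
  also have "\<dots> = zonal_int k (\<lambda>_. 1) * zonal_int (k + 1) (\<lambda>x. x ^ n)"
    by (subst rotated_moment) simp
  finally show ?thesis .
qed

lemma zonal_int_le_diff:
  assumes "continuous_on {-1..1} f" "continuous_on {-1..1} g"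
    "\<And>t. -1 \<le> t \<Longrightarrow> t \<le> 1 \<Longrightarrow> \<bar>f t - g t\<bar> \<le> B"
  shows "\<bar>zonal_int k f - zonal_int k g\<bar> \<le> B * zonal_int k (\<lambda>_. 1)"
  using zonal_int_abs_le[of "\<lambda>t. f t - g t" B k] zonal_int_diff[OF assms(1,2), of k] assms
  by (auto intro!: continuous_intros)

lemma slice_int_le_diff:
  assumes "continuous_on {-1..1} f" "continuous_on {-1..1} g"
    "\<And>t. -1 \<le> t \<Longrightarrow> t \<le> 1 \<Longrightarrow> \<bar>f t - g t\<bar> \<le> B" "s \<in> {-1..1}" "t \<in> {-1..1}"
  shows "\<bar>slice_int k f s t - slice_int k g s t\<bar> \<le> B * zonal_int k (\<lambda>_. 1)"
  unfolding slice_int_def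
proof (rule zonal_int_le_diff[OF slice_arg_continuous[OF assms(1,4,5)] slice_arg_continuous[OF assms(2,4,5)]])
  fix w :: real assume "-1 \<le> w" "w \<le> 1"
  then show "\<bar>f (s * t + sqrt (1 - s\<^sup>2) * sqrt (1 - t\<^sup>2) * w) - g (s * t + sqrt (1 - s\<^sup>2) * sqrt (1 - t\<^sup>2) * w)\<bar> \<le> B"
    using slice_arg_bounds[OF assms(4,5), of w] by (intro assms(3)) simp_all
qed

lemma eq_if_all_close:
  fixes a b C :: real
  assumes "\<And>e. e > 0 \<Longrightarrow> \<bar>a - b\<bar> \<le> C * e"
  shows "a = b"
proof (rule ccontr)
  assume "a \<noteq> b"
  then have p: "\<bar>a - b\<bar> > 0" by simp
  have C: "\<bar>C\<bar> + 1 > 0" by simp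
  let ?e = "\<bar>a - b\<bar> / (\<bar>C\<bar> + 1) / 2"
  have "\<bar>a - b\<bar> \<le> C * ?e" using p C by (intro assms) auto
  also have "\<dots> \<le> (\<bar>C\<bar> + 1) * ?e" using p C by (intro mult_right_mono) auto
  also have "\<dots> = \<bar>a - b\<bar> / 2" using C by (simp add: field_simps)
  finally show False using p by simp
qed

text \<open>Rotation invariance of the integral over S^(k+1), passed from powers to continuous
  functions by linearity and uniform approximation. The point is that the right side does not
  contain \<open>t\<close>.\<close>

lemma slice_int_mean:
  assumes g: "continuous_on {-1..1} g" and t: "t \<in> {-1..1}"
  shows "zonal_int (k + 1) (\<lambda>s. slice_int k g s t) = zonal_int k (\<lambda>_. 1) * zonal_int (k + 1) g"
proof -
  have poly: "zonal_int (k + 1) (\<lambda>s. slice_int k (poly p) s t) = zonal_int k (\<lambda>_. 1) * zonal_int (k + 1) (poly p)" for p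
  proof -
    have cont: "continuous_on {-1..1} (\<lambda>x::real. x ^ i)" for i by (intro continuous_intros)
    have "slice_int k (poly p) s t = (\<Sum>i\<le>degree p. coeff p i * slice_int k (\<lambda>x. x ^ i) s t)" if "s \<in> {-1..1}" for s
      unfolding slice_int_def poly_altdef
      by (subst zonal_int_sum) (auto intro!: continuous_intros simp: zonal_int_cmult)
    then have "zonal_int (k + 1) (\<lambda>s. slice_int k (poly p) s t) =
        zonal_int (k + 1) (\<lambda>s. \<Sum>i\<le>degree p. coeff p i * slice_int k (\<lambda>x. x ^ i) s t)"
      by (intro zonal_int_cong) auto
    also have "\<dots> = (\<Sum>i\<le>degree p. coeff p i * (zonal_int k (\<lambda>_. 1) * zonal_int (k + 1) (\<lambda>x. x ^ i)))"
      by (subst zonal_int_sum)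
        (auto intro!: continuous_intros slice_int_continuous1[OF cont t] simp: zonal_int_cmult slice_int_power[OF t, simplified])
    also have "\<dots> = zonal_int k (\<lambda>_. 1) * zonal_int (k + 1) (poly p)"
      unfolding poly_altdef
      by (subst zonal_int_sum) (auto intro!: continuous_intros simp: zonal_int_cmult sum_distrib_left mult_ac)
    finally show ?thesis .
  qed
  let ?C = "2 * (zonal_int k (\<lambda>_. 1) * zonal_int (k + 1) (\<lambda>_. 1))"
  show ?thesis
  proof (rule eq_if_all_close[where C = ?C])
    fix e :: real assume "e > 0"
    then obtain p where p: "\<And>t. -1 \<le> t \<Longrightarrow> t \<le> 1 \<Longrightarrow> \<bar>g t - poly p t\<bar> < e"
      using weierstrass_poly[OF g] by blast
    have cp: "continuous_on {-1..1} (poly p)" by (intro continuous_intros)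
    have p': "\<And>t. -1 \<le> t \<Longrightarrow> t \<le> 1 \<Longrightarrow> \<bar>g t - poly p t\<bar> \<le> e" using p by (simp add: less_imp_le)
    have "\<bar>zonal_int (k + 1) (\<lambda>s. slice_int k g s t) - zonal_int (k + 1) (\<lambda>s. slice_int k (poly p) s t)\<bar>
       \<le> (e * zonal_int k (\<lambda>_. 1)) * zonal_int (k + 1) (\<lambda>_. 1)"
      by (rule zonal_int_le_diff[OF slice_int_continuous1[OF g t] slice_int_continuous1[OF cp t]])
        (auto intro!: slice_int_le_diff[OF g cp p'] t)
    moreover have "\<bar>zonal_int (k + 1) g - zonal_int (k + 1) (poly p)\<bar> \<le> e * zonal_int (k + 1) (\<lambda>_. 1)"
      by (rule zonal_int_le_diff[OF g cp p'])
    then have "\<bar>zonal_int k (\<lambda>_. 1) * zonal_int (k + 1) g - zonal_int k (\<lambda>_. 1) * zonal_int (k + 1) (poly p)\<bar>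
       \<le> zonal_int k (\<lambda>_. 1) * (e * zonal_int (k + 1) (\<lambda>_. 1))"
      unfolding right_diff_distrib[symmetric] abs_mult
      using zonal_int_nonneg[of "\<lambda>_. 1" k] by (auto intro!: mult_left_mono)
    ultimately show "\<bar>zonal_int (k + 1) (\<lambda>s. slice_int k g s t) - zonal_int k (\<lambda>_. 1) * zonal_int (k + 1) g\<bar> \<le> ?C * e"
      unfolding poly by (simp add: mult_ac abs_le_iff)
  qed
qed

text \<open>A Riemann sum at equally spaced angles whose weights are the exact masses of the cells,
  so constants are integrated without error. Nodes and weights depend on \<open>d\<close> only, so
  one rule serves a whole equicontinuous family of integrands.\<close>

lemma zonal_quadrature:
  assumes k: "k \<ge> 1" and d: "d > 0"
  obtains N :: nat and x w where "\<And>i. i < N \<Longrightarrow> x i \<in> {-1..1}" "\<And>i. i < N \<Longrightarrow> w i \<ge> 0"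
    "(\<Sum>i<N. w i) = zonal_int k (\<lambda>_. 1)"
    "\<And>F e. continuous_on {-1..1} F \<Longrightarrow>
       (\<And>a b. a \<in> {0..pi} \<Longrightarrow> b \<in> {0..pi} \<Longrightarrow> \<bar>a - b\<bar> < d \<Longrightarrow> \<bar>F (cos a) - F (cos b)\<bar> \<le> e) \<Longrightarrow>
       \<bar>zonal_int k F - (\<Sum>i<N. w i * F (x i))\<bar> \<le> e * zonal_int k (\<lambda>_. 1)"
proof -
  obtain N :: nat where N: "pi / d < real N" using reals_Archimedean2 by blast
  then have N0: "N > 0" using d by (cases N) (auto simp: divide_less_0_iff not_less)
  define \<theta> where "\<theta> i = pi * real i / real N" for i
  have \<theta>: "\<theta> i \<in> {0..pi}" if "i \<le> N" for i
    using that N0 by (auto simp: \<theta>_def divide_simps)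
  have step: "\<theta> i \<le> \<theta> (Suc i)" "\<theta> (Suc i) - \<theta> i < d" for i
    using N0 N d by (auto simp: \<theta>_def field_simps)
  define W where "W s = sin s ^ (k - 1)" for s :: real
  have W: "continuous_on A W" for A unfolding W_def by (intro continuous_intros)
  define w where "w i = integral {\<theta> i..\<theta> (Suc i)} W" for i
  have split: "integral {0..pi} G = (\<Sum>i<N. integral {\<theta> i..\<theta> (Suc i)} G)"
    if G: "continuous_on {0..pi} G" for G :: "real \<Rightarrow> real"
  proof -
    have "integral {0..\<theta> n} G = (\<Sum>i<n. integral {\<theta> i..\<theta> (Suc i)} G)" if "n \<le> N" for n
      using that
    proof (induction n)
      case (Suc n)
      have "G integrable_on {0..\<theta> (Suc n)}"
        using \<theta>[of "Suc n"] Suc.prems by (intro integrable_continuous_real continuous_on_subset[OF G]) auto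
      from Henstock_Kurzweil_Integration.integral_combine[OF _ step(1) this] \<theta>[of n] Suc show ?case by auto
    qed (simp add: \<theta>_def)
    from this[of N] N0 show ?thesis by (simp add: \<theta>_def)
  qed
  have Wnn: "W s \<ge> 0" if "s \<in> {\<theta> i..\<theta> (Suc i)}" "i < N" for s i
    using that \<theta>[of i] \<theta>[of "Suc i"] by (auto simp: W_def intro!: zero_le_power sin_ge_zero)
  show ?thesis
  proof (rule that[of N "\<lambda>i. cos (\<theta> i)" w])
    show "w i \<ge> 0" if "i < N" for i
      unfolding w_def using Wnn that W by (intro integral_nonneg integrable_continuous_real) auto
    show w1: "(\<Sum>i<N. w i) = zonal_int k (\<lambda>_. 1)"
      using split[OF W] k by (simp add: w_def zonal_int_def W_def[abs_def])
    fix F :: "real \<Rightarrow> real" and e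
    assume F: "continuous_on {-1..1} F"
      "\<And>a b. a \<in> {0..pi} \<Longrightarrow> b \<in> {0..pi} \<Longrightarrow> \<bar>a - b\<bar> < d \<Longrightarrow> \<bar>F (cos a) - F (cos b)\<bar> \<le> e"
    have FW: "continuous_on A (\<lambda>s. F (cos s) * W s)" for A
      by (intro continuous_intros W continuous_on_compose_cos F)
    have cell: "\<bar>integral {\<theta> i..\<theta> (Suc i)} (\<lambda>s. F (cos s) * W s) - w i * F (cos (\<theta> i))\<bar> \<le> e * w i" if i: "i < N" for i
    proof -
      have "integral {\<theta> i..\<theta> (Suc i)} (\<lambda>s. F (cos s) * W s) - w i * F (cos (\<theta> i)) =
         integral {\<theta> i..\<theta> (Suc i)} (\<lambda>s. F (cos s) * W s - F (cos (\<theta> i)) * W s)"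
      proof -
        have "(\<lambda>s. F (cos (\<theta> i)) * W s) integrable_on {\<theta> i..\<theta> (Suc i)}"
          by (intro integrable_continuous_real continuous_intros W)
        from integral_diff[OF integrable_continuous_real[OF FW] this] show ?thesis
          by (simp add: w_def mult.commute)
      qed
      also have "norm \<dots> \<le> integral {\<theta> i..\<theta> (Suc i)} (\<lambda>s. e * W s)"
      proof (rule integral_norm_bound_integral)
        show "(\<lambda>s. F (cos s) * W s - F (cos (\<theta> i)) * W s) integrable_on {\<theta> i..\<theta> (Suc i)}"
          by (intro integrable_continuous_real continuous_intros FW W)
        show "(\<lambda>s. e * W s) integrable_on {\<theta> i..\<theta> (Suc i)}"
          by (intro integrable_continuous_real continuous_intros W)
        fix s assume s: "s \<in> {\<theta> i..\<theta> (Suc i)}"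
        have "\<bar>F (cos s) - F (cos (\<theta> i))\<bar> \<le> e"
          using s step(2)[of i] \<theta>[of i] \<theta>[of "Suc i"] i by (intro F(2)) auto
        then show "norm (F (cos s) * W s - F (cos (\<theta> i)) * W s) \<le> e * W s"
          using Wnn[OF s i] by (simp add: left_diff_distrib[symmetric] abs_mult mult_right_mono)
      qed
      finally show ?thesis by (simp add: w_def)
    qed
    have "zonal_int k F - (\<Sum>i<N. w i * F (cos (\<theta> i))) =
       (\<Sum>i<N. integral {\<theta> i..\<theta> (Suc i)} (\<lambda>s. F (cos s) * W s) - w i * F (cos (\<theta> i)))"
      using split[OF FW] k by (simp add: zonal_int_def W_def sum_subtractf)
    also have "\<bar>\<dots>\<bar> \<le> (\<Sum>i<N. e * w i)"
      by (rule order_trans[OF sum_abs sum_mono]) (use cell in auto)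
    also have "\<dots> = e * zonal_int k (\<lambda>_. 1)" by (simp add: w1 flip: sum_distrib_left)
    finally show "\<bar>zonal_int k F - (\<Sum>i<N. w i * F (cos (\<theta> i)))\<bar> \<le> e * zonal_int k (\<lambda>_. 1)" .
  qed auto
qed

definition sph_lift :: "nat \<Rightarrow> real \<Rightarrow> (nat \<Rightarrow> real) \<Rightarrow> nat \<Rightarrow> real" where
  "sph_lift k s \<xi> i = (if i \<le> k then sqrt (1 - s\<^sup>2) * \<xi> i else if i = Suc k then s else 0)"

lemma ip_sph_lift:
  "ip (Suc k) (sph_lift k s \<xi>) (sph_lift k t \<eta>) = s * t + sqrt (1 - s\<^sup>2) * sqrt (1 - t\<^sup>2) * ip k \<xi> \<eta>"
  by (simp add: ip_def sph_lift_def sum_distrib_left mult_ac)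

lemma sph_lift_in:
  assumes "s \<in> {-1..1}" "\<xi> \<in> sph k"
  shows "sph_lift k s \<xi> \<in> sph (Suc k)"
proof -
  have "s\<^sup>2 \<le> 1" using assms by (auto simp: abs_square_le_1 abs_le_iff)
  then have "ip (Suc k) (sph_lift k s \<xi>) (sph_lift k s \<xi>) = 1"
    using assms by (simp add: ip_sph_lift sph_ip flip: power2_eq_square)
  then show ?thesis by (auto simp: sph_def ip_def power2_eq_square sph_lift_def)
qed

text \<open>Fixed heights and weights turn \<open>g\<close> into a positive definite function on
  S^k, so by induction the slice integral is a positive semidefinite kernel in the heights. All rows
  of this kernel have the same integral C. With quadrature weights its quadratic form is therefore
  close to C times the total mass, which forces C to be nonnegative.\<close>

theorem zonal_pd_mean_nonneg:
  assumes "continuous_on {-1..1} g" "zonal_pd k g"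
  shows "zonal_int k g \<ge> 0"
  using assms
proof (induction k arbitrary: g)
  case 0
  define e where "e b i = (if i = 0 then (if b then 1 else -1) else 0 :: real)" for b and i :: nat
  have "0 \<le> (\<Sum>i\<in>{True, False}. \<Sum>j\<in>{True, False}. 1 * 1 * g (ip 0 (e i) (e j)))"
    using 0 by (intro zonal_pd_family) (auto simp: sph_def e_def)
  then show ?case by (simp add: zonal_int_def ip_def e_def)
next
  case (Suc k)
  note g = Suc.prems(1)
  have psd: "0 \<le> (\<Sum>i\<in>I. \<Sum>j\<in>I. w i * w j * slice_int k g (x i) (x j))"
    if I: "finite I" and x: "\<And>i. i \<in> I \<Longrightarrow> x i \<in> {-1..1}" for I :: "nat set" and w x
  proof -
    define h where "h v = (\<Sum>i\<in>I. \<Sum>j\<in>I. w i * w j * g (x i * x j + sqrt (1 - (x i)\<^sup>2) * sqrt (1 - (x j)\<^sup>2) * v))" for v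
    have ch: "continuous_on {-1..1} h"
      unfolding h_def by (intro continuous_intros slice_arg_continuous g x)
    have "zonal_pd k h" unfolding zonal_pd_def
    proof (intro allI impI)
      fix A :: "(nat \<Rightarrow> real) set" and c :: "(nat \<Rightarrow> real) \<Rightarrow> real" assume A: "finite A \<and> A \<subseteq> sph k"
      have "(\<Sum>\<xi>\<in>A. \<Sum>\<eta>\<in>A. c \<xi> * c \<eta> * h (ip k \<xi> \<eta>)) =
         (\<Sum>\<xi>\<in>A. \<Sum>\<eta>\<in>A. \<Sum>i\<in>I. \<Sum>j\<in>I. (c \<xi> * w i) * (c \<eta> * w j) * g (ip (Suc k) (sph_lift k (x i) \<xi>) (sph_lift k (x j) \<eta>)))"
        unfolding h_def ip_sph_lift by (simp add: sum_distrib_left mult_ac)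
      also have "\<dots> = (\<Sum>\<xi>\<in>A. \<Sum>i\<in>I. \<Sum>\<eta>\<in>A. \<Sum>j\<in>I. (c \<xi> * w i) * (c \<eta> * w j) * g (ip (Suc k) (sph_lift k (x i) \<xi>) (sph_lift k (x j) \<eta>)))"
        by (intro sum.cong refl sum.swap)
      also have "\<dots> = (\<Sum>p\<in>A \<times> I. \<Sum>q\<in>A \<times> I. (c (fst p) * w (snd p)) * (c (fst q) * w (snd q)) *
          g (ip (Suc k) (sph_lift k (x (snd p)) (fst p)) (sph_lift k (x (snd q)) (fst q))))"
        by (simp add: sum.cartesian_product')
      also have "\<dots> \<ge> 0"
        using A I x by (intro zonal_pd_family[OF Suc.prems(2)] sph_lift_in) auto
      finally show "0 \<le> (\<Sum>\<xi>\<in>A. \<Sum>\<eta>\<in>A. c \<xi> * c \<eta> * h (ip k \<xi> \<eta>))" .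
    qed
    from Suc.IH[OF ch this] have "0 \<le> zonal_int k h" .
    also have "\<dots> = (\<Sum>i\<in>I. \<Sum>j\<in>I. w i * w j * slice_int k g (x i) (x j))"
      unfolding h_def slice_int_def
      by (subst zonal_int_sum, use I in \<open>force intro!: continuous_intros slice_arg_continuous g x\<close>,
          use I in \<open>force intro!: continuous_intros slice_arg_continuous g x\<close>,
          intro sum.cong refl, subst zonal_int_sum)
         (use I in \<open>auto intro!: continuous_intros slice_arg_continuous g x simp: zonal_int_cmult\<close>)
    finally show ?thesis .
  qed
  define C where "C = zonal_int k (\<lambda>_. 1) * zonal_int (Suc k) g"
  define V where "V = zonal_int (Suc k) (\<lambda>_. 1)"
  have V: "V > 0" unfolding V_def by (rule zonal_int_one_pos) simp
  have lower: "C \<ge> - (e * V)" if e: "e > 0" for e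
  proof -
    have "continuous_on ({0..pi} \<times> {-1..1}) (\<lambda>z. (\<lambda>(s, t). slice_int k g s t) (cos (fst z), snd z))"
      by (rule continuous_on_compose2[OF slice_int_continuous[OF g]]) (auto intro!: continuous_intros)
    then have "uniformly_continuous_on ({0..pi} \<times> {-1..1}) (\<lambda>z. (\<lambda>(s, t). slice_int k g s t) (cos (fst z), snd z))"
      by (intro compact_uniformly_continuous compact_Times) auto
    then obtain d where d: "d > 0" "\<And>z z'. z \<in> {0..pi} \<times> {-1..1} \<Longrightarrow> z' \<in> {0..pi} \<times> {-1..1} \<Longrightarrow> dist z' z < d \<Longrightarrow>
       dist ((\<lambda>(s, t). slice_int k g s t) (cos (fst z'), snd z')) ((\<lambda>(s, t). slice_int k g s t) (cos (fst z), snd z)) < e"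
      using e unfolding uniformly_continuous_on_def by blast
    have unif: "\<bar>slice_int k g (cos a) t - slice_int k g (cos b) t\<bar> \<le> e"
      if "a \<in> {0..pi}" "b \<in> {0..pi}" "\<bar>a - b\<bar> < d" "t \<in> {-1..1}" for a b t
      using d(2)[of "(b, t)" "(a, t)"] that by (auto simp: dist_Pair_Pair dist_real_def less_imp_le)
    show ?thesis
    proof (rule zonal_quadrature[of "Suc k" d, OF _ d(1)])
      fix N :: nat and x w assume q: "\<And>i. i < N \<Longrightarrow> x i \<in> {-1..1}" "\<And>i. i < N \<Longrightarrow> w i \<ge> 0"
      "(\<Sum>i<N. w i) = zonal_int (Suc k) (\<lambda>_. 1)"
      "\<And>F e. continuous_on {-1..1} F \<Longrightarrow>
       (\<And>a b. a \<in> {0..pi} \<Longrightarrow> b \<in> {0..pi} \<Longrightarrow> \<bar>a - b\<bar> < d \<Longrightarrow> \<bar>F (cos a) - F (cos b)\<bar> \<le> e) \<Longrightarrow>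
       \<bar>zonal_int (Suc k) F - (\<Sum>i<N. w i * F (x i))\<bar> \<le> e * zonal_int (Suc k) (\<lambda>_. 1)"
    have close: "\<bar>C - (\<Sum>i<N. w i * slice_int k g (x i) (x j))\<bar> \<le> e * V" if j: "j < N" for j
    proof -
      have "zonal_int (Suc k) (\<lambda>s. slice_int k g s (x j)) = C"
        using slice_int_mean[OF g q(1)[OF j], of k] by (simp add: C_def)
      then show ?thesis
        using q(4)[OF slice_int_continuous1[OF g q(1)[OF j], of k], of e] unif q(1)[OF j] by (simp add: V_def)
    qed
    have "0 \<le> (\<Sum>i<N. \<Sum>j<N. w i * w j * slice_int k g (x i) (x j))"
      by (rule psd) (use q(1) in auto)
    also have "\<dots> = (\<Sum>j<N. \<Sum>i<N. w i * w j * slice_int k g (x i) (x j))" by (rule sum.swap)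
    also have "\<dots> = (\<Sum>j<N. w j * (\<Sum>i<N. w i * slice_int k g (x i) (x j)))"
      by (simp add: sum_distrib_left mult_ac)
    also have "\<dots> \<le> (\<Sum>j<N. w j * (C + e * V))"
      using close q(2) by (intro sum_mono mult_left_mono) (auto simp: abs_le_iff algebra_simps)
    also have "\<dots> = V * (C + e * V)" by (simp add: q(3) V_def flip: sum_distrib_right)
    finally show ?thesis using V by (simp add: zero_le_mult_iff)
    qed simp
  qed
  have "C \<ge> 0"
  proof (rule ccontr)
    assume "\<not> C \<ge> 0"
    then show False using lower[of "- C / (2 * V)"] V by (simp add: field_simps)
  qed
  moreover have "zonal_int k (\<lambda>_. 1) > 0"
    by (cases "k = 0") (auto intro: zonal_int_one_pos simp: zonal_int_def[of 0])
  ultimately show ?case by (simp add: C_def zero_le_mult_iff)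
qed

lemma zonal_coeff_nonneg:
  assumes "k \<ge> 1" "continuous_on {-1..1} g" "zonal_pd k g"
  shows "zonal_int k (\<lambda>t. g t * poly (ultra k n) t) \<ge> 0"
  by (rule zonal_pd_mean_nonneg) (auto intro!: continuous_intros zonal_pd_mult_ultra assms)

section \<open>Ultraspherical expansions and strict positive definiteness\<close>

text \<open>The pairing is left unnormalised; the coefficient in the expansion is its quotient by
  \<open>ultra_norm\<close>, which has the same sign.\<close>

definition zonal_coeff :: "nat \<Rightarrow> (real \<Rightarrow> real) \<Rightarrow> nat \<Rightarrow> real" where
  "zonal_coeff k g n = zonal_int k (\<lambda>t. g t * poly (ultra k n) t)"

lemma bounded_on_interval:
  fixes g :: "real \<Rightarrow> real"
  assumes "continuous_on {-1..1} g"
  shows "\<exists>B>0. \<forall>t. -1 \<le> t \<longrightarrow> t \<le> 1 \<longrightarrow> \<bar>g t\<bar> \<le> B"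
proof -
  have "bounded (g ` {-1..1})"
    by (intro compact_imp_bounded compact_continuous_image assms compact_Icc)
  then obtain B where "B > 0" "\<forall>x\<in>g ` {-1..1}. norm x \<le> B" using bounded_pos by blast
  then show ?thesis by (intro exI[of _ B]) auto
qed

lemma zonal_int_linear_combination:
  assumes "finite I" "\<And>i. i \<in> I \<Longrightarrow> continuous_on {-1..1} (f i)"
  shows "zonal_int k (\<lambda>t. \<Sum>i\<in>I. b i * f i t) = (\<Sum>i\<in>I. b i * zonal_int k (f i))"
  using assms by (subst zonal_int_sum) (auto intro!: continuous_intros simp: zonal_int_cmult)

lemma zonal_coeff_combination:
  assumes "k \<ge> 1" "n \<le> d"
  shows "zonal_coeff k (\<lambda>t. \<Sum>i\<le>d. b i * poly (ultra k i) t) n = b n * ultra_norm k n"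
proof -
  have "zonal_coeff k (\<lambda>t. \<Sum>i\<le>d. b i * poly (ultra k i) t) n =
     zonal_int k (\<lambda>t. \<Sum>i\<le>d. b i * (poly (ultra k i) t * poly (ultra k n) t))"
    unfolding zonal_coeff_def by (simp add: sum_distrib_right mult.assoc)
  also have "\<dots> = (\<Sum>i\<le>d. b i * zonal_int k (\<lambda>t. poly (ultra k i) t * poly (ultra k n) t))"
    by (subst zonal_int_sum) (auto intro!: continuous_intros simp: zonal_int_cmult)
  also have "\<dots> = (\<Sum>i\<in>{n}. b i * zonal_int k (\<lambda>t. poly (ultra k i) t * poly (ultra k n) t))"
    using assms by (intro sum.mono_neutral_right) (auto simp: ultra_orthogonal)
  also have "\<dots> = b n * ultra_norm k n"
    by (simp add: ultra_norm_def power2_eq_square)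
  finally show ?thesis .
qed

lemma poly_ultra_expansion:
  assumes k: "k \<ge> 1" and "degree p \<le> d"
  shows "poly p t = (\<Sum>n\<le>d. zonal_coeff k (poly p) n / ultra_norm k n * poly (ultra k n) t)"
proof -
  obtain b where b: "p = (\<Sum>n\<le>d. smult (b n) (ultra k n))" using ultra_span[OF assms] .
  have pt: "poly p = (\<lambda>t. \<Sum>i\<le>d. b i * poly (ultra k i) t)" by (rule ext) (simp add: b poly_sum)
  have "zonal_coeff k (poly p) n / ultra_norm k n = b n" if "n \<le> d" for n
    unfolding pt zonal_coeff_combination[OF k that] using ultra_norm_pos[OF k, of n] by simp
  then show ?thesis by (simp add: pt)
qed

lemma zonal_int_mult_poly:
  assumes k: "k \<ge> 1" and g: "continuous_on {-1..1} g" and "degree p \<le> d"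
  shows "zonal_int k (\<lambda>t. g t * poly p t) =
    (\<Sum>n\<le>d. zonal_coeff k (poly p) n / ultra_norm k n * zonal_coeff k g n)"
proof -
  have "zonal_int k (\<lambda>t. g t * poly p t) =
     zonal_int k (\<lambda>t. \<Sum>n\<le>d. zonal_coeff k (poly p) n / ultra_norm k n * (g t * poly (ultra k n) t))"
    by (subst poly_ultra_expansion[OF k assms(3)]) (simp add: sum_distrib_left mult_ac)
  also have "\<dots> = (\<Sum>n\<le>d. zonal_coeff k (poly p) n / ultra_norm k n * zonal_coeff k g n)"
    unfolding zonal_coeff_def[of k g]
    by (rule zonal_int_linear_combination) (auto intro!: continuous_intros g)
  finally show ?thesis .
qed

text \<open>Orthogonality to all polynomials passes to the uniform limit \<open>g\<close> itself, so
  the square of \<open>g\<close> has integral 0. Positivity of the weight gives the claim inside the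
  interval, continuity gives it at the endpoints.\<close>

lemma zonal_coeff_unique:
  assumes k: "k \<ge> 1" and g: "continuous_on {-1..1} g" and 0: "\<And>n. zonal_coeff k g n = 0"
    and t: "t \<in> {-1..1}"
  shows "g t = 0"
proof -
  obtain B where B: "B > 0" "\<And>t. -1 \<le> t \<Longrightarrow> t \<le> 1 \<Longrightarrow> \<bar>g t\<bar> \<le> B" using bounded_on_interval[OF g] by blast
  have gp: "zonal_int k (\<lambda>t. g t * poly p t) = 0" for p
    using zonal_int_mult_poly[OF k g order_refl] by (simp add: 0)
  have "zonal_int k (\<lambda>t. g t * g t) = 0"
  proof (rule eq_if_all_close[where C = "B * zonal_int k (\<lambda>_. 1)"])
    fix e :: real assume "e > 0"
    then obtain p where p: "\<And>t. -1 \<le> t \<Longrightarrow> t \<le> 1 \<Longrightarrow> \<bar>g t - poly p t\<bar> < e"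
      using weierstrass_poly[OF g] by blast
    have "\<bar>zonal_int k (\<lambda>t. g t * g t) - zonal_int k (\<lambda>t. g t * poly p t)\<bar> \<le> (B * e) * zonal_int k (\<lambda>_. 1)"
    proof (rule zonal_int_le_diff)
      fix t :: real assume t: "-1 \<le> t" "t \<le> 1"
      have "\<bar>g t * g t - g t * poly p t\<bar> = \<bar>g t\<bar> * \<bar>g t - poly p t\<bar>"
        by (simp add: right_diff_distrib[symmetric] abs_mult)
      also have "\<dots> \<le> B * e" using B t p[OF t] by (intro mult_mono) auto
      finally show "\<bar>g t * g t - g t * poly p t\<bar> \<le> B * e" .
    qed (auto intro!: continuous_intros g)
    then show "\<bar>zonal_int k (\<lambda>t. g t * g t) - 0\<bar> \<le> B * zonal_int k (\<lambda>_. 1) * e"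
      by (simp add: gp mult_ac)
  qed
  then have open0: "g s = 0" if "s \<in> {-1<..<1}" for s
    using zonal_int_pos[of "\<lambda>t. g t * g t" s k] that k g
    by (fastforce intro!: continuous_intros simp: not_sum_power2_lt_zero zero_less_mult_iff)
  have cl: "closure {-1<..<1::real} = {-1..1}" by simp
  show ?thesis
    by (rule continuous_constant_on_closure[of "{-1<..<1}" g 0 t]) (use cl open0 g t in auto)
qed

section \<open>Expansions with nonnegative coefficients\<close>

text \<open>Integration by parts with the polynomial (1 + t)^N, followed by the bound t \<le> 1. The
  normalised bumps thus form an approximate identity at t = 1 with rate 1/N.\<close>

lemma bump_concentration:
  assumes k: "k \<ge> 1"
  shows "N * zonal_int k (\<lambda>t. (1 + t) ^ N * (1 - t)) \<le> k * zonal_int k (\<lambda>t. (1 + t) ^ N)"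
proof -
  have "0 = zonal_int k (\<lambda>t. k * t * poly ([:1, 1:] ^ N) t - (1 - t\<^sup>2) * poly (pderiv ([:1, 1:] ^ N)) t)"
    using zonal_int_by_parts[OF k, of "[:1, 1:] ^ N"] by (rule sym)
  also have "\<dots> = zonal_int k (\<lambda>t. k * ((1 + t) ^ N * t) - N * ((1 + t) ^ N * (1 - t)))"
  proof (rule zonal_int_cong)
    fix t :: real
    have "(1 - t\<^sup>2) * poly (pderiv ([:1, 1:] ^ N)) t = N * ((1 + t) ^ N * (1 - t))"
      by (cases N) (simp_all add: pderiv_power_Suc pderiv_pCons poly_power power2_eq_square algebra_simps del: power_Suc, simp add: algebra_simps)
    then show "k * t * poly ([:1, 1:] ^ N) t - (1 - t\<^sup>2) * poly (pderiv ([:1, 1:] ^ N)) t =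
       k * ((1 + t) ^ N * t) - N * ((1 + t) ^ N * (1 - t))" by (simp add: poly_power)
  qed
  also have "\<dots> = k * zonal_int k (\<lambda>t. (1 + t) ^ N * t) - N * zonal_int k (\<lambda>t. (1 + t) ^ N * (1 - t))"
    by (subst zonal_int_diff) (auto intro!: continuous_intros simp: zonal_int_cmult)
  finally have "N * zonal_int k (\<lambda>t. (1 + t) ^ N * (1 - t)) = k * zonal_int k (\<lambda>t. (1 + t) ^ N * t)" by simp
  also have "\<dots> \<le> k * zonal_int k (\<lambda>t. (1 + t) ^ N)"
    by (intro mult_left_mono zonal_int_mono continuous_intros) (auto intro!: mult_left_le)
  finally show ?thesis .
qed

lemma bump_int_pos: "k \<ge> 1 \<Longrightarrow> zonal_int k (\<lambda>t. (1 + t) ^ N) > 0"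
  by (rule zonal_int_pos[of _ 0]) (auto intro!: continuous_intros)

text \<open>The polynomial \<open>ultra k n\<close> differs from 1 by a multiple of 1 - t, and the
  bump average of 1 - t is at most k/N.\<close>

lemma bump_coeff_limit:
  assumes k: "k \<ge> 1"
  shows "(\<lambda>N. zonal_coeff k (\<lambda>t. (1 + t) ^ N) n / zonal_int k (\<lambda>t. (1 + t) ^ N)) \<longlonglongrightarrow> 1"
proof -
  have "poly (ultra k n - 1) 1 = 0" by simp
  then obtain R where R: "ultra k n - 1 = [:-1, 1:] * R" by (metis poly_eq_0_iff_dvd dvdE)
  have U: "poly (ultra k n) t = 1 - (1 - t) * poly R t" for t
    using arg_cong[OF R, of "\<lambda>q. poly q t"] by (simp add: algebra_simps)
  obtain B where B: "B > 0" "\<And>t. -1 \<le> t \<Longrightarrow> t \<le> 1 \<Longrightarrow> \<bar>poly R t\<bar> \<le> B"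
    using bounded_on_interval[of "poly R"] continuous_on_poly[OF continuous_on_id] by blast
  have bound: "\<bar>zonal_coeff k (\<lambda>t. (1 + t) ^ N) n / zonal_int k (\<lambda>t. (1 + t) ^ N) - 1\<bar> \<le> B * k / N" if "N > 0" for N
  proof -
    let ?Z = "zonal_int k (\<lambda>t. (1 + t) ^ N)"
    have Z: "?Z > 0" by (rule bump_int_pos[OF k])
    have "zonal_coeff k (\<lambda>t. (1 + t) ^ N) n = zonal_int k (\<lambda>t. (1 + t) ^ N - (1 + t) ^ N * (1 - t) * poly R t)"
      unfolding zonal_coeff_def U by (simp add: algebra_simps)
    also have "\<dots> = ?Z - zonal_int k (\<lambda>t. (1 + t) ^ N * (1 - t) * poly R t)"
      by (subst zonal_int_diff) (auto intro!: continuous_intros)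
    finally have e0: "zonal_coeff k (\<lambda>t. (1 + t) ^ N) n = ?Z - zonal_int k (\<lambda>t. (1 + t) ^ N * (1 - t) * poly R t)" .
    have e: "zonal_coeff k (\<lambda>t. (1 + t) ^ N) n / ?Z - 1 = - zonal_int k (\<lambda>t. (1 + t) ^ N * (1 - t) * poly R t) / ?Z"
      unfolding e0 using Z by (simp add: diff_divide_distrib)
    have pb: "\<bar>(1 + t) ^ N * (1 - t) * poly R t\<bar> \<le> B * ((1 + t) ^ N * (1 - t))" if "-1 \<le> t" "t \<le> 1" for t
    proof -
      have nn: "(1 + t) ^ N * (1 - t) \<ge> 0" using that by auto
      show ?thesis using mult_left_mono[OF B(2)[OF that] nn]
        unfolding abs_mult[of "(1 + t) ^ N * (1 - t)"] abs_of_nonneg[OF nn] by (simp only: mult.commute)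
    qed
    have "zonal_int k (\<lambda>t. (1 + t) ^ N * (1 - t) * poly R t) \<le> zonal_int k (\<lambda>t. B * ((1 + t) ^ N * (1 - t)))"
      using pb by (intro zonal_int_mono continuous_intros) (auto simp: abs_le_iff)
    moreover have "zonal_int k (\<lambda>t. (-B) * ((1 + t) ^ N * (1 - t))) \<le> zonal_int k (\<lambda>t. (1 + t) ^ N * (1 - t) * poly R t)"
      using pb by (intro zonal_int_mono continuous_intros) (fastforce simp: abs_le_iff)
    ultimately have "\<bar>zonal_int k (\<lambda>t. (1 + t) ^ N * (1 - t) * poly R t)\<bar> \<le> B * zonal_int k (\<lambda>t. (1 + t) ^ N * (1 - t))"
      unfolding zonal_int_cmult by (simp add: abs_le_iff)
    also have "\<dots> \<le> B * (k * ?Z / N)"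
      using bump_concentration[OF k, of N] that B(1) by (intro mult_left_mono) (auto simp: field_simps)
    finally have "\<bar>zonal_int k (\<lambda>t. (1 + t) ^ N * (1 - t) * poly R t)\<bar> / ?Z \<le> B * (k * ?Z / N) / ?Z"
      using Z by (intro divide_right_mono) auto
    also have "\<dots> = B * k / N" using Z by simp
    finally show ?thesis unfolding e using Z by simp
  qed
  have "(\<lambda>N. zonal_coeff k (\<lambda>t. (1 + t) ^ N) n / zonal_int k (\<lambda>t. (1 + t) ^ N) - 1) \<longlonglongrightarrow> 0"
  proof (rule Lim_null_comparison)
    show "\<forall>\<^sub>F N in sequentially. norm (zonal_coeff k (\<lambda>t. (1 + t) ^ N) n / zonal_int k (\<lambda>t. (1 + t) ^ N) - 1) \<le> B * k / N"
      by (rule eventually_mono[OF eventually_gt_at_top[of 0]]) (use bound in auto)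
    show "(\<lambda>N. B * real k / real N) \<longlonglongrightarrow> 0" by (rule lim_const_over_n)
  qed
  from tendsto_add[OF this tendsto_const[of 1]] show ?thesis by simp
qed

text \<open>The kernel 1 + x.y is the inner product of the points extended by an additional
  coordinate 1, placed at index \<open>Suc k\<close>; its powers follow as Schur products.\<close>

lemma zonal_pd_bump: "zonal_pd k (\<lambda>t. (1 + t) ^ N)"
proof (induction N)
  case 0 show ?case using zonal_pd_one by simp
next
  case (Suc N)
  have "zonal_pd k (\<lambda>t. (1 + t) ^ N * (1 + t))"
  proof (rule zonal_pd_mult_factors[OF Suc, of "insert (Suc k) {..k}" _ "\<lambda>i x. if i = Suc k then 1 else x i"])
    fix x y show "1 + ip k x y = (\<Sum>a\<in>insert (Suc k) {..k}. (if a = Suc k then 1 else x a) * (if a = Suc k then 1 else y a))"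
      by (simp add: ip_def)
  qed simp
  then show ?case by (simp add: mult.commute)
qed

text \<open>The signs enter through convergence: pairing \<open>g\<close> with the bumps, whose
  coefficients are also nonnegative, bounds the partial sums of the weights by the supremum of |g|.
  The series then converges uniformly, and its sum has the coefficients of \<open>g\<close>, so it
  is \<open>g\<close>.\<close>

theorem zonal_expansion:
  assumes k: "k \<ge> 1" and g: "continuous_on {-1..1} g" and nn: "\<And>n. zonal_coeff k g n \<ge> 0"
    and t: "t \<in> {-1..1}"
  shows "(\<lambda>n. zonal_coeff k g n / ultra_norm k n * poly (ultra k n) t) sums g t"
proof -
  define w where "w n = zonal_coeff k g n / ultra_norm k n" for n
  have w: "w n \<ge> 0" for n using nn[of n] ultra_norm_pos[OF k, of n] by (simp add: w_def)
  obtain B where B: "B > 0" "\<And>t. -1 \<le> t \<Longrightarrow> t \<le> 1 \<Longrightarrow> \<bar>g t\<bar> \<le> B" using bounded_on_interval[OF g] by blast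
  have partial: "(\<Sum>n<L. w n) \<le> B" for L
  proof (rule LIMSEQ_le_const2)
    let ?r = "\<lambda>N n. zonal_coeff k (\<lambda>t. (1 + t) ^ N) n / zonal_int k (\<lambda>t. (1 + t) ^ N)"
    show "(\<lambda>N. \<Sum>n<L. w n * ?r N n) \<longlonglongrightarrow> (\<Sum>n<L. w n)"
      using tendsto_sum[of "{..<L}" "\<lambda>n N. w n * ?r N n" "\<lambda>n. w n * 1" sequentially]
        tendsto_mult[OF tendsto_const bump_coeff_limit[OF k]] by simp
    show "\<exists>M. \<forall>N\<ge>M. (\<Sum>n<L. w n * ?r N n) \<le> B"
    proof (intro exI allI impI)
      \<comment> \<open>The bump has degree at most \<open>N\<close>, so its pairing with
        \<open>g\<close> is the exact finite sum up to \<open>N\<close>; for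
        \<open>L \<le> N\<close> this sum contains the first \<open>L\<close> terms and otherwise
        only nonnegative ones.\<close>
      fix N assume N: "L \<le> N"
      let ?q = "\<lambda>t::real. (1 + t) ^ N"
      let ?Z = "zonal_int k ?q"
      have Z: "?Z > 0" by (rule bump_int_pos[OF k])
      have qpoly: "?q = poly ([:1, 1:] ^ N)" by (rule ext) (simp add: poly_power)
      have deg: "degree ([:1, 1::real:] ^ N) \<le> N"
        using degree_power_le[of "[:1, 1::real:]" N] by simp
      have cq: "zonal_coeff k ?q n \<ge> 0" for n
        unfolding zonal_coeff_def
        by (rule zonal_coeff_nonneg[OF k _ zonal_pd_bump]) (auto intro!: continuous_intros)
      have "(\<Sum>n<L. w n * zonal_coeff k ?q n) \<le> (\<Sum>n\<le>N. w n * zonal_coeff k ?q n)"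
        using N w cq by (intro sum_mono2) auto
      also have "\<dots> = zonal_int k (\<lambda>t. g t * ?q t)"
        using zonal_int_mult_poly[OF k g deg] unfolding qpoly[symmetric]
        by (simp add: w_def poly_power mult.commute)
      also have "\<dots> \<le> zonal_int k (\<lambda>t. B * ?q t)"
        using B by (intro zonal_int_mono continuous_intros g mult_right_mono) (auto simp: abs_le_iff)
      also have "\<dots> = B * ?Z" by (rule zonal_int_cmult)
      finally have "(\<Sum>n<L. w n * zonal_coeff k ?q n) / ?Z \<le> B" using Z by (simp add: field_simps)
      then show "(\<Sum>n<L. w n * ?r N n) \<le> B" by (simp add: sum_divide_distrib)
    qed
  qed
  have sw: "summable w" using w partial by (rule summableI_nonneg_bounded)
  define s where "s t = (\<Sum>n. w n * poly (ultra k n) t)" for t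
  have Ub: "\<bar>poly (ultra k n) t\<bar> \<le> 1" if "t \<in> {-1..1}" for n t using ultra_abs_le_1[OF k] that by auto
  have ul: "uniform_limit {-1..1} (\<lambda>L t. \<Sum>n<L. w n * poly (ultra k n) t) s sequentially"
    unfolding s_def
  proof (rule Weierstrass_m_test[OF _ sw])
    fix n and t :: real assume "t \<in> {-1..1}"
    then show "norm (w n * poly (ultra k n) t) \<le> w n"
      using Ub[of t n] w[of n] by (simp add: abs_mult mult_left_le)
  qed
  have cs: "continuous_on {-1..1} s"
    by (rule uniform_limit_theorem[OF _ ul]) (auto intro!: always_eventually continuous_intros)
  have coeff_s: "zonal_coeff k s n = zonal_coeff k g n" for n
  proof (rule eq_if_all_close[where C = "zonal_int k (\<lambda>_. 1)"])
    fix e :: real assume "e > 0"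
    with ul have "\<forall>\<^sub>F L in sequentially. \<forall>t\<in>{-1..1}. dist (\<Sum>n<L. w n * poly (ultra k n) t) (s t) < e"
      by (simp add: uniform_limit_iff)
    then have "\<forall>\<^sub>F L in sequentially. n < L \<and> (\<forall>t\<in>{-1..1}. dist (\<Sum>n<L. w n * poly (ultra k n) t) (s t) < e)"
      by (intro eventually_conj eventually_gt_at_top)
    then obtain L where L: "n < L" "\<And>t. t \<in> {-1..1} \<Longrightarrow> \<bar>(\<Sum>n<L. w n * poly (ultra k n) t) - s t\<bar> < e"
      unfolding eventually_sequentially dist_real_def by blast
    then obtain L' where L': "L = Suc L'" by (cases L) auto
    have "\<bar>zonal_coeff k s n - zonal_coeff k (\<lambda>t. \<Sum>n<L. w n * poly (ultra k n) t) n\<bar> \<le> e * zonal_int k (\<lambda>_. 1)"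
      unfolding zonal_coeff_def
    proof (rule zonal_int_le_diff)
      fix t :: real assume t: "-1 \<le> t" "t \<le> 1"
      have "\<bar>s t * poly (ultra k n) t - (\<Sum>n<L. w n * poly (ultra k n) t) * poly (ultra k n) t\<bar> =
        \<bar>(\<Sum>n<L. w n * poly (ultra k n) t) - s t\<bar> * \<bar>poly (ultra k n) t\<bar>"
        unfolding left_diff_distrib[symmetric] abs_mult by (simp add: abs_minus_commute)
      also have "\<dots> \<le> e * 1" using L(2)[of t] Ub[of t n] t by (intro mult_mono) auto
      finally show "\<bar>s t * poly (ultra k n) t - (\<Sum>n<L. w n * poly (ultra k n) t) * poly (ultra k n) t\<bar> \<le> e" by simp
    qed (auto intro!: continuous_intros cs)
    moreover have "zonal_coeff k (\<lambda>t. \<Sum>n<L. w n * poly (ultra k n) t) n = zonal_coeff k g n"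
      using zonal_coeff_combination[OF k, of n L' w] L(1) ultra_norm_pos[OF k, of n]
      unfolding L' lessThan_Suc_atMost by (simp add: w_def)
    ultimately show "\<bar>zonal_coeff k s n - zonal_coeff k g n\<bar> \<le> zonal_int k (\<lambda>_. 1) * e"
      by (simp add: mult.commute)
  qed
  have "g t - s t = 0"
  proof (rule zonal_coeff_unique[OF k _ _ t])
    show "continuous_on {-1..1} (\<lambda>t. g t - s t)" by (intro continuous_intros g cs)
    fix n
    have "zonal_coeff k (\<lambda>t. g t - s t) n = zonal_coeff k g n - zonal_coeff k s n"
      unfolding zonal_coeff_def left_diff_distrib
      by (subst zonal_int_diff) (auto intro!: continuous_intros g cs)
    then show "zonal_coeff k (\<lambda>t. g t - s t) n = 0" by (simp add: coeff_s)
  qed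
  moreover have "summable (\<lambda>n. w n * poly (ultra k n) t)"
  proof (rule summable_comparison_test'[OF sw])
    show "norm (w n * poly (ultra k n) t) \<le> w n" for n
      using Ub[OF t, of n] w[of n] by (simp add: abs_mult mult_left_le)
  qed
  ultimately show ?thesis unfolding w_def[symmetric] s_def by (simp add: summable_sums)
qed

section \<open>Quadratic forms and sufficiency for strict positive definiteness\<close>

definition quad_form :: "nat \<Rightarrow> (nat \<Rightarrow> real) set \<Rightarrow> ((nat \<Rightarrow> real) \<Rightarrow> real) \<Rightarrow> (real \<Rightarrow> real) \<Rightarrow> real" where
  "quad_form k A c g = (\<Sum>x\<in>A. \<Sum>y\<in>A. c x * c y * g (ip k x y))"

lemma quad_form_sums:
  assumes k: "k \<ge> 1" and g: "continuous_on {-1..1} g" and nn: "\<And>n. zonal_coeff k g n \<ge> 0"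
    and A: "A \<subseteq> sph k"
  shows "(\<lambda>n. zonal_coeff k g n / ultra_norm k n * quad_form k A c (poly (ultra k n))) sums quad_form k A c g"
proof -
  have "(\<lambda>n. \<Sum>x\<in>A. \<Sum>y\<in>A. c x * c y * (zonal_coeff k g n / ultra_norm k n * poly (ultra k n) (ip k x y)))
     sums quad_form k A c g"
    unfolding quad_form_def
  proof (intro sums_sum sums_mult zonal_expansion[OF k g nn])
    fix x y assume "x \<in> A" "y \<in> A"
    then show "ip k x y \<in> {-1..1}" using A ip_bounds[of x k y] by auto
  qed
  then show ?thesis by (simp add: quad_form_def sum_distrib_left mult_ac)
qed

lemma quad_form_ultra_nonneg:
  assumes "k \<ge> 1" "finite A" "A \<subseteq> sph k"
  shows "quad_form k A c (poly (ultra k n)) \<ge> 0"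
  using zonal_pd_ultra[OF assms(1)] assms by (auto simp: zonal_pd_def quad_form_def)

lemma zonal_pd_of_coeffs:
  assumes k: "k \<ge> 1" and g: "continuous_on {-1..1} g" and nn: "\<And>n. zonal_coeff k g n \<ge> 0"
  shows "zonal_pd k g"
  unfolding zonal_pd_def quad_form_def[symmetric]
proof (intro allI impI)
  fix A :: "(nat \<Rightarrow> real) set" and c :: "(nat \<Rightarrow> real) \<Rightarrow> real" assume A: "finite A \<and> A \<subseteq> sph k"
  show "0 \<le> quad_form k A c g"
    by (rule sums_le[OF _ sums_zero quad_form_sums[OF k g nn]])
       (use A nn in \<open>auto intro!: mult_nonneg_nonneg divide_nonneg_pos ultra_norm_pos quad_form_ultra_nonneg k\<close>)
qed

text \<open>Sonin's argument: the energy E dominates the square of the polynomial on [-1, 1],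
  increases weakly on the nonnegative axis and has integral twice the norm. The value at r = |t| is
  thus bounded by an average of E above r, and the norms tend to 0. On the circle cos(n theta) does
  not decay.\<close>

lemma ultra_tendsto_0:
  assumes k: "k \<ge> 2" and t: "-1 < t" "t < 1"
  shows "(\<lambda>n. poly (ultra k n) t) \<longlonglongrightarrow> 0"
proof -
  have k1: "k \<ge> 1" using k by simp
  define r where "r = \<bar>t\<bar>"
  have r: "0 \<le> r" "r < 1" using t by (auto simp: r_def)
  \<comment> \<open>A continuous weight living on (r, 1]; integrating against it turns the
    monotonicity of the energy into a bound by its integral.\<close>
  define b where "b s = max 0 (s - r)" for s
  have cb: "continuous_on {-1..1} b" unfolding b_def by (intro continuous_intros)
  have Zb: "zonal_int k b > 0"
    by (rule zonal_int_pos[of _ "(1 + r) / 2"]) (use r k in \<open>auto simp: b_def intro!: cb[unfolded b_def]\<close>)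
  have bound: "(poly (ultra k n) t)\<^sup>2 \<le> 4 * ultra_norm k n / zonal_int k b" if n: "n > 0" for n
  proof -
    define \<nu> where "\<nu> = n * (real n + real k - 1)"
    have \<nu>: "\<nu> > 0" using n k by (simp add: \<nu>_def)
    let ?p = "poly (ultra k n)" and ?p' = "poly (pderiv (ultra k n))" and ?p'' = "poly (pderiv (pderiv (ultra k n)))"
    define E where "E s = (?p s)\<^sup>2 + (1 - s\<^sup>2) * (?p' s)\<^sup>2 / \<nu>" for s
    have E': "(E has_real_derivative 2 * (real k - 1) * s * (?p' s)\<^sup>2 / \<nu>) (at s)" for s
    proof -
      let ?u = "ultra k n"
      have "E = poly (?u * ?u + smult (1 / \<nu>) ([:1, 0, -1:] * (pderiv ?u * pderiv ?u)))"
        by (rule ext) (simp add: E_def power2_eq_square algebra_simps diff_divide_distrib)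
      moreover have "poly (pderiv (?u * ?u + smult (1 / \<nu>) ([:1, 0, -1:] * (pderiv ?u * pderiv ?u)))) s =
         2 * ?p s * ?p' s + (- (2 * s) * (?p' s)\<^sup>2 + 2 * ?p' s * ((1 - s\<^sup>2) * ?p'' s)) / \<nu>"
        unfolding pderiv_add pderiv_mult pderiv_smult
        by (simp add: pderiv_pCons power2_eq_square algebra_simps add_divide_distrib diff_divide_distrib)
      ultimately have "(E has_real_derivative 2 * ?p s * ?p' s +
         (- (2 * s) * (?p' s)\<^sup>2 + 2 * ?p' s * ((1 - s\<^sup>2) * ?p'' s)) / \<nu>) (at s)"
        using poly_DERIV by metis
      moreover have "2 * ?p s * ?p' s + (- (2 * s) * (?p' s)\<^sup>2 + 2 * ?p' s * ((1 - s\<^sup>2) * ?p'' s)) / \<nu>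
         = 2 * (real k - 1) * s * (?p' s)\<^sup>2 / \<nu>"
        unfolding ultra_ode_eval[OF k1] \<nu>_def[symmetric] using \<nu>
        by (simp add: field_simps power2_eq_square)
      ultimately show ?thesis by simp
    qed
    have mono: "E r \<le> E s" if "r \<le> s" for s
    proof (rule DERIV_nonneg_imp_nondecreasing[OF that])
      fix x assume "r \<le> x" "x \<le> s"
      then have "2 * (real k - 1) * x * (?p' x)\<^sup>2 / \<nu> \<ge> 0" using r k \<nu> by auto
      with E'[of x] show "\<exists>y. (E has_real_derivative y) (at x) \<and> 0 \<le> y" by blast
    qed
    have Enn: "E s \<ge> 0" if "-1 \<le> s" "s \<le> 1" for s
      using that \<nu> by (auto simp: E_def abs_square_le_1 abs_le_iff intro!: add_nonneg_nonneg divide_nonneg_pos mult_nonneg_nonneg)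
    have cE: "continuous_on {-1..1} E" unfolding E_def using \<nu> by (auto intro!: continuous_intros)
    have "(?p t)\<^sup>2 = (?p r)\<^sup>2"
      using ultra_parity[of k n t] by (cases "t \<ge> 0") (auto simp: r_def power_mult_distrib simp flip: power_mult)
    also have "\<dots> \<le> E r" using r \<nu> by (auto simp: E_def power_le_one intro!: divide_nonneg_pos mult_nonneg_nonneg)
    finally have "(?p t)\<^sup>2 * zonal_int k b \<le> E r * zonal_int k b" using Zb by simp
    also have "\<dots> = zonal_int k (\<lambda>s. E r * b s)" by (rule zonal_int_cmult[symmetric])
    also have "\<dots> \<le> zonal_int k (\<lambda>s. 2 * E s)"
    proof (rule zonal_int_mono)
      fix s :: real assume s: "-1 \<le> s" "s \<le> 1"
      show "E r * b s \<le> 2 * E s"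
      proof (cases "s \<ge> r")
        case True
        have "E r * b s \<le> E s * b s" using mono[OF True] by (intro mult_right_mono) (auto simp: b_def)
        also have "\<dots> \<le> E s * 2" using Enn[OF s] s r by (intro mult_left_mono) (auto simp: b_def)
        finally show ?thesis by simp
      next
        case False then show ?thesis using Enn[OF s] by (simp add: b_def)
      qed
    qed (auto intro!: continuous_intros cb cE)
    also have "\<dots> = 2 * zonal_int k E" by (rule zonal_int_cmult)
    also have "zonal_int k E = zonal_int k (\<lambda>s. (?p s)\<^sup>2 + (1 / \<nu>) * ((1 - s\<^sup>2) * (?p' s)\<^sup>2))"
      by (simp add: E_def[abs_def])
    also have "\<dots> = ultra_norm k n + (1 / \<nu>) * (\<nu> * ultra_norm k n)"
    proof -
      have "zonal_int k (\<lambda>s. (1 - s\<^sup>2) * (?p' s)\<^sup>2) = \<nu> * ultra_norm k n"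
        by (simp only: ultra_derivative_norm[OF k1] \<nu>_def)
      then have "zonal_int k (\<lambda>s. (1 / \<nu>) * ((1 - s\<^sup>2) * (?p' s)\<^sup>2)) = (1 / \<nu>) * (\<nu> * ultra_norm k n)"
        by (simp only: zonal_int_cmult)
      moreover have "continuous_on {-1..1} (\<lambda>s. (?p s)\<^sup>2)"
        and "continuous_on {-1..1} (\<lambda>s. (1 / \<nu>) * ((1 - s\<^sup>2) * (?p' s)\<^sup>2))"
        by (intro continuous_intros)+
      ultimately show ?thesis by (simp only: zonal_int_add ultra_norm_def)
    qed
    also have "\<dots> = 2 * ultra_norm k n" using \<nu> by simp
    finally show ?thesis using Zb by (simp add: field_simps)
  qed
  have "(\<lambda>n. (poly (ultra k n) t)\<^sup>2) \<longlonglongrightarrow> 0"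
  proof (rule Lim_null_comparison)
    show "\<forall>\<^sub>F n in sequentially. norm ((poly (ultra k n) t)\<^sup>2) \<le> 4 * ultra_norm k n / zonal_int k b"
      by (rule eventually_mono[OF eventually_gt_at_top[of 0]]) (use bound in auto)
    show "(\<lambda>n. 4 * ultra_norm k n / zonal_int k b) \<longlonglongrightarrow> 0"
      using tendsto_divide[OF tendsto_mult[OF tendsto_const[of 4] ultra_norm_tendsto_0[OF k]] tendsto_const[of "zonal_int k b"]] Zb by simp
  qed
  then have "(\<lambda>n. sqrt ((poly (ultra k n) t)\<^sup>2)) \<longlonglongrightarrow> sqrt 0" by (rule tendsto_real_sqrt)
  then show ?thesis by (simp add: tendsto_rabs_zero_iff)
qed

lemma ip_eq_1_imp_eq:
  assumes "x \<in> sph k" "y \<in> sph k" "ip k x y = 1"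
  shows "x = y"
proof
  fix i
  have "(\<Sum>i\<le>k. (x i - y i)\<^sup>2) = 2 - 2 * ip k x y"
    using assms by (auto simp: power2_diff sum.distrib sum_subtractf sph_def ip_def mult.assoc simp flip: sum_distrib_left)
  then have "\<forall>i\<in>{..k}. (x i - y i)\<^sup>2 = 0"
    using assms(3) by (subst sum_nonneg_eq_0_iff[symmetric]) auto
  then show "x i = y i" using assms(1,2) by (cases "i \<le> k") (auto simp: sph_def)
qed

text \<open>For \<open>k \<ge> 2\<close> the zonal polynomials tend to \<open>0\<close> off \<open>\<plusminus>1\<close>, so that along even (odd) degrees the
  quadratic form tends to \<open>D + E\<close> (\<open>D - E\<close>), where \<open>E\<close> collects the antipodal pairs.\<close>

theorem zonal_spd_of_coeffs:
  assumes k: "k \<ge> 2" and g: "continuous_on {-1..1} g" and nn: "\<And>n. zonal_coeff k g n \<ge> 0"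
    and ev: "\<And>N. \<exists>n\<ge>N. even n \<and> zonal_coeff k g n > 0"
    and od: "\<And>N. \<exists>n\<ge>N. odd n \<and> zonal_coeff k g n > 0"
  shows "zonal_spd k g"
  unfolding zonal_spd_def quad_form_def[symmetric]
proof (intro allI impI)
  fix A :: "(nat \<Rightarrow> real) set" and c :: "(nat \<Rightarrow> real) \<Rightarrow> real" assume A: "finite A \<and> A \<subseteq> sph k \<and> (\<exists>x\<in>A. c x \<noteq> 0)"
  have k1: "k \<ge> 1" using k by simp
  let ?Q = "\<lambda>n. quad_form k A c (poly (ultra k n))"
  have Qnn: "?Q n \<ge> 0" for n using A by (intro quad_form_ultra_nonneg k1) auto
  have S: "(\<lambda>n. zonal_coeff k g n / ultra_norm k n * ?Q n) sums quad_form k A c g"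
    using A by (intro quad_form_sums k1 g nn) auto
  have tnn: "zonal_coeff k g n / ultra_norm k n * ?Q n \<ge> 0" for n
    by (intro mult_nonneg_nonneg divide_nonneg_pos ultra_norm_pos k1 Qnn nn)
  show "0 < quad_form k A c g"
  proof (rule ccontr)
    assume "\<not> 0 < quad_form k A c g"
    moreover have "0 \<le> quad_form k A c g" by (rule sums_le[OF _ sums_zero S]) (rule tnn)
    ultimately have "(\<Sum>n. zonal_coeff k g n / ultra_norm k n * ?Q n) = 0" using S by (simp add: sums_iff)
    then have "zonal_coeff k g n / ultra_norm k n * ?Q n = 0" for n
      using suminf_eq_zero_iff[OF sums_summable[OF S] tnn] by blast
    \<comment> \<open>A series of nonnegative terms with sum 0 vanishes termwise, so the form of
      every degree with a positive coefficient is 0.\<close>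
    then have Q0: "?Q n = 0" if "zonal_coeff k g n > 0" for n
      using that ultra_norm_pos[OF k1, of n] by (metis divide_pos_pos less_irrefl mult_eq_0_iff)
    define D where "D = (\<Sum>x\<in>A. (c x)\<^sup>2)"
    define E where "E = (\<Sum>x\<in>A. \<Sum>y\<in>A. c x * c y * (if ip k x y = -1 then 1 else 0))"
    have "(\<lambda>n. poly (ultra k n) (ip k x y) - (if x = y then 1 else 0) - (-1) ^ n * (if ip k x y = -1 then 1 else 0)) \<longlonglongrightarrow> 0"
      if xy: "x \<in> A" "y \<in> A" for x y
    proof -
      have s: "x \<in> sph k" "y \<in> sph k" using xy A by auto
      consider "x = y" | "x \<noteq> y" "ip k x y = -1" | "x \<noteq> y" "ip k x y \<noteq> -1" by blast
      then show ?thesis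
      proof cases
        case 1 then show ?thesis using s by (simp add: sph_ip)
      next
        case 2 then show ?thesis using ultra_parity[of k _ 1] by simp
      next
        case 3
        then have "ip k x y \<noteq> 1" using ip_eq_1_imp_eq[OF s] by blast
        then have "(\<lambda>n. poly (ultra k n) (ip k x y)) \<longlonglongrightarrow> 0"
          using ip_bounds[OF s] 3 by (intro ultra_tendsto_0 k) auto
        then show ?thesis using 3 by simp
      qed
    qed
    then have "(\<lambda>n. \<Sum>x\<in>A. \<Sum>y\<in>A. c x * c y * (poly (ultra k n) (ip k x y) - (if x = y then 1 else 0) - (-1) ^ n * (if ip k x y = -1 then 1 else 0))) \<longlonglongrightarrow> (\<Sum>x\<in>A. \<Sum>y\<in>A. c x * c y * 0)"
      by (intro tendsto_sum tendsto_mult tendsto_const)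
    moreover have "(\<Sum>x\<in>A. \<Sum>y\<in>A. c x * c y * (poly (ultra k n) (ip k x y) - (if x = y then 1 else 0) - (-1) ^ n * (if ip k x y = -1 then 1 else 0))) = ?Q n - D - (-1) ^ n * E" for n
    proof -
      have "(\<Sum>x\<in>A. \<Sum>y\<in>A. c x * c y * (if x = y then 1 else 0)) = D"
      proof -
        have "(\<Sum>y\<in>A. c x * c y * (if x = y then 1 else 0)) = (c x)\<^sup>2" if "x \<in> A" for x
        proof -
          have "(\<Sum>y\<in>A. c x * c y * (if x = y then 1 else 0)) = (\<Sum>y\<in>A. if x = y then c x * c y else 0)"
            by (intro sum.cong) auto
          then show ?thesis using A that by (simp add: sum.delta' power2_eq_square)
        qed
        then show ?thesis by (simp add: D_def)
      qed
      moreover have "(\<Sum>x\<in>A. \<Sum>y\<in>A. c x * c y * ((-1) ^ n * (if ip k x y = -1 then 1 else 0))) = (-1) ^ n * E"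
        unfolding E_def sum_distrib_left by (intro sum.cong refl) simp
      ultimately show ?thesis
        unfolding right_diff_distrib sum_subtractf by (simp only: quad_form_def)
    qed
    ultimately have lim: "(\<lambda>n. ?Q n - D - (-1) ^ n * E) \<longlonglongrightarrow> 0" by simp
    have close: "\<exists>N. \<forall>n\<ge>N. \<bar>?Q n - D - (-1) ^ n * E\<bar> < e" if "e > 0" for e
      using LIMSEQ_D[OF lim that] by simp
    have "D + E = 0"
    proof (rule eq_if_all_close[where C = 1])
      fix e :: real assume "e > 0"
      from close[OF this] obtain N where N: "\<forall>n\<ge>N. \<bar>?Q n - D - (-1) ^ n * E\<bar> < e" by blast
      obtain n where n: "n \<ge> N" "even n" "zonal_coeff k g n > 0" using ev by blast
      have "\<bar>?Q n - D - (-1) ^ n * E\<bar> < e" using N n(1) by blast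
      then show "\<bar>D + E - 0\<bar> \<le> 1 * e" unfolding Q0[OF n(3)] using n(2) by simp
    qed
    moreover have "D - E = 0"
    proof (rule eq_if_all_close[where C = 1])
      fix e :: real assume "e > 0"
      from close[OF this] obtain N where N: "\<forall>n\<ge>N. \<bar>?Q n - D - (-1) ^ n * E\<bar> < e" by blast
      obtain n where n: "n \<ge> N" "odd n" "zonal_coeff k g n > 0" using od by blast
      have "\<bar>?Q n - D - (-1) ^ n * E\<bar> < e" using N n(1) by blast
      then show "\<bar>D - E - 0\<bar> \<le> 1 * e" unfolding Q0[OF n(3)] using n(2) by simp
    qed
    ultimately have "D = 0" by simp
    then show False using A unfolding D_def by (subst (asm) sum_nonneg_eq_0_iff) auto
  qed
qed

section \<open>Alternating sums over regular polygons and the necessary condition\<close>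

text \<open>The sign is absorbed into the phase increment x = pi (1 - q/M). This gives a geometric
  sum over a 2M-th root of unity, which is not 1 because |q| < M.\<close>

lemma alternating_cos_sum:
  fixes M :: nat and q :: int
  assumes "\<bar>q\<bar> < int M"
  shows "(\<Sum>j<2 * M. (-1) ^ j * cos (\<gamma> - q * (pi * j / M))) = 0"
proof -
  have M: "M > 0" using assms by auto
  define x where "x = pi * (1 - q / M)"
  have qM: "\<bar>real_of_int q\<bar> < real M" using assms by linarith
  then have "0 < 1 - q / M" "1 - q / M < 2" using M by (auto simp: field_simps abs_less_iff)
  then have x: "0 < x" "x < 2 * pi" by (simp_all add: x_def)
  have "cis x \<noteq> 1"
  proof
    assume "cis x = 1"
    then have "cos x = 1" by (metis cis.simps(1) one_complex.simps(1))
    then obtain n :: int where n: "x = n * 2 * pi" by (auto simp: cos_one_2pi_int)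
    from x n have "0 < real_of_int n" "real_of_int n < 1" by (auto simp: zero_less_mult_iff)
    then show False by simp
  qed
  moreover have "cis x ^ (2 * M) = 1"
  proof -
    have "real (2 * M) * x = 2 * pi * (real_of_int (int M - q))" using M by (simp add: x_def field_simps)
    then have "cis x ^ (2 * M) = cis (2 * pi * (real_of_int (int M - q)))" using Complex.DeMoivre[of x "2 * M"] by (simp only:)
    also have "\<dots> = 1" by (rule cis_multiple_2pi) auto
    finally show ?thesis .
  qed
  ultimately have "(\<Sum>j<2 * M. cis x ^ j) = 0" by (simp add: geometric_sum)
  then have "Re (cis \<gamma> * (\<Sum>j<2 * M. cis x ^ j)) = 0" by simp
  moreover have "Re (cis \<gamma> * cis x ^ j) = (-1) ^ j * cos (\<gamma> - q * (pi * j / M))" for j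
  proof -
    have "\<gamma> + real j * x = (\<gamma> - q * (pi * j / M)) + real j * pi" using M by (simp add: x_def field_simps)
    then have "Re (cis \<gamma> * cis x ^ j) = cos ((\<gamma> - q * (pi * j / M)) + real j * pi)"
      by (simp only: Complex.DeMoivre cis_mult cis.sel)
    then show ?thesis by (simp add: cos_add sin_npi cos_npi mult.commute)
  qed
  ultimately show ?thesis by (simp add: sum_distrib_left)
qed

text \<open>The product formula trades one power of the cosine for a frequency change by 1 up or
  down, so |q| + p is the quantity to be kept below M.\<close>

lemma alternating_cos_power_sum:
  fixes M p :: nat and q :: int
  assumes "\<bar>q\<bar> + int p < int M"
  shows "(\<Sum>j<2 * M. (-1) ^ j * (cos (\<alpha> - pi * j / M) ^ p * cos (q * (\<alpha> - pi * j / M)))) = 0"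
  using assms
proof (induction p arbitrary: q)
  case 0
  then show ?case using alternating_cos_sum[of q M "q * \<alpha>"] by (simp add: right_diff_distrib)
next
  case (Suc p)
  have e: "cos \<phi> ^ Suc p * cos (q * \<phi>) = (1 / 2) * (cos \<phi> ^ p * cos ((q + 1 :: int) * \<phi>)) + (1 / 2) * (cos \<phi> ^ p * cos ((q - 1 :: int) * \<phi>))" for \<phi> :: real
    by (simp add: cos_add cos_diff algebra_simps)
  have "(\<Sum>j<2 * M. (-1) ^ j * (cos (\<alpha> - pi * j / M) ^ Suc p * cos (q * (\<alpha> - pi * j / M)))) =
    (1 / 2) * (\<Sum>j<2 * M. (-1) ^ j * (cos (\<alpha> - pi * j / M) ^ p * cos ((q + 1 :: int) * (\<alpha> - pi * j / M)))) +
    (1 / 2) * (\<Sum>j<2 * M. (-1) ^ j * (cos (\<alpha> - pi * j / M) ^ p * cos ((q - 1 :: int) * (\<alpha> - pi * j / M))))"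
    unfolding e sum_distrib_left sum.distrib[symmetric] by (intro sum.cong refl) (simp only: distrib_left mult_ac)
  also have "\<dots> = 0" using Suc.IH[of "q + 1"] Suc.IH[of "q - 1"] Suc.prems by (simp del: of_int_add of_int_diff)
  finally show ?case .
qed

lemma alternating_ultra_sum:
  fixes M n :: nat
  assumes "k \<ge> 1" "M > 0" and n: "n < M \<or> even n \<noteq> even M"
  shows "(\<Sum>j<2 * M. (-1) ^ j * poly (ultra k n) (cos (\<alpha> - pi * j / M))) = 0"
  using n
proof
  assume n: "n < M"
  have d: "degree (ultra k n) < M" using ultra_degree[OF assms(1), of n] n by auto
  have "(\<Sum>j<2 * M. (-1) ^ j * poly (ultra k n) (cos (\<alpha> - pi * j / M))) =
    (\<Sum>p\<le>degree (ultra k n). coeff (ultra k n) p * (\<Sum>j<2 * M. (-1) ^ j * cos (\<alpha> - pi * j / M) ^ p))"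
    unfolding poly_altdef sum_distrib_left by (subst sum.swap) (simp add: mult_ac)
  also have "\<dots> = 0"
    using alternating_cos_power_sum[of 0 _ M \<alpha>] d by (intro sum.neutral) auto
  finally show ?thesis .
next
  \<comment> \<open>Advancing by \<open>M\<close> vertices leads to the antipode and yields the sign
    (-1)^(M + n) = -1, so the second half of the sum cancels the first.\<close>
  assume n: "even n \<noteq> even M"
  define h where "h j = (-1) ^ j * poly (ultra k n) (cos (\<alpha> - pi * real j / M))" for j :: nat
  have "h (j + M) = - h j" for j
  proof -
    have "\<alpha> - pi * real (j + M) / M = (\<alpha> - pi * real j / M) - pi" using assms(2) by (simp add: field_simps)
    then have "cos (\<alpha> - pi * real (j + M) / M) = - cos (\<alpha> - pi * real j / M)"
      by (simp only: cos_minus_pi)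
    then have "h (j + M) = (-1) ^ (j + M) * ((-1) ^ n * poly (ultra k n) (cos (\<alpha> - pi * real j / M)))"
      unfolding h_def ultra_parity[symmetric] by simp
    also have "\<dots> = ((-1) ^ M * (-1) ^ n) * h j" by (simp add: h_def power_add)
    also have "(-1) ^ M * (-1) ^ n = (-1 :: real)" using n by (cases "even n") auto
    finally show ?thesis by simp
  qed
  moreover have "(\<Sum>j<K + M. h j) = (\<Sum>j<M. h j) + (\<Sum>j<K. h (j + M))" for K
    by (induction K) auto
  ultimately have "(\<Sum>j<M + M. h j) = 0" by (simp add: sum_negf)
  then show ?thesis by (simp add: h_def mult_2)
qed

definition circle_point :: "real \<Rightarrow> nat \<Rightarrow> real" where
  "circle_point \<theta> i = (if i = 0 then cos \<theta> else if i = 1 then sin \<theta> else 0)"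

lemma ip_circle_point:
  assumes "k \<ge> 1"
  shows "ip k (circle_point \<theta>) (circle_point \<eta>) = cos (\<theta> - \<eta>)"
proof -
  have "ip k (circle_point \<theta>) (circle_point \<eta>) = (\<Sum>i\<in>{0, 1}. circle_point \<theta> i * circle_point \<eta> i)"
    unfolding ip_def using assms by (intro sum.mono_neutral_right) (auto simp: circle_point_def)
  then show ?thesis by (simp add: circle_point_def cos_diff)
qed

lemma circle_point_sph:
  assumes "k \<ge> 1"
  shows "circle_point \<theta> \<in> sph k"
  using ip_circle_point[OF assms, of \<theta> \<theta>] assms by (auto simp: sph_def ip_def power2_eq_square circle_point_def)

lemma zonal_spd_imp_pd: "zonal_spd k g \<Longrightarrow> zonal_pd k g"
  unfolding zonal_pd_def zonal_spd_def
proof (intro allI impI)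
  fix A :: "(nat \<Rightarrow> real) set" and c :: "(nat \<Rightarrow> real) \<Rightarrow> real"
  assume *: "\<forall>A c. finite A \<and> A \<subseteq> sph k \<and> (\<exists>x\<in>A. c x \<noteq> 0) \<longrightarrow> 0 < (\<Sum>x\<in>A. \<Sum>y\<in>A. c x * c y * g (ip k x y))"
    and A: "finite A \<and> A \<subseteq> sph k"
  show "0 \<le> (\<Sum>x\<in>A. \<Sum>y\<in>A. c x * c y * g (ip k x y))"
  proof (cases "\<exists>x\<in>A. c x \<noteq> 0")
    case True with * A have "0 < (\<Sum>x\<in>A. \<Sum>y\<in>A. c x * c y * g (ip k x y))" by blast
    then show ?thesis by simp
  next
    case False then show ?thesis by simp
  qed
qed

text \<open>Alternating weights at the vertices of a regular \<open>2M\<close>-gon on a great circle annihilate all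
  zonal polynomials of degree less than \<open>M\<close> and all those whose degree has the other parity.\<close>

theorem zonal_spd_coeff_pos:
  assumes k: "k \<ge> 1" and g: "continuous_on {-1..1} g" and spd: "zonal_spd k g" and M: "M > 0"
  shows "\<exists>n\<ge>M. even n = even M \<and> zonal_coeff k g n > 0"
proof (rule ccontr)
  assume no: "\<not> ?thesis"
  have nn: "zonal_coeff k g n \<ge> 0" for n
    unfolding zonal_coeff_def by (rule zonal_coeff_nonneg[OF k g zonal_spd_imp_pd[OF spd]])
  define x where "x j = circle_point (pi * real j / real M)" for j :: nat
  have inj: "inj_on x {..<2 * M}"
  proof (rule inj_onI)
    fix i j assume ij: "i \<in> {..<2 * M}" "j \<in> {..<2 * M}" and "x i = x j"
    then have "x i 0 = x j 0" "x i 1 = x j 1" by auto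
    then have "sin (pi * real i / M) = sin (pi * real j / M) \<and> cos (pi * real i / M) = cos (pi * real j / M)"
      by (simp add: x_def circle_point_def)
    then obtain n :: int where "pi * real i / M = pi * real j / M + 2 * pi * n" unfolding sin_cos_eq_iff by blast
    then have "pi * (real i - real j - 2 * real M * n) = 0" using M by (simp add: field_simps)
    then have "real_of_int (int i - int j) = real_of_int (2 * int M * n)" by simp
    then have e: "int i - int j = 2 * int M * n" by (simp only: of_int_eq_iff)
    have "\<bar>int i - int j\<bar> < 2 * int M" using ij by auto
    then have "\<bar>2 * int M * n\<bar> < 2 * int M * 1" unfolding e by simp
    then have "\<bar>n\<bar> < 1" using M by (simp add: abs_mult)
    then show "i = j" using e by simp
  qed
  define A where "A = x ` {..<2 * M}"
  define c where "c u = (-1 :: real) ^ inv_into {..<2 * M} x u" for u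
  have A: "finite A" "A \<subseteq> sph k" by (auto simp: A_def x_def circle_point_sph[OF k])
  have Q: "quad_form k A c h = (\<Sum>i<2 * M. (-1) ^ i * (\<Sum>j<2 * M. (-1) ^ j * h (cos (pi * i / M - pi * j / M))))" for h
  proof -
    have cx: "c (x i) = (-1) ^ i" if "i < 2 * M" for i using inj that by (simp add: c_def inv_into_f_f)
    have ipx: "ip k (x i) (x j) = cos (pi * i / M - pi * j / M)" for i j
      by (simp add: x_def ip_circle_point[OF k])
    show ?thesis
      unfolding quad_form_def A_def sum_sum_reindex[OF inj] sum_distrib_left
      by (intro sum.cong refl) (simp add: cx ipx)
  qed
  have "0 < quad_form k A c g"
  proof -
    have "x 0 \<in> A" "c (x 0) \<noteq> 0" using M by (auto simp: A_def c_def)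
    then show ?thesis using spd A unfolding zonal_spd_def quad_form_def by blast
  qed
  moreover have "zonal_coeff k g n / ultra_norm k n * quad_form k A c (poly (ultra k n)) = 0" for n
  proof (cases "n < M \<or> even n \<noteq> even M")
    case True
    then show ?thesis unfolding Q alternating_ultra_sum[OF k M True] by simp
  next
    case False
    then have "zonal_coeff k g n = 0" using no nn[of n] by (metis not_less order_antisym_conv)
    then show ?thesis by simp
  qed
  then have "(\<lambda>n. 0) sums quad_form k A c g"
    using quad_form_sums[OF k g nn A(2), of c] by (simp only:)
  then have "quad_form k A c g = 0" by (simp add: sums_0 sums_unique2[OF _ sums_zero])
  ultimately show False by simp
qed

section \<open>Differentiability of absolutely continuous functions\<close>

text \<open>Finite sets of endpoint pairs, where neighbours may share an endpoint. Unlike the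
  sequences in \<open>abs_cont_on\<close>, such families can be united, filtered and mapped
  directly.\<close>

definition nonoverlapping :: "real \<Rightarrow> real \<Rightarrow> (real \<times> real) set \<Rightarrow> bool" where
  "nonoverlapping a b D \<longleftrightarrow> finite D \<and> (\<forall>I\<in>D. a \<le> fst I \<and> fst I < snd I \<and> snd I \<le> b) \<and>
     (\<forall>I\<in>D. \<forall>J\<in>D. I \<noteq> J \<longrightarrow> snd I \<le> fst J \<or> snd J \<le> fst I)"

definition increment_sum :: "(real \<Rightarrow> real) \<Rightarrow> (real \<times> real) set \<Rightarrow> real" where
  "increment_sum h D = (\<Sum>I\<in>D. \<bar>h (snd I) - h (fst I)\<bar>)"

definition total_var :: "(real \<Rightarrow> real) \<Rightarrow> real \<Rightarrow> real \<Rightarrow> real" where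
  "total_var h u v = (SUP D\<in>{D. nonoverlapping u v D}. increment_sum h D)"

definition var_bound :: "(real \<Rightarrow> real) \<Rightarrow> real \<Rightarrow> real \<Rightarrow> real \<Rightarrow> bool" where
  "var_bound h a b B \<longleftrightarrow> (\<forall>D. nonoverlapping a b D \<longrightarrow> increment_sum h D \<le> B)"

lemma nonoverlapping_mono: "nonoverlapping u v D \<Longrightarrow> a \<le> u \<Longrightarrow> v \<le> b \<Longrightarrow> nonoverlapping a b D"
  unfolding nonoverlapping_def by fastforce

lemma nonoverlapping_empty [simp]: "nonoverlapping a b {}"
  by (simp add: nonoverlapping_def)

text \<open>Induction on the number of intervals: one interval separates the others into a left and
  a right family. It is applied to the total variation and to the variation minus a signed
  increment.\<close>

lemma superadditive_sum_le:
  assumes nn: "\<And>u v. a \<le> u \<Longrightarrow> u \<le> v \<Longrightarrow> v \<le> b \<Longrightarrow> 0 \<le> \<Psi> u v"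
    and sup: "\<And>u w v. a \<le> u \<Longrightarrow> u \<le> w \<Longrightarrow> w \<le> v \<Longrightarrow> v \<le> b \<Longrightarrow> \<Psi> u w + \<Psi> w v \<le> (\<Psi> u v :: real)"
    and D: "nonoverlapping u v D" and uv: "a \<le> u" "u \<le> v" "v \<le> b"
  shows "(\<Sum>I\<in>D. \<Psi> (fst I) (snd I)) \<le> \<Psi> u v"
  using D uv
proof (induction "card D" arbitrary: D u v rule: less_induct)
  case less
  note D = less.prems(1)
  have fin: "finite D" using D by (simp add: nonoverlapping_def)
  show ?case
  proof (cases "D = {}")
    case True then show ?thesis using nn less.prems by simp
  next
    case False
    then obtain I where I: "I \<in> D" by blast
    define l r where "l = fst I" and "r = snd I"
    have lr: "u \<le> l" "l < r" "r \<le> v" using D I by (auto simp: nonoverlapping_def l_def r_def)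
    define L where "L = {J \<in> D. snd J \<le> l}"
    define R where "R = {J \<in> D. r \<le> fst J}"
    have ne: "fst J < snd J" if "J \<in> D" for J using D that by (auto simp: nonoverlapping_def)
    have part: "D = insert I (L \<union> R)" "I \<notin> L \<union> R" "L \<inter> R = {}"
      using D I lr ne unfolding nonoverlapping_def L_def R_def l_def r_def by fastforce+
    have cards: "card L < card D" "card R < card D"
      using part fin I by (auto intro!: psubset_card_mono simp: L_def R_def)
    have "nonoverlapping u l L" "nonoverlapping r v R"
      using D unfolding nonoverlapping_def L_def R_def by auto
    then have IH: "(\<Sum>I\<in>L. \<Psi> (fst I) (snd I)) \<le> \<Psi> u l" "(\<Sum>I\<in>R. \<Psi> (fst I) (snd I)) \<le> \<Psi> r v"
      using less.hyps[OF cards(1)] less.hyps[OF cards(2)] lr less.prems by auto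
    have "(\<Sum>I\<in>D. \<Psi> (fst I) (snd I)) = \<Psi> l r + ((\<Sum>I\<in>L. \<Psi> (fst I) (snd I)) + (\<Sum>I\<in>R. \<Psi> (fst I) (snd I)))"
    proof -
      have "finite L" "finite R" using fin by (auto simp: L_def R_def)
      then have "(\<Sum>I\<in>insert I (L \<union> R). \<Psi> (fst I) (snd I)) = \<Psi> l r + ((\<Sum>I\<in>L. \<Psi> (fst I) (snd I)) + (\<Sum>I\<in>R. \<Psi> (fst I) (snd I)))"
        using part(2,3) by (simp add: sum.union_disjoint l_def r_def)
      then show ?thesis by (simp only: part(1)[symmetric])
    qed
    also have "\<dots> \<le> \<Psi> l r + (\<Psi> u l + \<Psi> r v)" using IH by simp
    also have "\<dots> \<le> \<Psi> u v"
      using sup[of u l v] sup[of l r v] lr less.prems by simp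
    finally show ?thesis .
  qed
qed

lemma nonoverlapping_length:
  assumes "nonoverlapping a b D" "a \<le> b"
  shows "(\<Sum>I\<in>D. snd I - fst I) \<le> b - a"
  using superadditive_sum_le[of a b "\<lambda>u v. v - u" a b D] assms by simp

context
  fixes h a b B
  assumes vb: "var_bound h a b B"
begin

lemma total_var_upper:
  assumes "nonoverlapping u v D" "a \<le> u" "v \<le> b"
  shows "increment_sum h D \<le> total_var h u v"
  unfolding total_var_def
proof (rule cSUP_upper)
  show "bdd_above (increment_sum h ` {D. nonoverlapping u v D})"
    using vb assms(2,3) nonoverlapping_mono unfolding var_bound_def by (intro bdd_aboveI2[of _ _ B]) blast
qed (use assms in simp)

lemma total_var_least:
  assumes "\<And>D. nonoverlapping u v D \<Longrightarrow> increment_sum h D \<le> C"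
  shows "total_var h u v \<le> C"
  unfolding total_var_def
  using assms nonoverlapping_empty by (intro cSUP_least) blast+

lemma total_var_approx:
  assumes "e > 0"
  shows "\<exists>D. nonoverlapping u v D \<and> increment_sum h D > total_var h u v - e"
proof (rule ccontr)
  assume "\<not> ?thesis"
  then have "\<And>D. nonoverlapping u v D \<Longrightarrow> increment_sum h D \<le> total_var h u v - e" by (auto simp: not_less)
  then have "total_var h u v \<le> total_var h u v - e" by (rule total_var_least)
  then show False using assms by simp
qed

lemma total_var_superadd:
  assumes "a \<le> u" "u \<le> w" "w \<le> v" "v \<le> b"
  shows "total_var h u w + total_var h w v \<le> total_var h u v"
proof -
  have "total_var h u w \<le> total_var h u v - total_var h w v"
  proof (rule total_var_least)
    fix D assume D: "nonoverlapping u w D"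
    have "total_var h w v \<le> total_var h u v - increment_sum h D"
    proof (rule total_var_least)
      fix E assume E: "nonoverlapping w v E"
      have disj: "D \<inter> E = {}" using D E unfolding nonoverlapping_def by fastforce
      have "nonoverlapping u v (D \<union> E)"
        using D E assms unfolding nonoverlapping_def by (auto; force)
      then have "increment_sum h (D \<union> E) \<le> total_var h u v" using assms by (intro total_var_upper) auto
      also have "increment_sum h (D \<union> E) = increment_sum h D + increment_sum h E"
        unfolding increment_sum_def using D E disj by (intro sum.union_disjoint) (auto simp: nonoverlapping_def)
      finally show "increment_sum h E \<le> total_var h u v - increment_sum h D" by simp
    qed
    then show "increment_sum h D \<le> total_var h u v - total_var h w v" by simp
  qed
  then show ?thesis by simp
qed

lemma total_var_ge:
  assumes "a \<le> u" "u \<le> v" "v \<le> b"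
  shows "\<bar>h v - h u\<bar> \<le> total_var h u v"
proof (cases "u = v")
  case True
  then show ?thesis using total_var_upper[OF nonoverlapping_empty assms(1,3)] by (simp add: increment_sum_def)
next
  case False
  then have "nonoverlapping u v {(u, v)}" using assms by (simp add: nonoverlapping_def)
  from total_var_upper[OF this assms(1,3)] show ?thesis by (simp add: increment_sum_def)
qed

lemma total_var_nonneg: "a \<le> u \<Longrightarrow> u \<le> v \<Longrightarrow> v \<le> b \<Longrightarrow> 0 \<le> total_var h u v"
  using total_var_ge[of u v] by linarith

lemma total_var_sum_le:
  assumes "nonoverlapping u v D" "a \<le> u" "u \<le> v" "v \<le> b"
  shows "(\<Sum>I\<in>D. total_var h (fst I) (snd I)) \<le> total_var h u v"
  by (rule superadditive_sum_le[of a b, OF total_var_nonneg total_var_superadd assms])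

text \<open>The variation minus \<open>\<sigma>\<close> times the increment is nonnegative and
  superadditive, and on each interval it is at least twice the movement against
  \<open>\<sigma>\<close>. Backward movement therefore counts double.\<close>

lemma total_var_against:
  assumes D: "nonoverlapping u v D" and uv: "a \<le> u" "u \<le> v" "v \<le> b" and \<sigma>: "\<bar>\<sigma>\<bar> = (1::real)"
  shows "\<sigma> * (h v - h u) + 2 * (\<Sum>I\<in>D. \<sigma> * (h (fst I) - h (snd I))) \<le> total_var h u v"
proof -
  define \<Psi> where "\<Psi> u v = total_var h u v - \<sigma> * (h v - h u)" for u v
  have abs: "\<sigma> * x \<le> \<bar>x\<bar>" for x using \<sigma> by (metis abs_ge_self abs_mult mult_1)
  have "(\<Sum>I\<in>D. \<Psi> (fst I) (snd I)) \<le> \<Psi> u v"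
  proof (rule superadditive_sum_le[of a b, OF _ _ D uv])
    show "0 \<le> \<Psi> u v" if "a \<le> u" "u \<le> v" "v \<le> b" for u v
      using total_var_ge[OF that] abs[of "h v - h u"] by (simp add: \<Psi>_def)
    show "\<Psi> u w + \<Psi> w v \<le> \<Psi> u v" if "a \<le> u" "u \<le> w" "w \<le> v" "v \<le> b" for u w v
      using total_var_superadd[OF that] by (simp add: \<Psi>_def right_diff_distrib)
  qed
  moreover have "(\<Sum>I\<in>D. 2 * (\<sigma> * (h (fst I) - h (snd I)))) \<le> (\<Sum>I\<in>D. \<Psi> (fst I) (snd I))"
  proof (rule sum_mono)
    fix I assume "I \<in> D"
    then have "a \<le> fst I" "fst I \<le> snd I" "snd I \<le> b" using D uv by (auto simp: nonoverlapping_def)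
    from total_var_ge[OF this] abs[of "h (fst I) - h (snd I)"]
    show "2 * (\<sigma> * (h (fst I) - h (snd I))) \<le> \<Psi> (fst I) (snd I)"
      unfolding \<Psi>_def by (simp add: right_diff_distrib abs_minus_commute)
  qed
  ultimately show ?thesis unfolding \<Psi>_def sum_distrib_left[symmetric] by simp
qed

end

section \<open>Lebesgue's differentiation theorem for functions of bounded variation\<close>

text \<open>Vitali's theorem selects countably many disjoint intervals that cover \<open>S\<close>
  up to a null set; the measure of their union is controlled by its finite subfamilies, to which
  \<open>small\<close> applies.\<close>

lemma vitali_outer_measure:
  fixes K :: "(real \<times> real) set"
  assumes K: "\<And>I. I \<in> K \<Longrightarrow> fst I < snd I"
    and cover: "\<And>x d. x \<in> S \<Longrightarrow> d > 0 \<Longrightarrow> \<exists>I\<in>K. x \<in> {fst I..snd I} \<and> snd I - fst I < d"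
    and small: "\<And>C. finite C \<Longrightarrow> C \<subseteq> K \<Longrightarrow>
      (\<And>I J. I \<in> C \<Longrightarrow> J \<in> C \<Longrightarrow> I \<noteq> J \<Longrightarrow> snd I < fst J \<or> snd J < fst I) \<Longrightarrow> (\<Sum>I\<in>C. snd I - fst I) \<le> e"
  shows "\<exists>T. S \<subseteq> T \<and> T \<in> lmeasurable \<and> measure lebesgue T \<le> e"
proof -
  define m where "m I = (fst I + snd I) / 2" for I :: "real \<times> real"
  define \<rho> where "\<rho> I = (snd I - fst I) / 2" for I :: "real \<times> real"
  have cb: "cball (m I) (\<rho> I) = {fst I..snd I}" for I
    by (auto simp: m_def \<rho>_def dist_real_def abs_if field_simps split: if_splits)
  obtain C where C: "countable C" "C \<subseteq> K"
     "pairwise (\<lambda>i j. disjnt (cball (m i) (\<rho> i)) (cball (m j) (\<rho> j))) C"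
     "negligible (S - (\<Union>i \<in> C. cball (m i) (\<rho> i)))"
  proof (rule Vitali_covering_theorem_cballs[of K \<rho> S m])
    show "0 < \<rho> i" if "i \<in> K" for i using K[OF that] by (simp add: \<rho>_def)
    fix x d :: real assume "x \<in> S" "0 < d"
    from cover[OF this(1), of d] this(2) obtain I where "I \<in> K" "x \<in> {fst I..snd I}" "snd I - fst I < d" by auto
    moreover have "\<rho> I < d" using K[OF \<open>I \<in> K\<close>] \<open>snd I - fst I < d\<close> by (simp add: \<rho>_def)
    ultimately show "\<exists>i. i \<in> K \<and> x \<in> cball (m i) (\<rho> i) \<and> \<rho> i < d" unfolding cb by blast
  qed
  have fin: "measure lebesgue (\<Union>i\<in>C'. {fst i..snd i}) \<le> e" if C': "C' \<subseteq> C" "finite C'" for C'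
  proof -
    have "measure lebesgue (\<Union>i\<in>C'. {fst i..snd i}) \<le> (\<Sum>i\<in>C'. measure lebesgue {fst i..snd i})"
      by (rule measure_UNION_le) (use C' in auto)
    also have "\<dots> = (\<Sum>i\<in>C'. snd i - fst i)"
      using C' C(2) K by (intro sum.cong refl) (force simp: less_imp_le)
    also have "\<dots> \<le> e"
    proof (rule small)
      fix I J assume IJ: "I \<in> C'" "J \<in> C'" "I \<noteq> J"
      then have "disjnt {fst I..snd I} {fst J..snd J}"
        using C(3) C'(1) unfolding cb pairwise_def by blast
      moreover have "fst I < snd I" "fst J < snd J" using IJ C'(1) C(2) K by blast+
      ultimately show "snd I < fst J \<or> snd J < fst I"
        unfolding disjnt_iff by (metis atLeastAtMost_iff less_imp_le linorder_le_less_linear order_refl)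
    qed (use C' C in auto)
    finally show ?thesis .
  qed
  have U: "(\<Union>i\<in>C. {fst i..snd i}) \<in> lmeasurable" "measure lebesgue (\<Union>i\<in>C. {fst i..snd i}) \<le> e"
    by (rule fmeasurable_UN_bound[OF C(1) _ fin] measure_UN_bound[OF C(1) _ fin]; simp)+
  let ?N = "S - (\<Union>i\<in>C. {fst i..snd i})"
  have N: "negligible ?N" using C(4) by (simp add: cb)
  show ?thesis
  proof (intro exI conjI)
    show "S \<subseteq> (\<Union>i\<in>C. {fst i..snd i}) \<union> ?N" by blast
    show "(\<Union>i\<in>C. {fst i..snd i}) \<union> ?N \<in> lmeasurable"
      by (rule fmeasurable.Un[OF U(1) negligible_imp_measurable[OF N]])
    have "measure lebesgue ((\<Union>i\<in>C. {fst i..snd i}) \<union> ?N) \<le> measure lebesgue (\<Union>i\<in>C. {fst i..snd i}) + measure lebesgue ?N"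
      using U N by (intro measure_Un_le) (auto simp: fmeasurableD negligible_imp_measurable)
    then show "measure lebesgue ((\<Union>i\<in>C. {fst i..snd i}) \<union> ?N) \<le> e"
      using U(2) negligible_imp_measure0[OF N] by linarith
  qed
qed

lemma separated_nonoverlapping:
  assumes "finite C" "\<And>I. I \<in> C \<Longrightarrow> a \<le> fst I \<and> fst I < snd I \<and> snd I \<le> b"
    "\<And>I J. I \<in> C \<Longrightarrow> J \<in> C \<Longrightarrow> I \<noteq> J \<Longrightarrow> snd I < fst J \<or> snd J < fst I"
  shows "nonoverlapping a b C"
  using assms unfolding nonoverlapping_def by (meson less_imp_le)

text \<open>Disjoint intervals of slope at least N have total length at most the variation divided
  by N, and N may be chosen as large as desired.\<close>

lemma steep_negligible:
  assumes vb: "var_bound h a b B"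
    and steep: "\<And>x N d. x \<in> S \<Longrightarrow> N > 0 \<Longrightarrow> d > 0 \<Longrightarrow> \<exists>l r. a \<le> l \<and> l < r \<and> r \<le> b \<and> x \<in> {l..r} \<and> r - l < d \<and> \<bar>h r - h l\<bar> \<ge> N * (r - l)"
  shows "negligible S"
  unfolding negligible_outer_le
proof (intro allI impI)
  fix e :: real assume e: "e > 0"
  define N where "N = (\<bar>B\<bar> + 1) / e"
  have N: "N > 0" using e by (simp add: N_def)
  define K where "K = {I. a \<le> fst I \<and> fst I < snd I \<and> snd I \<le> b \<and> \<bar>h (snd I) - h (fst I)\<bar> \<ge> N * (snd I - fst I)}"
  show "\<exists>T. S \<subseteq> T \<and> T \<in> lmeasurable \<and> measure lebesgue T \<le> e"
  proof (rule vitali_outer_measure[of K])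
    show "fst I < snd I" if "I \<in> K" for I using that by (simp add: K_def)
    show "\<exists>I\<in>K. x \<in> {fst I..snd I} \<and> snd I - fst I < d" if x: "x \<in> S" "d > 0" for x d
    proof -
      from steep[OF x(1) N x(2)] obtain l r where "a \<le> l \<and> l < r \<and> r \<le> b \<and> x \<in> {l..r} \<and> r - l < d \<and> \<bar>h r - h l\<bar> \<ge> N * (r - l)"
        by blast
      then show ?thesis by (intro bexI[of _ "(l, r)"]) (auto simp: K_def)
    qed
    fix C assume C: "finite C" "C \<subseteq> K" "\<And>I J. I \<in> C \<Longrightarrow> J \<in> C \<Longrightarrow> I \<noteq> J \<Longrightarrow> snd I < fst J \<or> snd J < fst I"
    have "nonoverlapping a b C" by (rule separated_nonoverlapping) (use C in \<open>auto simp: K_def\<close>)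
    then have "increment_sum h C \<le> B" using vb by (simp add: var_bound_def)
    moreover have "(\<Sum>I\<in>C. N * (snd I - fst I)) \<le> increment_sum h C"
      unfolding increment_sum_def using C(2) by (intro sum_mono) (auto simp: K_def)
    ultimately have "N * (\<Sum>I\<in>C. snd I - fst I) \<le> \<bar>B\<bar> + 1" unfolding sum_distrib_left[symmetric] by simp
    also have "\<dots> = N * e" using e by (simp add: N_def)
    finally show "(\<Sum>I\<in>C. snd I - fst I) \<le> e" using N by simp
  qed
qed

text \<open>Austin's argument: let \<open>D\<close> almost exhaust the total variation. Inside each interval of \<open>D\<close> pick the
  Vitali intervals on which \<open>h\<close> moves against its increment over that interval. They add variation
  in proportion to their length, so their total length is small.\<close>

lemma oscillating_negligible:
  assumes vb: "var_bound h a b B" and ab: "a \<le> b" and c: "c > 0" and S: "S \<subseteq> {a..b}"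
    and osc: "\<And>x \<sigma> d. x \<in> S \<Longrightarrow> \<bar>\<sigma>\<bar> = 1 \<Longrightarrow> d > 0 \<Longrightarrow> \<exists>l r. a \<le> l \<and> l < r \<and> r \<le> b \<and> x \<in> {l..r} \<and> r - l < d \<and> \<sigma> * (h r - h l) \<ge> c * (r - l)"
  shows "negligible S"
  unfolding negligible_outer_le
proof (intro allI impI)
  fix e :: real assume e: "e > 0"
  \<comment> \<open>The slack \<open>c * e\<close> is calibrated to the end of the argument: each
    unit of length of selected intervals adds at least \<open>c\<close> to the variation, so their
    length cannot exceed \<open>e\<close>.\<close>
  obtain D where D: "nonoverlapping a b D" "increment_sum h D > total_var h a b - c * e"
    using total_var_approx[OF vb, of "c * e"] c e by auto
  have finD: "finite D" using D by (simp add: nonoverlapping_def)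
  \<comment> \<open>Once the finitely many endpoints are removed, every point is interior to an
    interval of \<open>D\<close> or at positive distance from all of them, so small intervals around
    it are either inside or outside.\<close>
  define P where "P = fst ` D \<union> snd ` D"
  have finP: "finite P" using finD by (simp add: P_def)
  define sg where "sg J = (if h (snd J) \<ge> h (fst J) then 1 else -1 :: real)" for J :: "real \<times> real"
  have sg: "\<bar>sg J\<bar> = 1" "\<bar>- sg J\<bar> = 1" "sg J * (h (snd J) - h (fst J)) = \<bar>h (snd J) - h (fst J)\<bar>" for J
    by (auto simp: sg_def)
  define inside where "inside I J \<longleftrightarrow> fst J \<le> fst I \<and> snd I \<le> snd J \<and> - sg J * (h (snd I) - h (fst I)) \<ge> c * (snd I - fst I)" for I J
  define outside where "outside I \<longleftrightarrow> (\<forall>J\<in>D. snd I \<le> fst J \<or> snd J \<le> fst I) \<and> \<bar>h (snd I) - h (fst I)\<bar> \<ge> c * (snd I - fst I)" for I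
  define K where "K = {I. a \<le> fst I \<and> fst I < snd I \<and> snd I \<le> b \<and> ((\<exists>J\<in>D. inside I J) \<or> outside I)}"
  have "\<exists>T. S - P \<subseteq> T \<and> T \<in> lmeasurable \<and> measure lebesgue T \<le> e"
  proof (rule vitali_outer_measure[of K])
    show "fst I < snd I" if "I \<in> K" for I using that by (simp add: K_def)
    show "\<exists>I\<in>K. x \<in> {fst I..snd I} \<and> snd I - fst I < d" if x: "x \<in> S - P" "d > 0" for x d
    proof (cases "\<exists>J\<in>D. fst J < x \<and> x < snd J")
      case True
      then obtain J where J: "J \<in> D" "fst J < x" "x < snd J" by blast
      define d' where "d' = min d (min (x - fst J) (snd J - x))"
      have d': "d' > 0" using x J by (simp add: d'_def)
      from osc[OF _ sg(2) d', of x J] x obtain l r where lr: "a \<le> l" "l < r" "r \<le> b" "x \<in> {l..r}" "r - l < d'"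
        "- sg J * (h r - h l) \<ge> c * (r - l)" by blast
      then have "inside (l, r) J" by (auto simp: inside_def d'_def)
      then show ?thesis using lr J by (intro bexI[of _ "(l, r)"]) (auto simp: K_def d'_def)
    next
      case False
      have out: "x < fst J \<or> snd J < x" if "J \<in> D" for J
        using False x(1) that by (force simp: P_def)
      have "\<exists>d'>0. \<forall>J\<in>D. x < fst J - d' \<or> snd J + d' < x"
        using finD out
      proof (induction D rule: finite_induct)
        case empty show ?case by (auto intro: exI[of _ 1])
      next
        case (insert J F)
        then obtain d1 where d1: "d1 > 0" "\<forall>J\<in>F. x < fst J - d1 \<or> snd J + d1 < x" by auto
        define d2 where "d2 = (if x < fst J then (fst J - x) / 2 else (x - snd J) / 2)"
        have d2: "d2 > 0" "x < fst J - d2 \<or> snd J + d2 < x"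
          using insert.prems[of J] by (auto simp: d2_def field_simps)
        show ?case by (rule exI[of _ "min d1 d2"]) (use d1 d2 in fastforce)
      qed
      then obtain d1 where d1: "d1 > 0" "\<forall>J\<in>D. x < fst J - d1 \<or> snd J + d1 < x" by blast
      from osc[of x 1 "min d d1"] x d1 obtain l r where lr: "a \<le> l" "l < r" "r \<le> b" "x \<in> {l..r}" "r - l < min d d1"
        "1 * (h r - h l) \<ge> c * (r - l)" by auto
      then have "outside (l, r)" using d1(2) by (fastforce simp: outside_def)
      then show ?thesis using lr by (intro bexI[of _ "(l, r)"]) (auto simp: K_def)
    qed
    fix C assume C: "finite C" "C \<subseteq> K" "\<And>I J. I \<in> C \<Longrightarrow> J \<in> C \<Longrightarrow> I \<noteq> J \<Longrightarrow> snd I < fst J \<or> snd J < fst I"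
    let ?len = "\<lambda>I. snd I - fst I"
    define Out where "Out = {I \<in> C. outside I}"
    have CI: "a \<le> fst I" "fst I < snd I" "snd I \<le> b" if "I \<in> C" for I using that C(2) by (auto simp: K_def)
    have nC: "nonoverlapping a b C" by (rule separated_nonoverlapping) (use C CI in auto)
    have disj: "D \<inter> Out = {}"
    proof -
      have "fst I < snd I" if "I \<in> D" for I using that D(1) by (auto simp: nonoverlapping_def)
      then show ?thesis unfolding Out_def outside_def by force
    qed
    have nDO: "nonoverlapping a b (D \<union> Out)"
      unfolding nonoverlapping_def
    proof (intro conjI ballI impI)
      show "finite (D \<union> Out)" using finD C(1) by (simp add: Out_def)
      show "a \<le> fst I" "fst I < snd I" "snd I \<le> b" if "I \<in> D \<union> Out" for I
        using that D(1) CI[of I] unfolding nonoverlapping_def Out_def by blast+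
      show "snd I \<le> fst J \<or> snd J \<le> fst I" if "I \<in> D \<union> Out" "J \<in> D \<union> Out" "I \<noteq> J" for I J
        using that D(1) nC unfolding nonoverlapping_def Out_def outside_def by blast
    qed
    have J1: "\<bar>h (snd J) - h (fst J)\<bar> + c * (\<Sum>I\<in>C. if inside I J then ?len I else 0) \<le> total_var h (fst J) (snd J)"
      if J: "J \<in> D" for J
    proof -
      let ?CJ = "{I \<in> C. inside I J}"
      have bJ: "a \<le> fst J" "fst J < snd J" "snd J \<le> b" using D(1) J by (auto simp: nonoverlapping_def)
      have "nonoverlapping (fst J) (snd J) ?CJ"
        using nC unfolding nonoverlapping_def inside_def by auto
      from total_var_against[OF vb this _ _ _ sg(1)[of J]] bJ
      have "\<bar>h (snd J) - h (fst J)\<bar> + 2 * (\<Sum>I\<in>?CJ. sg J * (h (fst I) - h (snd I))) \<le> total_var h (fst J) (snd J)"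
        by (simp add: sg)
      moreover have "(\<Sum>I\<in>?CJ. c * ?len I) \<le> (\<Sum>I\<in>?CJ. sg J * (h (fst I) - h (snd I)))"
        by (intro sum_mono) (auto simp: inside_def algebra_simps)
      moreover have "0 \<le> (\<Sum>I\<in>?CJ. c * ?len I)"
        using c CI by (intro sum_nonneg mult_nonneg_nonneg) (auto simp: less_imp_le)
      moreover have "c * (\<Sum>I\<in>C. if inside I J then ?len I else 0) = (\<Sum>I\<in>?CJ. c * ?len I)"
        unfolding sum_distrib_left[symmetric] using C(1) by (simp add: sum.inter_filter)
      ultimately show ?thesis by linarith
    qed
    have O1: "c * ?len I \<le> total_var h (fst I) (snd I)" if "I \<in> Out" for I
    proof -
      have I: "a \<le> fst I" "fst I \<le> snd I" "snd I \<le> b" using CI[of I] that by (auto simp: Out_def)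
      have "c * ?len I \<le> \<bar>h (snd I) - h (fst I)\<bar>" using that by (simp add: Out_def outside_def)
      also note total_var_ge[OF vb I]
      finally show ?thesis .
    qed
    have len: "(\<Sum>I\<in>C. ?len I) \<le> (\<Sum>I\<in>Out. ?len I) + (\<Sum>J\<in>D. \<Sum>I\<in>C. if inside I J then ?len I else 0)"
    proof -
      have "(\<Sum>I\<in>C. ?len I) \<le> (\<Sum>I\<in>C. (if outside I then ?len I else 0) + (\<Sum>J\<in>D. if inside I J then ?len I else 0))"
      proof (rule sum_mono)
        fix I assume I: "I \<in> C"
        have nn: "0 \<le> (\<Sum>J\<in>D. if inside I J then ?len I else 0)" using CI[OF I] by (intro sum_nonneg) auto
        show "?len I \<le> (if outside I then ?len I else 0) + (\<Sum>J\<in>D. if inside I J then ?len I else 0)"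
        proof (cases "outside I")
          case True then show ?thesis using nn by simp
        next
          case False
          then obtain J where J: "J \<in> D" "inside I J" using I C(2) by (auto simp: K_def)
          have "(if inside I J then ?len I else 0) \<le> (\<Sum>J\<in>D. if inside I J then ?len I else 0)"
            by (rule member_le_sum[OF J(1) _ finD]) (use CI[OF I] in auto)
          then show ?thesis using J False by simp
        qed
      qed
      also have "\<dots> = (\<Sum>I\<in>Out. ?len I) + (\<Sum>J\<in>D. \<Sum>I\<in>C. if inside I J then ?len I else 0)"
        unfolding sum.distrib Out_def using C(1) by (subst sum.swap[of _ D C]) (simp add: sum.inter_filter)
      finally show ?thesis .
    qed
    have "increment_sum h D + c * (\<Sum>I\<in>C. ?len I) \<le>
      increment_sum h D + c * ((\<Sum>I\<in>Out. ?len I) + (\<Sum>J\<in>D. \<Sum>I\<in>C. if inside I J then ?len I else 0))"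
      using len c by simp
    also have "\<dots> = (\<Sum>J\<in>D. \<bar>h (snd J) - h (fst J)\<bar> + c * (\<Sum>I\<in>C. if inside I J then ?len I else 0)) + (\<Sum>I\<in>Out. c * ?len I)"
      by (simp add: increment_sum_def sum.distrib sum_distrib_left distrib_left)
    also have "\<dots> \<le> (\<Sum>J\<in>D. total_var h (fst J) (snd J)) + (\<Sum>I\<in>Out. total_var h (fst I) (snd I))"
      using J1 O1 by (intro add_mono sum_mono) auto
    also have "\<dots> = (\<Sum>I\<in>D \<union> Out. total_var h (fst I) (snd I))"
      using finD C(1) disj by (subst sum.union_disjoint) (auto simp: Out_def)
    also have "\<dots> \<le> total_var h a b" by (rule total_var_sum_le[OF vb nDO order_refl ab order_refl])
    also have "\<dots> < increment_sum h D + c * e" using D(2) by simp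
    finally show "(\<Sum>I\<in>C. ?len I) \<le> e" using c by simp
  qed
  then obtain T where T: "S - P \<subseteq> T" "T \<in> lmeasurable" "measure lebesgue T \<le> e" by blast
  have P: "negligible P" using finP by (rule negligible_finite)
  show "\<exists>T. S \<subseteq> T \<and> T \<in> lmeasurable \<and> measure lebesgue T \<le> e"
  proof (intro exI conjI)
    show "S \<subseteq> T \<union> P" using T by blast
    show "T \<union> P \<in> lmeasurable" by (rule fmeasurable.Un[OF T(2) negligible_imp_measurable[OF P]])
    have "measure lebesgue (T \<union> P) \<le> measure lebesgue T + measure lebesgue P"
      using T P by (intro measure_Un_le) (auto simp: fmeasurableD negligible_imp_measurable)
    then show "measure lebesgue (T \<union> P) \<le> e" using T(3) negligible_imp_measure0[OF P] by linarith
  qed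
qed

text \<open>Subtracting a line of slope midway between P and Q turns slopes below P and above Q into
  slopes of both signs and of size at least (Q - P)/2, the situation of
  \<open>oscillating_negligible\<close>.\<close>

lemma var_bound_tilt:
  assumes vb: "var_bound h a b B" and ab: "a \<le> b"
  shows "var_bound (\<lambda>y. h y - s * y) a b (B + \<bar>s\<bar> * (b - a))"
  unfolding var_bound_def
proof (intro allI impI)
  fix D assume D: "nonoverlapping a b D"
  have "increment_sum (\<lambda>y. h y - s * y) D \<le> (\<Sum>I\<in>D. \<bar>h (snd I) - h (fst I)\<bar> + \<bar>s\<bar> * (snd I - fst I))"
    unfolding increment_sum_def
  proof (rule sum_mono)
    fix I assume "I \<in> D"
    then have l: "fst I < snd I" using D by (auto simp: nonoverlapping_def)
    have "\<bar>(h (snd I) - s * snd I) - (h (fst I) - s * fst I)\<bar> = \<bar>(h (snd I) - h (fst I)) - s * (snd I - fst I)\<bar>"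
      by (simp add: algebra_simps)
    also have "\<dots> \<le> \<bar>h (snd I) - h (fst I)\<bar> + \<bar>s * (snd I - fst I)\<bar>" by (rule abs_triangle_ineq4)
    also have "\<bar>s * (snd I - fst I)\<bar> = \<bar>s\<bar> * (snd I - fst I)" using l by (simp add: abs_mult)
    finally show "\<bar>(h (snd I) - s * snd I) - (h (fst I) - s * fst I)\<bar> \<le> \<bar>h (snd I) - h (fst I)\<bar> + \<bar>s\<bar> * (snd I - fst I)" .
  qed
  also have "\<dots> = increment_sum h D + \<bar>s\<bar> * (\<Sum>I\<in>D. snd I - fst I)"
    by (simp add: increment_sum_def sum.distrib sum_distrib_left)
  also have "\<dots> \<le> B + \<bar>s\<bar> * (b - a)"
    using vb D nonoverlapping_length[OF D ab] by (intro add_mono mult_left_mono) (auto simp: var_bound_def)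
  finally show "increment_sum (\<lambda>y. h y - s * y) D \<le> B + \<bar>s\<bar> * (b - a)" .
qed

definition slope :: "(real \<Rightarrow> real) \<Rightarrow> real \<Rightarrow> real \<Rightarrow> real" where
  "slope h x y = (h y - h x) / (y - x)"

lemma frequently_slope_interval:
  assumes fr: "\<exists>\<^sub>F y in at x. P (slope h x y)" and x: "x \<in> {a<..<b}" and d: "d > 0"
  shows "\<exists>l r. a \<le> l \<and> l < r \<and> r \<le> b \<and> x \<in> {l..r} \<and> r - l < d \<and> P ((h r - h l) / (r - l))"
proof -
  define d' where "d' = min d (min (x - a) (b - x))"
  have d': "d' > 0" using x d by (simp add: d'_def)
  have "\<exists>y. y \<noteq> x \<and> dist y x < d' \<and> P (slope h x y)"
    using fr d' unfolding frequently_def eventually_at by blast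
  then obtain y where y: "y \<noteq> x" "\<bar>y - x\<bar> < d'" "P (slope h x y)" by (auto simp: dist_real_def)
  show ?thesis
  proof (cases "x < y")
    case True
    then show ?thesis using y x
      by (intro exI[of _ x] exI[of _ y]) (auto simp: slope_def d'_def)
  next
    case False
    have "slope h x y = (h x - h y) / (x - y)" unfolding slope_def by (metis minus_diff_eq minus_divide_divide)
    then show ?thesis using False y x
      by (intro exI[of _ y] exI[of _ x]) (auto simp: d'_def)
  qed
qed

text \<open>The supremum of the eventual lower bounds of the difference quotient is the only
  candidate for the limit; if the quotient exceeded it persistently, a pair of rationals in between
  would be crossed again and again.\<close>

lemma differentiable_from_slopes:
  fixes h :: "real \<Rightarrow> real"
  assumes bdd: "\<not> (\<forall>N::nat. \<exists>\<^sub>F y in at x. \<bar>slope h x y\<bar> > real N)"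
    and osc: "\<And>p q :: rat. p < q \<Longrightarrow> \<not> ((\<exists>\<^sub>F y in at x. slope h x y < real_of_rat p) \<and> (\<exists>\<^sub>F y in at x. slope h x y > real_of_rat q))"
  shows "h field_differentiable at x"
proof -
  obtain N :: nat where N: "\<forall>\<^sub>F y in at x. \<bar>slope h x y\<bar> \<le> real N"
    using bdd by (auto simp: not_frequently not_less)
  define A where "A = {p. \<forall>\<^sub>F y in at x. slope h x y \<ge> p}"
  have "- real N \<in> A" unfolding A_def using N by (auto elim: eventually_mono)
  then have ne: "A \<noteq> {}" by blast
  have up: "p \<le> real N" if "p \<in> A" for p
  proof -
    have "\<forall>\<^sub>F y in at x. p \<le> slope h x y" using that by (simp add: A_def)
    with N have "\<forall>\<^sub>F y in at x. p \<le> real N" by eventually_elim linarith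
    then show ?thesis by (simp add: trivial_limit_at)
  qed
  then have ba: "bdd_above A" by (intro bdd_aboveI) auto
  define s where "s = Sup A"
  have "(slope h x \<longlongrightarrow> s) (at x)"
  proof (rule order_tendstoI)
    fix a assume "a < s"
    then obtain p where "p \<in> A" "a < p" unfolding s_def using less_cSup_iff[OF ne ba] by blast
    then show "\<forall>\<^sub>F y in at x. a < slope h x y" unfolding A_def by (auto elim: eventually_mono)
  next
    fix a assume "s < a"
    then obtain q where q: "s < real_of_rat q" "real_of_rat q < a" using of_rat_dense by blast
    then obtain p where p: "s < real_of_rat p" "real_of_rat p < real_of_rat q" using of_rat_dense by blast
    have "\<not> (\<forall>\<^sub>F y in at x. slope h x y \<ge> real_of_rat p)"
    proof
      assume "\<forall>\<^sub>F y in at x. slope h x y \<ge> real_of_rat p"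
      then have "real_of_rat p \<in> A" by (simp add: A_def)
      then have "real_of_rat p \<le> s" unfolding s_def by (rule cSup_upper[OF _ ba])
      then show False using p by simp
    qed
    then have "\<exists>\<^sub>F y in at x. slope h x y < real_of_rat p" by (simp add: frequently_def not_less)
    then have "\<forall>\<^sub>F y in at x. slope h x y \<le> real_of_rat q"
      using osc[of p q] p(2) by (auto simp: of_rat_less not_frequently not_less)
    then show "\<forall>\<^sub>F y in at x. slope h x y < a" by (rule eventually_mono) (use q in auto)
  qed
  then show ?thesis unfolding slope_def field_differentiable_def has_field_derivative_iff by blast
qed

text \<open>A point of non-differentiability has unbounded difference quotients or quotients
  oscillating across some rational pair; this makes countably many null sets.\<close>

lemma bounded_variation_differentiable:
  assumes vb: "var_bound h a b B" and ab: "a \<le> b"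
  shows "negligible {x \<in> {a<..<b}. \<not> h field_differentiable at x}"
proof -
  define E0 where "E0 = {x \<in> {a<..<b}. \<forall>N::nat. \<exists>\<^sub>F y in at x. \<bar>slope h x y\<bar> > real N}"
  define E1 where "E1 p q = {x \<in> {a<..<b}. (\<exists>\<^sub>F y in at x. slope h x y < real_of_rat p) \<and> (\<exists>\<^sub>F y in at x. slope h x y > real_of_rat q)}" for p q
  have "negligible E0"
  proof (rule steep_negligible[OF vb])
    fix x N d :: real assume x: "x \<in> E0" "N > 0" "d > 0"
    obtain n :: nat where n: "N \<le> real n" using real_arch_simple by blast
    have "\<exists>\<^sub>F y in at x. \<bar>slope h x y\<bar> > real n" "x \<in> {a<..<b}" using x(1) by (auto simp: E0_def)
    from frequently_slope_interval[OF this x(3)] obtain l r where lr: "a \<le> l" "l < r" "r \<le> b" "x \<in> {l..r}" "r - l < d" "\<bar>(h r - h l) / (r - l)\<bar> > real n"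
      by blast
    then have "N * (r - l) \<le> \<bar>h r - h l\<bar>"
      using n mult_right_mono[of N "\<bar>h r - h l\<bar> / (r - l)" "r - l"] by (auto simp: abs_divide)
    then show "\<exists>l r. a \<le> l \<and> l < r \<and> r \<le> b \<and> x \<in> {l..r} \<and> r - l < d \<and> N * (r - l) \<le> \<bar>h r - h l\<bar>"
      using lr by blast
  qed
  moreover have "negligible (E1 p q)" if pq: "p < q" for p q
  proof -
    define P Q where "P = real_of_rat p" and "Q = real_of_rat q"
    have PQ: "P < Q" using pq by (simp add: P_def Q_def of_rat_less)
    define s c where "s = (P + Q) / 2" and "c = (Q - P) / 2"
    show ?thesis
    proof (rule oscillating_negligible[OF var_bound_tilt[OF vb ab, of s] ab, of c])
      show "c > 0" using PQ by (simp add: c_def)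
      show "E1 p q \<subseteq> {a..b}" by (auto simp: E1_def)
      fix x \<sigma> d :: real assume x: "x \<in> E1 p q" and \<sigma>: "\<bar>\<sigma>\<bar> = 1" and d: "d > 0"
      have x': "x \<in> {a<..<b}" "\<exists>\<^sub>F y in at x. slope h x y < P" "\<exists>\<^sub>F y in at x. slope h x y > Q"
        using x by (auto simp: E1_def P_def Q_def)
      have conv: "\<sigma> * ((h r - s * r) - (h l - s * l)) = \<sigma> * ((h r - h l) / (r - l) - s) * (r - l)" if "l < r" for l r
        using that by (simp add: field_simps)
      have "\<exists>l r. a \<le> l \<and> l < r \<and> r \<le> b \<and> x \<in> {l..r} \<and> r - l < d \<and> \<sigma> * ((h r - h l) / (r - l) - s) \<ge> c"
      proof (cases "\<sigma> = 1")
        case True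
        from frequently_slope_interval[OF x'(3,1) d] obtain l r where
          "a \<le> l \<and> l < r \<and> r \<le> b \<and> x \<in> {l..r} \<and> r - l < d \<and> (h r - h l) / (r - l) > Q" by blast
        then show ?thesis using True by (intro exI[of _ l] exI[of _ r]) (auto simp: s_def c_def field_simps)
      next
        case False
        then have sm: "\<sigma> = -1" using \<sigma> by linarith
        from frequently_slope_interval[OF x'(2,1) d] obtain l r where
          "a \<le> l \<and> l < r \<and> r \<le> b \<and> x \<in> {l..r} \<and> r - l < d \<and> (h r - h l) / (r - l) < P" by blast
        moreover have "\<sigma> * (z - s) \<ge> c" if "z < P" for z
          using that by (simp add: sm s_def c_def field_simps)
        ultimately show ?thesis by blast
      qed
      then obtain l r where lr: "a \<le> l" "l < r" "r \<le> b" "x \<in> {l..r}" "r - l < d" "\<sigma> * ((h r - h l) / (r - l) - s) \<ge> c" by blast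
      then have "\<sigma> * ((h r - s * r) - (h l - s * l)) \<ge> c * (r - l)" unfolding conv[OF lr(2)] by (intro mult_right_mono) auto
      then show "\<exists>l r. a \<le> l \<and> l < r \<and> r \<le> b \<and> x \<in> {l..r} \<and> r - l < d \<and> c * (r - l) \<le> \<sigma> * ((h r - s * r) - (h l - s * l))"
        using lr by blast
    qed
  qed
  then have "negligible (\<Union>z\<in>{z. fst z < snd z}. E1 (fst z) (snd z))"
    by (intro negligible_countable_Union) auto
  ultimately have "negligible (E0 \<union> (\<Union>z\<in>{z. fst z < snd z}. E1 (fst z) (snd z)))" by (rule negligible_Un)
  moreover have "{x \<in> {a<..<b}. \<not> h field_differentiable at x} \<subseteq> E0 \<union> (\<Union>z\<in>{z. fst z < snd z}. E1 (fst z) (snd z))"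
  proof
    fix x assume x: "x \<in> {x \<in> {a<..<b}. \<not> h field_differentiable at x}"
    show "x \<in> E0 \<union> (\<Union>z\<in>{z. fst z < snd z}. E1 (fst z) (snd z))"
    proof (rule ccontr)
      assume n: "x \<notin> E0 \<union> (\<Union>z\<in>{z. fst z < snd z}. E1 (fst z) (snd z))"
      have "x \<notin> E0" using n by blast
      then have 1: "\<not> (\<forall>N::nat. \<exists>\<^sub>F y in at x. \<bar>slope h x y\<bar> > real N)" using x by (simp add: E0_def)
      have "x \<notin> E1 p q" if "p < q" for p q using n that by force
      then have 2: "\<not> ((\<exists>\<^sub>F y in at x. slope h x y < real_of_rat p) \<and> (\<exists>\<^sub>F y in at x. slope h x y > real_of_rat q))" if "p < q" for p q
        using x that by (auto simp: E1_def)
      show False using differentiable_from_slopes[OF 1 2] x by blast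
    qed
  qed
  ultimately show ?thesis by (rule negligible_subset)
qed

section \<open>Absolutely continuous functions: derivative almost everywhere and constancy\<close>

lemma abs_cont_on_iff:
  "abs_cont_on {a..b} h \<longleftrightarrow>
    (\<forall>e>0. \<exists>d>0. \<forall>D. nonoverlapping a b D \<longrightarrow> (\<Sum>I\<in>D. snd I - fst I) < d \<longrightarrow> increment_sum h D < e)"
    (is "?L \<longleftrightarrow> ?R")
proof
  assume ?L
  show ?R
  proof (intro allI impI)
    fix e :: real assume "e > 0"
    from \<open>?L\<close>[unfolded abs_cont_on_def, THEN spec, of e, THEN mp, OF this]
    obtain d where d: "d > 0" and dd: "\<forall>n (u :: nat \<Rightarrow> real) v.
        (\<forall>i<n. u i < v i \<and> u i \<in> {a..b} \<and> v i \<in> {a..b} \<and> {u i..v i} \<subseteq> {a..b}) \<and>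
        (\<forall>i<n. \<forall>j<n. i \<noteq> j \<longrightarrow> v i \<le> u j \<or> v j \<le> u i) \<and>
        (\<Sum>i<n. v i - u i) < d \<longrightarrow> (\<Sum>i<n. \<bar>h (v i) - h (u i)\<bar>) < e"
      by (elim exE conjE)
    show "\<exists>d>0. \<forall>D. nonoverlapping a b D \<longrightarrow> (\<Sum>I\<in>D. snd I - fst I) < d \<longrightarrow> increment_sum h D < e"
    proof (intro exI[of _ d] conjI allI impI d)
      fix D assume D: "nonoverlapping a b D" and len: "(\<Sum>I\<in>D. snd I - fst I) < d"
      then have fin: "finite D" by (simp add: nonoverlapping_def)
      obtain g where g: "bij_betw g {0..<card D} D" using ex_bij_betw_nat_finite[OF fin] by blast
      then have gD: "g i \<in> D" if "i < card D" for i using that by (auto simp: bij_betw_def)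
      have ginj: "g i \<noteq> g j" if "i < card D" "j < card D" "i \<noteq> j" for i j
        using g that by (auto simp: bij_betw_def inj_on_def)
      have re: "(\<Sum>I\<in>D. F I) = (\<Sum>i<card D. F (g i))" for F :: "real \<times> real \<Rightarrow> real"
        using sum.reindex_bij_betw[OF g, of F] by (simp add: atLeast0LessThan)
      have "(\<Sum>i<card D. \<bar>h (snd (g i)) - h (fst (g i))\<bar>) < e"
      proof (rule mp[OF spec[OF spec[OF spec[OF dd]]]], intro conjI allI impI)
        fix i assume i: "i < card D"
        have "a \<le> fst (g i)" "fst (g i) < snd (g i)" "snd (g i) \<le> b"
          using D gD[OF i] by (auto simp: nonoverlapping_def)
        then show "fst (g i) < snd (g i)" "fst (g i) \<in> {a..b}" "snd (g i) \<in> {a..b}" "{fst (g i)..snd (g i)} \<subseteq> {a..b}"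
          by auto
        show "snd (g i) \<le> fst (g j) \<or> snd (g j) \<le> fst (g i)" if "j < card D" "i \<noteq> j" for j
          using D gD[OF i] gD[OF that(1)] ginj[OF i that] unfolding nonoverlapping_def by blast
      qed (use len re[of "\<lambda>I. snd I - fst I"] in simp)
      then show "increment_sum h D < e" unfolding increment_sum_def re .
    qed
  qed
next
  assume R: ?R
  show ?L unfolding abs_cont_on_def
  proof (intro allI impI)
    fix e :: real assume "e > 0"
    with R obtain d where d: "d > 0"
      and dd: "\<And>D. nonoverlapping a b D \<Longrightarrow> (\<Sum>I\<in>D. snd I - fst I) < d \<Longrightarrow> increment_sum h D < e" by blast
    show "\<exists>d>0. \<forall>(n::nat) (u :: nat \<Rightarrow> real) v.
        (\<forall>i<n. u i < v i \<and> u i \<in> {a..b} \<and> v i \<in> {a..b} \<and> {u i..v i} \<subseteq> {a..b}) \<and>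
        (\<forall>i<n. \<forall>j<n. i \<noteq> j \<longrightarrow> v i \<le> u j \<or> v j \<le> u i) \<and>
        (\<Sum>i<n. v i - u i) < d \<longrightarrow> (\<Sum>i<n. \<bar>h (v i) - h (u i)\<bar>) < e"
    proof (intro exI[of _ d] conjI allI impI d)
      fix n :: nat and u v :: "nat \<Rightarrow> real"
      assume *: "(\<forall>i<n. u i < v i \<and> u i \<in> {a..b} \<and> v i \<in> {a..b} \<and> {u i..v i} \<subseteq> {a..b}) \<and>
        (\<forall>i<n. \<forall>j<n. i \<noteq> j \<longrightarrow> v i \<le> u j \<or> v j \<le> u i) \<and> (\<Sum>i<n. v i - u i) < d"
      define p where "p i = (u i, v i)" for i
      have inj: "inj_on p {..<n}"
      proof (rule inj_onI, rule ccontr)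
        fix i j assume ij: "i \<in> {..<n}" "j \<in> {..<n}" "p i = p j" "i \<noteq> j"
        then have "v i \<le> u j \<or> v j \<le> u i" "u i < v i" using * by auto
        then show False using ij(3) by (auto simp: p_def)
      qed
      have re: "(\<Sum>I\<in>p ` {..<n}. F I) = (\<Sum>i<n. F (p i))" for F :: "real \<times> real \<Rightarrow> real"
        using inj by (simp add: sum.reindex)
      have "increment_sum h (p ` {..<n}) < e"
      proof (rule dd)
        show "nonoverlapping a b (p ` {..<n})"
          unfolding nonoverlapping_def
        proof (intro conjI ballI impI)
          fix I J assume "I \<in> p ` {..<n}" "J \<in> p ` {..<n}" "I \<noteq> J"
          then obtain i j where "i < n" "j < n" "i \<noteq> j" "I = p i" "J = p j" by blast
          then show "snd I \<le> fst J \<or> snd J \<le> fst I" using * by (simp add: p_def)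
        qed (use * in \<open>auto simp: p_def\<close>)
        show "(\<Sum>I\<in>p ` {..<n}. snd I - fst I) < d" using * unfolding re by (simp add: p_def)
      qed
      then show "(\<Sum>i<n. \<bar>h (v i) - h (u i)\<bar>) < e" unfolding increment_sum_def re by (simp add: p_def)
    qed
  qed
qed

text \<open>Serves two purposes: dilations with factor in (0, 1] for the Abel means and the
  reflection with factor -1. A negative factor exchanges the endpoints, hence the case distinction
  in the proof.\<close>

lemma nonoverlapping_affine:
  assumes D: "nonoverlapping a b D" and c: "c \<noteq> 0"
    and im: "\<And>x. a \<le> x \<Longrightarrow> x \<le> b \<Longrightarrow> a' \<le> \<alpha> + c * x \<and> \<alpha> + c * x \<le> b'"
  obtains D' where "nonoverlapping a' b' D'"
    "(\<Sum>I\<in>D'. snd I - fst I) = \<bar>c\<bar> * (\<Sum>I\<in>D. snd I - fst I)"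
    "\<And>h. increment_sum h D' = increment_sum (\<lambda>x. h (\<alpha> + c * x)) D"
proof -
  define p where "p I = (if c > 0 then (\<alpha> + c * fst I, \<alpha> + c * snd I) else (\<alpha> + c * snd I, \<alpha> + c * fst I))" for I
  have inj: "inj p" using c by (auto simp: inj_def p_def prod_eq_iff split: if_splits)
  have re: "(\<Sum>I\<in>p ` D. F I) = (\<Sum>I\<in>D. F (p I))" for F :: "real \<times> real \<Rightarrow> real"
    using inj by (subst sum.reindex) (auto intro: inj_on_subset)
  show ?thesis
  proof (rule that[of "p ` D"])
    show "nonoverlapping a' b' (p ` D)"
      unfolding nonoverlapping_def
    proof (intro conjI ballI impI)
      fix I J assume "I \<in> p ` D" "J \<in> p ` D" "I \<noteq> J"
      then obtain K L where "K \<in> D" "L \<in> D" "K \<noteq> L" and eq: "I = p K" "J = p L" by blast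
      then have "snd K \<le> fst L \<or> snd L \<le> fst K" using D unfolding nonoverlapping_def by blast
      then show "snd I \<le> fst J \<or> snd J \<le> fst I" using c by (auto simp: eq p_def mult_le_cancel_left)
    next
      fix I assume "I \<in> p ` D"
      then obtain K where K: "K \<in> D" and I: "I = p K" by blast
      have "a \<le> fst K" "fst K < snd K" "snd K \<le> b" using D K by (auto simp: nonoverlapping_def)
      then show "a' \<le> fst I" "snd I \<le> b'" "fst I < snd I"
        using im[of "fst K"] im[of "snd K"] c by (auto simp: I p_def mult_less_cancel_left)
    qed (use D in \<open>simp add: nonoverlapping_def\<close>)
    show "(\<Sum>I\<in>p ` D. snd I - fst I) = \<bar>c\<bar> * (\<Sum>I\<in>D. snd I - fst I)"
      unfolding re sum_distrib_left by (intro sum.cong refl) (auto simp: p_def right_diff_distrib)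
    show "increment_sum h (p ` D) = increment_sum (\<lambda>x. h (\<alpha> + c * x)) D" for h
      unfolding increment_sum_def re by (intro sum.cong refl) (auto simp: p_def abs_minus_commute)
  qed
qed

text \<open>On intervals shorter than the delta that belongs to epsilon = 1 the variation is at most
  1, and countably many such intervals with rational endpoints cover the open interval.\<close>

theorem abs_cont_differentiable:
  assumes "abs_cont_on {a..b} h"
  shows "negligible {x \<in> {a<..<b}. \<not> h field_differentiable at x}"
proof -
  obtain d where d: "d > 0" "\<And>D. nonoverlapping a b D \<Longrightarrow> (\<Sum>I\<in>D. snd I - fst I) < d \<Longrightarrow> increment_sum h D < 1"
    using assms[unfolded abs_cont_on_iff, THEN spec, of 1] by auto
  define R where "R = {z :: rat \<times> rat. fst z < snd z \<and> a \<le> real_of_rat (fst z) \<and> real_of_rat (snd z) \<le> b \<and> real_of_rat (snd z) - real_of_rat (fst z) < d}"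
  have "negligible {x \<in> {real_of_rat (fst z)<..<real_of_rat (snd z)}. \<not> h field_differentiable at x}" if z: "z \<in> R" for z
  proof (rule bounded_variation_differentiable[where B = 1])
    let ?u = "real_of_rat (fst z)" and ?v = "real_of_rat (snd z)"
    show uv: "?u \<le> ?v" using z by (simp add: R_def of_rat_less_eq)
    show "var_bound h ?u ?v 1"
      unfolding var_bound_def
    proof (intro allI impI)
      fix D assume D: "nonoverlapping ?u ?v D"
      have "(\<Sum>I\<in>D. snd I - fst I) < d" using nonoverlapping_length[OF D uv] z by (simp add: R_def)
      moreover have "nonoverlapping a b D" by (rule nonoverlapping_mono[OF D]) (use z in \<open>auto simp: R_def\<close>)
      ultimately show "increment_sum h D \<le> 1" using d(2) by (simp add: less_imp_le)
    qed
  qed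
  then have "negligible (\<Union>z\<in>R. {x \<in> {real_of_rat (fst z)<..<real_of_rat (snd z)}. \<not> h field_differentiable at x})"
    by (intro negligible_countable_Union) auto
  moreover have "{x \<in> {a<..<b}. \<not> h field_differentiable at x} \<subseteq>
     (\<Union>z\<in>R. {x \<in> {real_of_rat (fst z)<..<real_of_rat (snd z)}. \<not> h field_differentiable at x})"
  proof
    fix x assume x: "x \<in> {x \<in> {a<..<b}. \<not> h field_differentiable at x}"
    then have "max a (x - d / 2) < x" "x < min b (x + d / 2)" using d(1) by auto
    then obtain p q where p: "max a (x - d / 2) < real_of_rat p" "real_of_rat p < x" and q: "x < real_of_rat q" "real_of_rat q < min b (x + d / 2)"
      using of_rat_dense by metis
    have "real_of_rat p < real_of_rat q" using p q by linarith
    then have "(p, q) \<in> R" using p q by (auto simp: R_def of_rat_less)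
    then show "x \<in> (\<Union>z\<in>R. {x \<in> {real_of_rat (fst z)<..<real_of_rat (snd z)}. \<not> h field_differentiable at x})"
      using x p q by (intro UN_I[of "(p, q)"]) auto
  qed
  ultimately show ?thesis by (rule negligible_subset)
qed

lemma nonoverlapping_length_measure:
  assumes D: "nonoverlapping a b D" and U: "U \<in> lmeasurable" and sub: "\<And>I. I \<in> D \<Longrightarrow> {fst I..snd I} \<subseteq> U"
  shows "(\<Sum>I\<in>D. snd I - fst I) \<le> measure lebesgue U"
proof -
  have fin: "finite D" using D by (simp add: nonoverlapping_def)
  have "(\<Sum>I\<in>D. snd I - fst I) = (\<Sum>I\<in>D. measure lebesgue {fst I<..<snd I})"
    using D by (intro sum.cong refl) (auto simp: nonoverlapping_def less_imp_le)
  also have "\<dots> = measure lebesgue (\<Union>I\<in>D. {fst I<..<snd I})"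
  proof (rule measure_finite_Union[symmetric, OF fin])
    show "disjoint_family_on (\<lambda>I. {fst I<..<snd I}) D"
      unfolding disjoint_family_on_def
    proof (intro ballI impI)
      fix I J assume "I \<in> D" "J \<in> D" "I \<noteq> J"
      then have "snd I \<le> fst J \<or> snd J \<le> fst I" using D unfolding nonoverlapping_def by blast
      then show "{fst I<..<snd I} \<inter> {fst J<..<snd J} = {}" by auto
    qed
    show "emeasure lebesgue {fst I<..<snd I} \<noteq> \<infinity>" if "I \<in> D" for I
      using D that by (auto simp: nonoverlapping_def less_imp_le)
  qed auto
  also have "\<dots> \<le> measure lebesgue U"
  proof (rule measure_mono_fmeasurable[OF _ _ U])
    show "(\<Union>I\<in>D. {fst I<..<snd I}) \<subseteq> U" using sub by fastforce
    show "(\<Union>I\<in>D. {fst I<..<snd I}) \<in> sets lebesgue" using fin by (intro sets.finite_UN) auto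
  qed
  finally show ?thesis .
qed

text \<open>A gauge argument. Pieces tagged in the exceptional set lie in an open set of small
  measure, where absolute continuity bounds their increments; elsewhere the zero derivative bounds
  the increment by \<open>e\<close> times the length. The first estimate is what excludes functions
  of Cantor type.\<close>

theorem abs_cont_zero_derivative:
  assumes ac: "abs_cont_on {a..b} h" and ab: "a \<le> b" and N: "negligible N"
    and der: "\<And>x. x \<in> {a<..<b} - N \<Longrightarrow> (h has_real_derivative 0) (at x)"
  shows "h b = h a"
proof -
  have "\<bar>h b - h a\<bar> \<le> (b - a + 1) * e" if e: "e > 0" for e
  proof -
    \<comment> \<open>The endpoints join the exceptional set because the derivative is known in the
      open interval only.\<close>
    define N' where "N' = N \<union> {a, b}"
    have N': "negligible N'" using N by (simp add: N'_def negligible_Un)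
    obtain d where d: "d > 0" "\<And>D. nonoverlapping a b D \<Longrightarrow> (\<Sum>I\<in>D. snd I - fst I) < d \<Longrightarrow> increment_sum h D < e"
      using ac e unfolding abs_cont_on_iff by blast
    obtain U where U: "open U" "N' \<subseteq> U" "U \<in> lmeasurable" "measure lebesgue U < d"
    proof -
      obtain T where T: "open T" "N' \<subseteq> T" "T - N' \<in> lmeasurable" "emeasure lebesgue (T - N') < ennreal d"
        using sets_lebesgue_outer_open[OF negligible_imp_sets[OF N'] d(1)] by blast
      have "measure lebesgue (T - N') < d" using T(3,4) d(1) by (simp add: emeasure_eq_measure2 ennreal_less_iff)
      moreover have TN: "T = (T - N') \<union> N'" using T(2) by blast
      moreover have "(T - N') \<union> N' \<in> lmeasurable" by (rule fmeasurable.Un[OF T(3) negligible_imp_measurable[OF N']])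
      moreover have "measure lebesgue ((T - N') \<union> N') \<le> measure lebesgue (T - N') + measure lebesgue N'"
        using T N' by (intro measure_Un_le) (auto simp: fmeasurableD negligible_imp_sets)
      ultimately have "T \<in> lmeasurable" "measure lebesgue T < d" using negligible_imp_measure0[OF N'] by auto
      then show ?thesis using that[of T] T by blast
    qed
    have "\<exists>r>0. \<forall>y. \<bar>y - x\<bar> < r \<longrightarrow> \<bar>h y - h x\<bar> \<le> e * \<bar>y - x\<bar>" if x: "x \<in> {a..b} - N'" for x
    proof -
      have "(h has_real_derivative 0) (at x)" using x by (intro der) (auto simp: N'_def)
      moreover have "(*) (0 :: real) = (\<lambda>_. 0)" by (rule ext) simp
      ultimately have "(h has_derivative (\<lambda>_. 0)) (at x)" by (simp only: has_field_derivative_def)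
      then show ?thesis using e unfolding has_derivative_at_alt by (auto simp: mult.commute)
    qed
    then obtain r where r: "\<And>x. x \<in> {a..b} - N' \<Longrightarrow> r x > 0"
      "\<And>x y. x \<in> {a..b} - N' \<Longrightarrow> \<bar>y - x\<bar> < r x \<Longrightarrow> \<bar>h y - h x\<bar> \<le> e * \<bar>y - x\<bar>" by metis
    define \<gamma> where "\<gamma> x = (if x \<in> N' then U else if x \<in> {a..b} then ball x (r x) else UNIV)" for x
    have "gauge \<gamma>" unfolding gauge_def \<gamma>_def using U r(1) by auto
    then obtain p where p: "p tagged_division_of {a..b}" "\<gamma> fine p" using fine_division_exists_real by blast
    note td = tagged_division_ofD[OF p(1)]
    have fin: "finite p" by (rule td(1))
    have el: "\<exists>u v. K = {u..v} \<and> u \<le> x \<and> x \<le> v \<and> a \<le> u \<and> v \<le> b \<and> Inf K = u \<and> Sup K = v" if xKp: "(x, K) \<in> p" for x K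
    proof -
      obtain u v where uv: "K = cbox u v" using td(4)[OF xKp] by blast
      have "u \<le> x" "x \<le> v" using td(2)[OF xKp] by (auto simp: uv)
      moreover have "{u..v} \<subseteq> {a..b}" using td(3)[OF xKp] by (simp add: uv)
      ultimately show ?thesis using uv by (intro exI[of _ u] exI[of _ v]) auto
    qed
    define F where "F z = h (Sup (snd z)) - h (Inf (snd z))" for z :: "real \<times> real set"
    \<comment> \<open>Degenerate pieces are left out, so that the endpoint pairs form a
      nonoverlapping family; their increment is 0 and fits the estimate \<open>G\<close> of the
      remaining pieces.\<close>
    define bad where "bad = {z \<in> p. fst z \<in> N' \<and> Inf (snd z) < Sup (snd z)}"
    define i where "i z = (Inf (snd z), Sup (snd z))" for z :: "real \<times> real set"
    have sep: "Sup (snd z) \<le> Inf (snd w) \<or> Sup (snd w) \<le> Inf (snd z)"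
      if z: "z \<in> bad" and w: "w \<in> bad" and "z \<noteq> w" for z w
    proof -
      obtain x K y L where zw: "z = (x, K)" "w = (y, L)" by (metis surj_pair)
      have p': "(x, K) \<in> p" "(y, L) \<in> p" using z w zw by (auto simp: bad_def)
      obtain u v s t where K: "K = {u..v}" "Inf K = u" "Sup K = v" and L: "L = {s..t}" "Inf L = s" "Sup L = t"
        using el[OF p'(1)] el[OF p'(2)] by blast
      have "u < v" "s < t" using z w zw K L by (auto simp: bad_def)
      have "interior K \<inter> interior L = {}" using td(5)[OF p'] that(3) zw by blast
      then have "{u<..<v} \<inter> {s<..<t} = {}" using K L by simp
      then have "v \<le> s \<or> t \<le> u"
      proof (rule contrapos_pp)
        assume "\<not> (v \<le> s \<or> t \<le> u)"
        then have "max u s < min v t" using \<open>u < v\<close> \<open>s < t\<close> by auto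
        then obtain m where "max u s < m" "m < min v t" using dense by blast
        then have "m \<in> {u<..<v} \<inter> {s<..<t}" by auto
        then show "{u<..<v} \<inter> {s<..<t} \<noteq> {}" by blast
      qed
      then show ?thesis using zw K L by simp
    qed
    have inj: "inj_on i bad"
    proof (rule inj_onI, rule ccontr)
      fix z w assume zw: "z \<in> bad" "w \<in> bad" "i z = i w" "z \<noteq> w"
      have "Inf (snd z) < Sup (snd z)" using zw(1) by (simp add: bad_def)
      then show False using sep[OF zw(1,2,4)] zw(3) by (simp add: i_def)
    qed
    have no: "nonoverlapping a b (i ` bad)"
      unfolding nonoverlapping_def
    proof (intro conjI ballI impI)
      show "finite (i ` bad)" using fin by (simp add: bad_def)
      fix I assume "I \<in> i ` bad"
      then obtain z where z: "z \<in> bad" "I = i z" by blast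
      then obtain x K where xK: "z = (x, K)" "(x, K) \<in> p" "Inf K < Sup K" by (cases z) (auto simp: bad_def)
      from el[OF xK(2)] xK z show "a \<le> fst I" "fst I < snd I" "snd I \<le> b" by (auto simp: i_def)
      fix J assume "J \<in> i ` bad" "I \<noteq> J"
      then obtain w where w: "w \<in> bad" "J = i w" by blast
      with \<open>I \<noteq> J\<close> z have "z \<noteq> w" by blast
      from sep[OF z(1) w(1) this] show "snd I \<le> fst J \<or> snd J \<le> fst I" by (simp add: z w i_def)
    qed
    have "(\<Sum>I\<in>i ` bad. snd I - fst I) \<le> measure lebesgue U"
    proof (rule nonoverlapping_length_measure[OF no U(3)])
      fix I assume "I \<in> i ` bad"
      then obtain z where z: "z \<in> bad" "I = i z" by blast
      then obtain x K where xK: "z = (x, K)" "(x, K) \<in> p" "x \<in> N'" by (cases z) (auto simp: bad_def)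
      have "K \<subseteq> \<gamma> x" using p(2) xK(2) unfolding fine_def by blast
      then have "K \<subseteq> U" using xK(3) by (simp add: \<gamma>_def)
      moreover have "{fst I..snd I} = K" using el[OF xK(2)] z xK by (auto simp: i_def)
      ultimately show "{fst I..snd I} \<subseteq> U" by simp
    qed
    then have "increment_sum h (i ` bad) < e" using U(4) by (intro d(2) no) auto
    then have B: "(\<Sum>z\<in>bad. \<bar>F z\<bar>) < e"
      unfolding increment_sum_def sum.reindex[OF inj] by (simp add: i_def F_def)
    have G: "\<bar>F z\<bar> \<le> e * (Sup (snd z) - Inf (snd z))" if z: "z \<in> p - bad" for z
    proof -
      obtain x K where xK: "z = (x, K)" "(x, K) \<in> p" using z by (cases z) auto
      obtain u v where uv: "K = {u..v}" "u \<le> x" "x \<le> v" "a \<le> u" "v \<le> b" "Inf K = u" "Sup K = v" using el[OF xK(2)] by blast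
      show ?thesis
      proof (cases "u = v")
        case True then show ?thesis by (simp add: F_def xK uv(6,7))
      next
        case False
        then have "x \<notin> N'" using z xK uv by (auto simp: bad_def)
        then have x: "x \<in> {a..b} - N'" using uv by auto
        have Kb: "K \<subseteq> ball x (r x)" using p(2) xK(2) x unfolding fine_def \<gamma>_def by fastforce
        moreover have "u \<in> K" "v \<in> K" using uv by auto
        ultimately have "u \<in> ball x (r x)" "v \<in> ball x (r x)" by blast+
        then have "\<bar>u - x\<bar> < r x" "\<bar>v - x\<bar> < r x" by (simp_all add: dist_real_def abs_minus_commute)
        then have "\<bar>h u - h x\<bar> \<le> e * \<bar>u - x\<bar>" "\<bar>h v - h x\<bar> \<le> e * \<bar>v - x\<bar>" using r(2)[OF x] by blast+
        then have "\<bar>h v - h u\<bar> \<le> e * (x - u) + e * (v - x)" using uv by (simp add: abs_if split: if_splits)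
        then show ?thesis by (simp add: F_def xK uv(6,7) algebra_simps)
      qed
    qed
    have "h b - h a = (\<Sum>z\<in>p. F z)"
      using additive_tagged_division_1[OF ab p(1), of h] by (simp add: F_def split_beta)
    also have "(\<Sum>z\<in>p. F z) = (\<Sum>z\<in>bad. F z) + (\<Sum>z\<in>p - bad. F z)"
      using fin by (subst sum.subset_diff[of bad p]) (auto simp: bad_def)
    finally have "\<bar>h b - h a\<bar> \<le> \<bar>\<Sum>z\<in>bad. F z\<bar> + \<bar>\<Sum>z\<in>p - bad. F z\<bar>" by simp
    also have "\<dots> \<le> (\<Sum>z\<in>bad. \<bar>F z\<bar>) + (\<Sum>z\<in>p - bad. \<bar>F z\<bar>)" by (intro add_mono sum_abs)
    also have "\<dots> \<le> e + (\<Sum>z\<in>p - bad. e * (Sup (snd z) - Inf (snd z)))"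
      using B G by (intro add_mono sum_mono) auto
    also have "(\<Sum>z\<in>p - bad. e * (Sup (snd z) - Inf (snd z))) \<le> (\<Sum>z\<in>p. e * (Sup (snd z) - Inf (snd z)))"
    proof (rule sum_mono2[OF fin])
      fix z assume "z \<in> p - (p - bad)"
      then show "0 \<le> e * (Sup (snd z) - Inf (snd z))" using e by (auto simp: bad_def)
    qed auto
    also have "\<dots> = e * (b - a)"
      using additive_tagged_division_1[OF ab p(1), of "\<lambda>x. x"] by (simp add: split_beta flip: sum_distrib_left)
    finally show ?thesis by (simp add: algebra_simps)
  qed
  note * = this
  show ?thesis
  proof (rule ccontr)
    assume "h b \<noteq> h a"
    then have p: "\<bar>h b - h a\<bar> > 0" by simp
    define c where "c = b - a + 1"
    have c: "c > 0" using ab by (simp add: c_def)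
    have "\<bar>h b - h a\<bar> \<le> c * (\<bar>h b - h a\<bar> / (2 * c))" unfolding c_def using p c by (intro *) (auto simp: c_def)
    also have "\<dots> = \<bar>h b - h a\<bar> / 2" using c by simp
    finally show False using p by simp
  qed
qed

section \<open>Abel means\<close>

text \<open>The unnormalised Beta density with parameters lam + 1/2 and 1/2;
  \<open>abel_mass\<close> is its total mass.\<close>

definition abel_kernel :: "real \<Rightarrow> real \<Rightarrow> real" where
  "abel_kernel lam u = u powr (lam - 1 / 2) * (1 - u) powr (- 1 / 2)"

definition abel_mean :: "real \<Rightarrow> (real \<Rightarrow> real) \<Rightarrow> real \<Rightarrow> real" where
  "abel_mean lam f x = integral {0..1} (\<lambda>u. abel_kernel lam u * f (-1 + (1 + x) * u))"

abbreviation abel_mass :: "real \<Rightarrow> real" where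
  "abel_mass lam \<equiv> Beta (lam + 1 / 2) (1 / 2)"

lemma abel_kernel_has_integral:
  assumes "lam > - 1 / 2"
  shows "(abel_kernel lam has_integral abel_mass lam) {0..1}"
  using has_integral_Beta_real[of "lam + 1 / 2" "1 / 2"] assms
  by (simp add: abel_kernel_def[abs_def])

lemma abel_kernel_nonneg: "abel_kernel lam u \<ge> 0"
  by (simp add: abel_kernel_def)

lemma abel_mass_nonneg: "lam > - 1 / 2 \<Longrightarrow> abel_mass lam \<ge> 0"
  using has_integral_nonneg[OF abel_kernel_has_integral] abel_kernel_nonneg by blast

lemma abel_kernel_integrable:
  assumes lam: "lam > - 1 / 2" and g: "continuous_on {0..1} g"
  shows "(\<lambda>u. abel_kernel lam u * g u) integrable_on {0..1}"
proof -
  have "abel_kernel lam absolutely_integrable_on {0..1}"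
    using abel_kernel_has_integral[OF lam] abel_kernel_nonneg
    by (intro nonnegative_absolutely_integrable_1) auto
  then have "(\<lambda>u. g u * abel_kernel lam u) absolutely_integrable_on {0..1}"
  proof (rule absolutely_integrable_bounded_measurable_product_real[rotated 3])
    show "g \<in> borel_measurable (lebesgue_on {0..1})" by (intro continuous_imp_measurable_on_sets_lebesgue g) auto
    show "bounded (g ` {0..1})" by (intro compact_imp_bounded compact_continuous_image g) auto
  qed simp
  then show ?thesis by (auto simp: mult.commute dest: set_lebesgue_integral_eq_integral(1))
qed

lemma abel_mean_le:
  assumes lam: "lam > - 1 / 2" and g: "continuous_on {0..1} g" and B: "\<And>u. u \<in> {0..1} \<Longrightarrow> \<bar>g u\<bar> \<le> B"
  shows "\<bar>integral {0..1} (\<lambda>u. abel_kernel lam u * g u)\<bar> \<le> abel_mass lam * B"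
proof -
  have "norm (integral {0..1} (\<lambda>u. abel_kernel lam u * g u)) \<le> integral {0..1} (\<lambda>u. abel_kernel lam u * B)"
  proof (rule integral_norm_bound_integral)
    show "norm (abel_kernel lam u * g u) \<le> abel_kernel lam u * B" if "u \<in> {0..1}" for u
      using B[OF that] abel_kernel_nonneg[of lam u] by (simp add: abs_mult mult_left_mono)
  qed (auto intro!: abel_kernel_integrable lam g continuous_intros)
  also have "\<dots> = abel_mass lam * B"
    using abel_kernel_has_integral[OF lam] by (intro integral_unique has_integral_mult_left)
  finally show ?thesis by simp
qed

lemma dilate_bounds: "x \<in> {-1..1} \<Longrightarrow> u \<in> {0..1} \<Longrightarrow> -1 + (1 + x) * u \<in> {-1..1::real}"
  using mult_mono[of "1 + x" 2 u 1] by auto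

lemma dilate_continuous:
  assumes f: "continuous_on {-1..1} f" and x: "x \<in> {-1..1::real}"
  shows "continuous_on {0..1} (\<lambda>u. f (-1 + (1 + x) * u))"
  by (rule continuous_on_compose2[OF f]) (use dilate_bounds[OF x] in \<open>auto intro!: continuous_intros\<close>)

lemma abel_mean_abs_le:
  assumes lam: "lam > - 1 / 2" and f: "continuous_on {-1..1} f" and x: "x \<in> {-1..1}"
    and B: "\<And>t. t \<in> {-1..1} \<Longrightarrow> \<bar>f t\<bar> \<le> B"
  shows "\<bar>abel_mean lam f x\<bar> \<le> abel_mass lam * B"
  unfolding abel_mean_def using dilate_bounds[OF x] B
  by (intro abel_mean_le lam dilate_continuous f x) auto

lemma abel_mean_sum:
  assumes lam: "lam > - 1 / 2" and I: "finite I" and f: "\<And>i. i \<in> I \<Longrightarrow> continuous_on {-1..1} (f i)" and x: "x \<in> {-1..1}"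
  shows "abel_mean lam (\<lambda>t. \<Sum>i\<in>I. c i * f i t) x = (\<Sum>i\<in>I. c i * abel_mean lam (f i) x)"
proof -
  have "abel_mean lam (\<lambda>t. \<Sum>i\<in>I. c i * f i t) x = integral {0..1} (\<lambda>u. \<Sum>i\<in>I. c i * (abel_kernel lam u * f i (-1 + (1 + x) * u)))"
    unfolding abel_mean_def by (intro integral_cong) (simp add: sum_distrib_left mult_ac)
  also have "\<dots> = (\<Sum>i\<in>I. integral {0..1} (\<lambda>u. c i * (abel_kernel lam u * f i (-1 + (1 + x) * u))))"
  proof (rule integral_sum[OF I])
    show "(\<lambda>u. c i * (abel_kernel lam u * f i (-1 + (1 + x) * u))) integrable_on {0..1}" if "i \<in> I" for i
      using integrable_cmul[OF abel_kernel_integrable[OF lam dilate_continuous[OF f[OF that] x]], of "c i"] by simp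
  qed
  finally show ?thesis by (simp add: abel_mean_def)
qed

text \<open>The substitution \<open>\<tau> = -1 + (1 + t) u\<close> turns the Abel integral into an average of dilates of \<open>f\<close>,
  which makes its regularity in \<open>t\<close> obvious.\<close>

lemma abel_mean_eq:
  assumes lam: "lam > - 1 / 2" and f: "continuous_on {-1..1} f" and t: "-1 < t" "t \<le> 1"
  shows "(1 + t) powr (-lam) *
      integral {-1..t} (\<lambda>\<tau>. (t - \<tau>) powr (-1/2) * (1 + \<tau>) powr (lam - 1/2) * f \<tau>) = abel_mean lam f t"
proof -
  define s where "s = 1 + t"
  have s: "s > 0" using t by (simp add: s_def)
  let ?I = "\<lambda>\<tau>. (t - \<tau>) powr (-1/2) * (1 + \<tau>) powr (lam - 1/2) * f \<tau>"
  define F where "F u = abel_kernel lam u * f (-1 + s * u)" for u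
  have "(F has_integral abel_mean lam f t) (cbox 0 1)"
    unfolding abel_mean_def F_def[abs_def] s_def
    using integrable_integral[OF abel_kernel_integrable[OF lam dilate_continuous[OF f]], of t] t by simp
  from has_integral_affinity'[OF this, of "1 / s" "1 / s"]
  have "((\<lambda>\<tau>. F (\<tau> / s + 1 / s)) has_integral abel_mean lam f t * s) (cbox ((0 - 1 / s) /\<^sub>R (1 / s)) ((1 - 1 / s) /\<^sub>R (1 / s)))"
    using s by (simp add: mult.commute)
  moreover have "(0 - 1 / s) /\<^sub>R (1 / s) = -1" "(1 - 1 / s) /\<^sub>R (1 / s) = t"
    using s by (simp_all add: field_simps) (simp_all add: s_def algebra_simps)
  ultimately have "((\<lambda>\<tau>. F (\<tau> / s + 1 / s)) has_integral abel_mean lam f t * s) {-1..t}" by simp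
  then have "((\<lambda>\<tau>. ?I \<tau> / s powr (lam - 1)) has_integral abel_mean lam f t * s) {-1..t}"
  proof (rule has_integral_eq[rotated])
    fix \<tau> assume \<tau>: "\<tau> \<in> {-1..t}"
    have e: "\<tau> / s + 1 / s = (1 + \<tau>) / s" "1 - (1 + \<tau>) / s = (t - \<tau>) / s" "-1 + s * (\<tau> / s + 1 / s) = \<tau>"
      using s by (auto simp: s_def field_simps)
    have "s powr (lam - 1) = s powr (lam - 1/2) * s powr (-1/2)" by (simp flip: powr_add)
    then show "F (\<tau> / s + 1 / s) = ?I \<tau> / s powr (lam - 1)"
      unfolding F_def abel_kernel_def e using \<tau> s by (simp add: powr_divide)
  qed
  from has_integral_mult_left[OF this, of "s powr (lam - 1)"]
  have "(?I has_integral abel_mean lam f t * s * s powr (lam - 1)) {-1..t}" using s by simp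
  then have "integral {-1..t} ?I = abel_mean lam f t * (s * s powr (lam - 1))" by (simp add: integral_unique mult.assoc)
  also have "s * s powr (lam - 1) = s powr lam" using s by (simp add: powr_mult_base)
  finally show ?thesis using s by (simp add: powr_minus s_def[symmetric])
qed

lemma Dp_eq:
  assumes lam: "lam > - 1 / 2" and f: "continuous_on {-1..1} f" and x: "x \<in> {-1<..<1}"
  shows "Dp lam f x = (1 + x) * deriv (abel_mean lam f) x"
proof -
  have "\<forall>\<^sub>F t in nhds x. t \<in> {-1<..<1}" using x by (intro eventually_nhds_in_open) auto
  then have "\<forall>\<^sub>F t in nhds x. (1 + t) powr (-lam) *
      integral {-1..t} (\<lambda>\<tau>. (t - \<tau>) powr (-1/2) * (1 + \<tau>) powr (lam - 1/2) * f \<tau>) = abel_mean lam f t"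
    by eventually_elim (rule abel_mean_eq[OF lam f], auto)
  then show ?thesis unfolding Dp_def by (subst deriv_cong_ev[OF _ refl]) auto
qed

lemma Dm_eq:
  assumes lam: "lam > - 1 / 2" and f: "continuous_on {-1..1} f" and x: "x \<in> {-1<..<1}"
  shows "Dm lam f x = (1 - x) * deriv (\<lambda>t. abel_mean lam (\<lambda>t. f (- t)) (- t)) x"
proof -
  have f': "continuous_on {-1..1} (\<lambda>t. f (- t))"
    by (rule continuous_on_compose2[OF f]) (auto intro!: continuous_intros)
  have "\<forall>\<^sub>F t in nhds x. t \<in> {-1<..<1}" using x by (intro eventually_nhds_in_open) auto
  then have "\<forall>\<^sub>F t in nhds x. (1 - t) powr (-lam) *
      integral {t..1} (\<lambda>\<tau>. (\<tau> - t) powr (-1/2) * (1 - \<tau>) powr (lam - 1/2) * f \<tau>) = abel_mean lam (\<lambda>t. f (- t)) (- t)"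
  proof eventually_elim
    fix t :: real assume t: "t \<in> {-1<..<1}"
    have "integral {t..1} (\<lambda>\<tau>. (\<tau> - t) powr (-1/2) * (1 - \<tau>) powr (lam - 1/2) * f \<tau>) =
      integral {-1..-t} (\<lambda>\<tau>. (- t - \<tau>) powr (-1/2) * (1 + \<tau>) powr (lam - 1/2) * f (- \<tau>))"
    proof -
      let ?g = "\<lambda>\<tau>. (\<tau> - t) powr (-1/2) * (1 - \<tau>) powr (lam - 1/2) * f \<tau>"
      have "(- \<tau> - t) = (- t - \<tau>)" "1 - - \<tau> = 1 + \<tau>" for \<tau> :: real by simp_all
      then have "?g (- \<tau>) = (- t - \<tau>) powr (-1/2) * (1 + \<tau>) powr (lam - 1/2) * f (- \<tau>)" for \<tau> by (simp only:)
      then show ?thesis using Henstock_Kurzweil_Integration.integral_reflect_real[of 1 t ?g, symmetric] by (simp only:)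
    qed
    then show "(1 - t) powr (-lam) * integral {t..1} (\<lambda>\<tau>. (\<tau> - t) powr (-1/2) * (1 - \<tau>) powr (lam - 1/2) * f \<tau>) = abel_mean lam (\<lambda>t. f (- t)) (- t)"
      using abel_mean_eq[OF lam f', of "- t"] t by simp
  qed
  then show ?thesis unfolding Dm_def by (subst deriv_cong_ev[OF _ refl]) auto
qed

text \<open>Dilation by \<open>u\<close> in [0, 1] never lengthens intervals, so one delta for
  \<open>f\<close> controls the increments of all dilates at once; integration against the kernel
  only multiplies by its mass.\<close>

lemma abel_mean_abs_cont:
  assumes lam: "lam > - 1 / 2" and f: "continuous_on {-1..1} f" and ac: "abs_cont_on {-1..1} f"
  shows "abs_cont_on {-1..1} (abel_mean lam f)"
  unfolding abs_cont_on_iff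
proof (intro allI impI)
  fix e :: real assume e: "e > 0"
  \<comment> \<open>The summand 1 makes \<open>K\<close> positive and the final estimate
    strict.\<close>
  define K where "K = abel_mass lam + 1"
  have K: "K > 0" using abel_mass_nonneg[OF lam] by (simp add: K_def)
  obtain d where d: "d > 0"
    and dd: "\<And>D. nonoverlapping (-1) 1 D \<Longrightarrow> (\<Sum>I\<in>D. snd I - fst I) < d \<Longrightarrow> increment_sum f D < e / K"
    using ac[unfolded abs_cont_on_iff, THEN spec, of "e / K"] e K by auto
  show "\<exists>d>0. \<forall>D. nonoverlapping (-1) 1 D \<longrightarrow> (\<Sum>I\<in>D. snd I - fst I) < d \<longrightarrow> increment_sum (abel_mean lam f) D < e"
  proof (intro exI[of _ d] conjI allI impI d)
    fix D assume D: "nonoverlapping (-1) 1 D" and len: "(\<Sum>I\<in>D. snd I - fst I) < d"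
    define g where "g I u = f (-1 + (1 + snd I) * u) - f (-1 + (1 + fst I) * u)" for I u
    have DI: "fst I < snd I" "fst I \<in> {-1..1}" "snd I \<in> {-1..1}" if "I \<in> D" for I
      using D that unfolding nonoverlapping_def by fastforce+
    have fin: "finite D" using D by (simp add: nonoverlapping_def)
    have cg: "continuous_on {0..1} (g I)" if "I \<in> D" for I
      unfolding g_def by (intro continuous_intros dilate_continuous f DI[OF that])
    have gsum: "(\<Sum>I\<in>D. \<bar>g I u\<bar>) \<le> e / K" if u: "u \<in> {0..1}" for u
    \<comment> \<open>The affine transport of intervals needs a nonzero factor; at
      \<open>u = 0\<close> all dilates equal f(-1) and the increments vanish.\<close>
    proof (cases "u = 0")
      case True then show ?thesis using e K by (simp add: g_def)
    next
      case False
      then have u0: "u \<noteq> 0" "0 \<le> u" "u \<le> 1" using u by auto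
      have dil: "- 1 + (1 + x) * u = (u - 1) + u * x" for x by (simp add: algebra_simps)
      have "- 1 \<le> (u - 1) + u * x \<and> (u - 1) + u * x \<le> 1" if "-1 \<le> x" "x \<le> 1" for x
        using dilate_bounds[OF _ u, of x] that unfolding dil by auto
      from nonoverlapping_affine[OF D u0(1) this] obtain D' where D': "nonoverlapping (-1) 1 D'"
        "(\<Sum>I\<in>D'. snd I - fst I) = \<bar>u\<bar> * (\<Sum>I\<in>D. snd I - fst I)"
        "increment_sum f D' = increment_sum (\<lambda>x. f ((u - 1) + u * x)) D" by blast
      have "0 \<le> (\<Sum>I\<in>D. snd I - fst I)" using DI by (intro sum_nonneg) (auto simp: less_imp_le)
      then have "\<bar>u\<bar> * (\<Sum>I\<in>D. snd I - fst I) \<le> 1 * (\<Sum>I\<in>D. snd I - fst I)"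
        using u0 by (intro mult_right_mono) auto
      then have "increment_sum f D' < e / K" using len D' by (intro dd) auto
      then have "increment_sum (\<lambda>x. f ((u - 1) + u * x)) D < e / K" unfolding D'(3) .
      then show ?thesis unfolding increment_sum_def g_def dil by simp
    qed
    have diff: "\<bar>abel_mean lam f (snd I) - abel_mean lam f (fst I)\<bar> \<le> integral {0..1} (\<lambda>u. abel_kernel lam u * \<bar>g I u\<bar>)"
      if I: "I \<in> D" for I
    proof -
      have "abel_mean lam f (snd I) - abel_mean lam f (fst I) = integral {0..1} (\<lambda>u. abel_kernel lam u * g I u)"
        unfolding abel_mean_def g_def right_diff_distrib
        by (rule integral_diff[symmetric]) (intro abel_kernel_integrable lam dilate_continuous f DI[OF I])+
      also have "norm \<dots> \<le> integral {0..1} (\<lambda>u. abel_kernel lam u * \<bar>g I u\<bar>)"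
        by (rule integral_norm_bound_integral)
           (auto intro!: abel_kernel_integrable lam cg I continuous_intros simp: abs_mult abel_kernel_nonneg)
      finally show ?thesis by simp
    qed
    have "increment_sum (abel_mean lam f) D \<le> (\<Sum>I\<in>D. integral {0..1} (\<lambda>u. abel_kernel lam u * \<bar>g I u\<bar>))"
      unfolding increment_sum_def using diff by (intro sum_mono) auto
    also have "\<dots> = integral {0..1} (\<lambda>u. \<Sum>I\<in>D. abel_kernel lam u * \<bar>g I u\<bar>)"
      by (rule integral_sum[symmetric, OF fin]) (intro abel_kernel_integrable lam cg continuous_intros)
    also have "\<dots> = integral {0..1} (\<lambda>u. abel_kernel lam u * (\<Sum>I\<in>D. \<bar>g I u\<bar>))"
      by (simp add: sum_distrib_left)
    also have "\<dots> \<le> abel_mass lam * (e / K)"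
    proof -
      have "\<bar>integral {0..1} (\<lambda>u. abel_kernel lam u * (\<Sum>I\<in>D. \<bar>g I u\<bar>))\<bar> \<le> abel_mass lam * (e / K)"
        by (rule abel_mean_le[OF lam]) (intro continuous_intros cg, use gsum in \<open>simp_all add: sum_nonneg\<close>)
      then show ?thesis by simp
    qed
    also have "\<dots> < e" using e K by (simp add: K_def field_simps)
    finally show "increment_sum (abel_mean lam f) D < e" .
  qed
qed

lemma abs_cont_on_diff:
  assumes f: "abs_cont_on {a..b} f" and g: "abs_cont_on {a..b} g"
  shows "abs_cont_on {a..b} (\<lambda>x. f x - g x)"
  unfolding abs_cont_on_iff
proof (intro allI impI)
  fix e :: real assume e: "e > 0"
  then have e2: "e / 2 > 0" by simp
  obtain d d' where d: "d > 0" "d' > 0"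
    "\<And>D. nonoverlapping a b D \<Longrightarrow> (\<Sum>I\<in>D. snd I - fst I) < d \<Longrightarrow> increment_sum f D < e / 2"
    "\<And>D. nonoverlapping a b D \<Longrightarrow> (\<Sum>I\<in>D. snd I - fst I) < d' \<Longrightarrow> increment_sum g D < e / 2"
    using f g e2 unfolding abs_cont_on_iff by blast
  have tri: "increment_sum (\<lambda>x. f x - g x) D \<le> increment_sum f D + increment_sum g D" for D
    unfolding increment_sum_def sum.distrib[symmetric] by (intro sum_mono) linarith
  show "\<exists>d>0. \<forall>D. nonoverlapping a b D \<longrightarrow> (\<Sum>I\<in>D. snd I - fst I) < d \<longrightarrow> increment_sum (\<lambda>x. f x - g x) D < e"
  proof (intro exI[of _ "min d d'"] conjI allI impI)
    fix D assume D: "nonoverlapping a b D" "(\<Sum>I\<in>D. snd I - fst I) < min d d'"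
    then show "increment_sum (\<lambda>x. f x - g x) D < e" using d(3)[of D] d(4)[of D] tri[of D] by simp
  qed (use d in simp)
qed

lemma abs_cont_on_subinterval:
  assumes "abs_cont_on {a..b} f" "a \<le> u" "v \<le> b"
  shows "abs_cont_on {u..v} f"
  unfolding abs_cont_on_iff
proof (intro allI impI)
  fix e :: real assume "e > 0"
  with assms(1) obtain d where "d > 0"
    "\<And>D. nonoverlapping a b D \<Longrightarrow> (\<Sum>I\<in>D. snd I - fst I) < d \<Longrightarrow> increment_sum f D < e"
    unfolding abs_cont_on_iff by blast
  then show "\<exists>d>0. \<forall>D. nonoverlapping u v D \<longrightarrow> (\<Sum>I\<in>D. snd I - fst I) < d \<longrightarrow> increment_sum f D < e"
    using nonoverlapping_mono[OF _ assms(2,3)] by (intro exI[of _ d]) blast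
qed

lemma abs_cont_on_reflect:
  assumes "abs_cont_on {-1..1} f"
  shows "abs_cont_on {-1..1} (\<lambda>t. f (- t))"
  unfolding abs_cont_on_iff
proof (intro allI impI)
  fix e :: real assume "e > 0"
  with assms obtain d where d: "d > 0"
    "\<And>D. nonoverlapping (-1) 1 D \<Longrightarrow> (\<Sum>I\<in>D. snd I - fst I) < d \<Longrightarrow> increment_sum f D < e"
    unfolding abs_cont_on_iff by blast
  show "\<exists>d>0. \<forall>D. nonoverlapping (-1) 1 D \<longrightarrow> (\<Sum>I\<in>D. snd I - fst I) < d \<longrightarrow> increment_sum (\<lambda>t. f (- t)) D < e"
  proof (intro exI[of _ d] conjI allI impI d(1))
    fix D :: "(real \<times> real) set" assume D: "nonoverlapping (-1) 1 D" and len: "(\<Sum>I\<in>D. snd I - fst I) < d"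
    show "increment_sum (\<lambda>t. f (- t)) D < e"
    proof (rule nonoverlapping_affine[OF D, of "-1" "-1" 0 1])
      fix D' assume "nonoverlapping (-1) 1 D'" "(\<Sum>I\<in>D'. snd I - fst I) = \<bar>- 1\<bar> * (\<Sum>I\<in>D. snd I - fst I)"
        and inc: "\<And>h. increment_sum h D' = increment_sum (\<lambda>x. h (0 + - 1 * x)) D"
      then have "increment_sum f D' < e" using len by (intro d(2)) auto
      then show ?thesis unfolding inc by simp
    qed auto
  qed
qed

lemma abs_cont_on_integral:
  assumes g: "continuous_on {a..b} g"
  shows "abs_cont_on {a..b} (\<lambda>x. integral {a..x} g)"
  unfolding abs_cont_on_iff
proof (intro allI impI)
  fix e :: real assume e: "e > 0"
  have "bounded (g ` {a..b})" by (intro compact_imp_bounded compact_continuous_image g) auto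
  then obtain B where B: "B > 0" "\<forall>y\<in>g ` {a..b}. norm y \<le> B" using bounded_pos by blast
  have lip: "\<bar>integral {a..v} g - integral {a..u} g\<bar> \<le> B * (v - u)" if "a \<le> u" "u < v" "v \<le> b" for u v
  proof -
    have i: "g integrable_on {a..v}" using that by (intro integrable_continuous_real continuous_on_subset[OF g]) auto
    have "integral {a..v} g - integral {a..u} g = integral {u..v} g"
      using Henstock_Kurzweil_Integration.integral_combine[OF _ _ i, of u] that by simp
    also have "norm \<dots> \<le> B * (v - u)"
      using that B by (intro integral_bound continuous_on_subset[OF g]) auto
    finally show ?thesis by simp
  qed
  show "\<exists>d>0. \<forall>D. nonoverlapping a b D \<longrightarrow> (\<Sum>I\<in>D. snd I - fst I) < d \<longrightarrow> increment_sum (\<lambda>x. integral {a..x} g) D < e"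
  proof (intro exI[of _ "e / B"] conjI allI impI)
    fix D assume D: "nonoverlapping a b D" "(\<Sum>I\<in>D. snd I - fst I) < e / B"
    have "increment_sum (\<lambda>x. integral {a..x} g) D \<le> (\<Sum>I\<in>D. B * (snd I - fst I))"
      unfolding increment_sum_def using D(1) by (intro sum_mono lip) (auto simp: nonoverlapping_def)
    also have "\<dots> = B * (\<Sum>I\<in>D. snd I - fst I)" by (simp add: sum_distrib_left)
    also have "\<dots> < B * (e / B)" using D(2) B(1) by (intro mult_strict_left_mono) auto
    finally show "increment_sum (\<lambda>x. integral {a..x} g) D < e" using B(1) by simp
  qed (use e B in auto)
qed

text \<open>The null set is first enlarged by the points of non-differentiability, since
  \<open>deriv\<close> carries information only elsewhere. Subtracting the integral of
  \<open>g\<close> then leaves an absolutely continuous function with zero derivative almost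
  everywhere, so \<open>h\<close> is an antiderivative of \<open>g\<close> at every interior
  point.\<close>

theorem abs_cont_C1:
  assumes ac: "abs_cont_on {a..b} h" and g: "continuous_on {a<..<b} g" and N: "negligible N"
    and der: "\<And>x. x \<in> {a<..<b} - N \<Longrightarrow> deriv h x = g x" and x: "x \<in> {a<..<b}"
  shows "(h has_real_derivative g x) (at x)"
proof -
  define N' where "N' = N \<union> {x \<in> {a<..<b}. \<not> h field_differentiable at x}"
  have N': "negligible N'" unfolding N'_def by (intro negligible_Un N abs_cont_differentiable ac)
  have hd: "(h has_real_derivative g y) (at y)" if yN: "y \<in> {a<..<b} - N'" for y
  proof -
    obtain D where D: "(h has_real_derivative D) (at y)" using yN by (auto simp: N'_def field_differentiable_def)
    moreover have "deriv h y = g y" using yN by (intro der) (auto simp: N'_def)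
    ultimately show ?thesis using DERIV_imp_deriv[OF D] by simp
  qed
  define \<alpha> \<beta> where "\<alpha> = (a + x) / 2" and "\<beta> = (x + b) / 2"
  have ab: "a < \<alpha>" "\<alpha> < x" "x < \<beta>" "\<beta> < b" using x by (auto simp: \<alpha>_def \<beta>_def)
  have g': "continuous_on {\<alpha>..\<beta>} g" using ab by (intro continuous_on_subset[OF g]) auto
  have Ider: "((\<lambda>y. integral {\<alpha>..y} g) has_real_derivative g y) (at y)" if "y \<in> {\<alpha><..<\<beta>}" for y
    using integral_has_real_derivative[OF g', of y] that by (simp add: at_within_Icc_at)
  have eq: "h y = h \<alpha> + integral {\<alpha>..y} g" if y: "y \<in> {\<alpha>..\<beta>}" for y
  proof -
    have "h y - integral {\<alpha>..y} g = h \<alpha> - integral {\<alpha>..\<alpha>} g"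
    proof (rule abs_cont_zero_derivative[where h = "\<lambda>y. h y - integral {\<alpha>..y} g", OF _ _ N'])
      have "abs_cont_on {\<alpha>..\<beta>} (\<lambda>y. h y - integral {\<alpha>..y} g)"
        using ab by (intro abs_cont_on_diff abs_cont_on_integral g' abs_cont_on_subinterval[OF ac]) auto
      then show "abs_cont_on {\<alpha>..y} (\<lambda>y. h y - integral {\<alpha>..y} g)" by (rule abs_cont_on_subinterval) (use y in auto)
      show "\<alpha> \<le> y" using y by simp
      fix z assume z: "z \<in> {\<alpha><..<y} - N'"
      have "(h has_real_derivative g z) (at z)" by (rule hd) (use z y ab in auto)
      moreover have "((\<lambda>y. integral {\<alpha>..y} g) has_real_derivative g z) (at z)" by (rule Ider) (use z y in auto)
      ultimately show "((\<lambda>y. h y - integral {\<alpha>..y} g) has_real_derivative 0) (at z)" using DERIV_diff by fastforce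
    qed
    then show ?thesis by simp
  qed
  have "((\<lambda>y. h \<alpha> + integral {\<alpha>..y} g) has_real_derivative g x) (at x)"
    using DERIV_add[OF DERIV_const Ider[of x]] ab by simp
  moreover have "\<forall>\<^sub>F y in nhds x. h y = h \<alpha> + integral {\<alpha>..y} g"
  proof -
    have "\<forall>\<^sub>F y in nhds x. y \<in> {\<alpha><..<\<beta>}" using ab by (intro eventually_nhds_in_open) auto
    then show ?thesis by eventually_elim (rule eq, auto)
  qed
  ultimately show ?thesis by (subst DERIV_cong_ev[OF refl _ refl]) auto
qed

section \<open>Coefficients of the fractional derivatives\<close>

text \<open>Its coefficients are those of the polynomial in powers of 1 + t, the basis on which the
  Abel means act diagonally (\<open>abel_mean_power\<close>).\<close>

definition shifted_ultra :: "nat \<Rightarrow> nat \<Rightarrow> real poly" where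
  "shifted_ultra k j = pcompose (ultra k j) [:-1, 1:]"

lemma poly_shifted_ultra: "poly (shifted_ultra k j) (1 + t) = poly (ultra k j) t"
  by (simp add: shifted_ultra_def poly_pcompose)

lemma shifted_ultra_coeff_0: "coeff (shifted_ultra k j) 0 = (-1) ^ j"
  using poly_shifted_ultra[of k j "-1"] ultra_parity[of k j 1] by (simp add: poly_0_coeff_0)

text \<open>The differential equation in y = 1 + t compared coefficientwise. The ratio is that of
  the hypergeometric series 2F1(-j, j + k - 1; k/2; y/2).\<close>

lemma shifted_ultra_coeff_Suc:
  assumes k: "k \<ge> 1"
  shows "(real i + 1) * (2 * real i + k) * coeff (shifted_ultra k j) (Suc i) =
    (real i - real j) * (real i + real j + k - 1) * coeff (shifted_ultra k j) i"
proof -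
  define Y where "Y = shifted_ultra k j"
  define c where "c = j * (real j + real k - 1)"
  have dY: "pderiv Y = pcompose (pderiv (ultra k j)) [:-1, 1:]"
    "pderiv (pderiv Y) = pcompose (pderiv (pderiv (ultra k j))) [:-1, 1:]"
    by (simp_all add: Y_def shifted_ultra_def pderiv_pcompose pderiv_pCons)
  have ode: "[:0, 2, -1:] * pderiv (pderiv Y) = smult k ([:-1, 1:] * pderiv Y) - smult c Y"
  proof (rule poly_ext_real)
    fix y :: real
    have "(1 - (y - 1)\<^sup>2) * poly (pderiv (pderiv (ultra k j))) (y - 1) =
      k * (y - 1) * poly (pderiv (ultra k j)) (y - 1) - c * poly (ultra k j) (y - 1)"
      unfolding c_def by (rule ultra_ode_eval[OF k])
    moreover have "1 - (y - 1)\<^sup>2 = y * (2 - y)" by (simp add: power2_eq_square algebra_simps)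
    ultimately show "poly ([:0, 2, -1:] * pderiv (pderiv Y)) y = poly (smult k ([:-1, 1:] * pderiv Y) - smult c Y) y"
      unfolding dY(2) unfolding dY(1) by (simp add: Y_def shifted_ultra_def poly_pcompose algebra_simps)
  qed
  have L: "coeff ([:0, 2, -1:] * pderiv (pderiv Y)) i = 2 * (real i + 1) * real i * coeff Y (Suc i) - real i * (real i - 1) * coeff Y i"
  proof (cases i)
    case 0 then show ?thesis by simp
  next
    case (Suc i')
    then show ?thesis by (cases i') (simp_all add: coeff_pderiv algebra_simps)
  qed
  have R: "coeff (smult k ([:-1, 1:] * pderiv Y) - smult c Y) i = k * (real i * coeff Y i - (real i + 1) * coeff Y (Suc i)) - c * coeff Y i"
    by (cases i) (simp_all add: coeff_pderiv algebra_simps)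
  from arg_cong[OF ode, of "\<lambda>p. coeff p i"] L R
  have "2 * (real i + 1) * real i * coeff Y (Suc i) - real i * (real i - 1) * coeff Y i =
     k * (real i * coeff Y i - (real i + 1) * coeff Y (Suc i)) - c * coeff Y i" by simp
  then show ?thesis unfolding Y_def[symmetric] c_def by (simp add: algebra_simps)
qed

text \<open>Comparing hypergeometric coefficients, \<open>i u\<^sub>i\<close> splits over two consecutive ultraspherical
  polynomials of the next dimension.\<close>

lemma shifted_ultra_transfer:
  fixes u :: "nat \<Rightarrow> real"
  assumes m: "m \<ge> 1" and j: "j \<ge> 1" and u0: "u 0 = (-1) ^ j"
    and uS: "\<And>i. (real i + 1) * (2 * real i + m + 1) * u (Suc i) = (real i - real j) * (real i + real j + m - 1) * u i"
  shows "real i * u i = j * (real j + m - 1) / (2 * real j + m - 1) *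
    (coeff (shifted_ultra (m + 1) j) i + coeff (shifted_ultra (m + 1) (j - 1)) i)"
proof -
  define q where "q = coeff (shifted_ultra (m + 1) j)"
  define q' where "q' = coeff (shifted_ultra (m + 1) (j - 1))"
  have rj: "real (j - 1) = real j - 1" using j by simp
  have qS: "(real i + 1) * (2 * real i + m + 1) * q (Suc i) = (real i - real j) * (real i + real j + m) * q i" for i
    using shifted_ultra_coeff_Suc[of "m + 1" i j] by (simp add: q_def algebra_simps)
  have qS': "(real i + 1) * (2 * real i + m + 1) * q' (Suc i) = (real i - real j + 1) * (real i + real j + m - 1) * q' i" for i
    using shifted_ultra_coeff_Suc[of "m + 1" i "j - 1"] unfolding rj by (simp add: q'_def algebra_simps)
  have pos: "(real i + 1) * (2 * real i + m + 1) \<noteq> 0" for i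
    using m by (auto simp: add_eq_0_iff)
  \<comment> \<open>The ratio of successive coefficients of \<open>q\<close>, and likewise of
    \<open>q'\<close>, differs from that of \<open>u\<close> by one shifted factor, so the quotients
    by \<open>u i\<close> are linear in i. The two linear expressions combine below to i (2j + m -
    1).\<close>
  have 1: "q i * (real j + m - 1) = u i * (real j + m + real i - 1)"
  proof (induction i)
    case 0 show ?case by (simp add: q_def shifted_ultra_coeff_0 u0)
  next
    case (Suc i)
    have "(real i + 1) * (2 * real i + m + 1) * (q (Suc i) * (real j + m - 1)) =
      (real i - real j) * (real i + real j + m) * (q i * (real j + m - 1))"
      using qS[of i] by (simp add: mult_ac)
    also have "\<dots> = (real i + real j + m) * ((real i - real j) * (real i + real j + m - 1) * u i)"
      unfolding Suc by (simp add: algebra_simps)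
    also have "\<dots> = (real i + 1) * (2 * real i + m + 1) * (u (Suc i) * (real j + m + real (Suc i) - 1))"
      unfolding uS[symmetric] by (simp add: algebra_simps)
    finally show ?case using pos[of i] by (metis mult_cancel_left)
  qed
  have 2: "q' i * j = u i * (real i - real j)"
  proof (induction i)
    case 0
    have "(-1) ^ (j - 1) = - ((-1 :: real) ^ j)" using j by (cases j) auto
    then show ?case by (simp add: q'_def shifted_ultra_coeff_0 u0)
  next
    case (Suc i)
    have "(real i + 1) * (2 * real i + m + 1) * (q' (Suc i) * j) =
      (real i - real j + 1) * (real i + real j + m - 1) * (q' i * j)"
      using qS'[of i] by (simp add: mult_ac)
    also have "\<dots> = (real i - real j + 1) * ((real i - real j) * (real i + real j + m - 1) * u i)"
      unfolding Suc by (simp add: algebra_simps)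
    also have "\<dots> = (real i + 1) * (2 * real i + m + 1) * (u (Suc i) * (real (Suc i) - real j))"
      unfolding uS[symmetric] by (simp add: algebra_simps)
    finally show ?case using pos[of i] by (metis mult_cancel_left)
  qed
  have jp: "real j > 0" "real j + m - 1 > 0" "2 * real j + m - 1 > 0" using j m by auto
  have "q i = u i * (real j + m + real i - 1) / (real j + m - 1)" "q' i = u i * (real i - real j) / j"
    using 1 2 jp by (simp_all add: field_simps)
  moreover have "v * x / p + v * y / r = v * (x * r + y * p) / (r * p)" if "p > 0" "r > 0" for v x y p r :: real
    using that by (simp add: field_simps)
  ultimately have "q i + q' i = u i * ((real j + m + real i - 1) * j + (real i - real j) * (real j + m - 1)) / (j * (real j + m - 1))"
    using jp by simp
  also have "(real j + m + real i - 1) * j + (real i - real j) * (real j + m - 1) = real i * (2 * real j + m - 1)"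
    by (simp add: algebra_simps)
  finally show ?thesis unfolding q_def[symmetric] q'_def[symmetric] using jp by simp
qed

definition abel_lam :: "nat \<Rightarrow> real" where
  "abel_lam m = (real m - 1) / 2"

lemma abel_lam_gt: "m \<ge> 1 \<Longrightarrow> abel_lam m > - 1 / 2"
  by (simp add: abel_lam_def)

lemma abel_mean_power:
  assumes lam: "lam > - 1 / 2" and x: "x \<in> {-1..1}"
  shows "abel_mean lam (\<lambda>t. (1 + t) ^ i) x = abel_mass (lam + i) * (1 + x) ^ i"
proof -
  have "abel_mean lam (\<lambda>t. (1 + t) ^ i) x = integral {0..1} (\<lambda>u. abel_kernel (lam + i) u * (1 + x) ^ i)"
    unfolding abel_mean_def
  proof (rule integral_cong)
    fix u :: real assume u: "u \<in> {0..1}"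
    have "u powr (lam - 1 / 2) * u ^ i = u powr (lam + i - 1 / 2)"
    proof (cases "u = 0")
      case False
      then have "u ^ i = u powr i" using u by (simp add: powr_realpow)
      then show ?thesis by (simp add: algebra_simps flip: powr_add)
    qed simp
    then show "abel_kernel lam u * (1 + (-1 + (1 + x) * u)) ^ i = abel_kernel (lam + i) u * (1 + x) ^ i"
      by (simp add: abel_kernel_def power_mult_distrib mult_ac)
  qed
  also have "\<dots> = abel_mass (lam + i) * (1 + x) ^ i"
    using lam by (intro integral_unique has_integral_mult_left abel_kernel_has_integral) auto
  finally show ?thesis .
qed

text \<open>The functional equation of the Beta function. Its ratio (2i + m)/(2i + m + 1) replaces
  the denominator parameter m/2 of the series on S^m by the parameter (m + 1)/2 of S^(m+1).\<close>

lemma abel_mass_Suc: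
  assumes m: "m \<ge> 1"
  shows "abel_mass (abel_lam m + Suc i) * (2 * real i + m + 1) = abel_mass (abel_lam m + i) * (2 * real i + m)"
proof -
  have "(abel_lam m + i + 1 / 2 + 1 / 2) * Beta (abel_lam m + i + 1 / 2 + 1) (1 / 2) = (abel_lam m + i + 1 / 2) * Beta (abel_lam m + i + 1 / 2) (1 / 2)"
  proof (rule Beta_plus1_left)
    have "abel_lam m + i + 1 / 2 = real m / 2 + real i" by (simp add: abel_lam_def field_simps)
    then have "abel_lam m + i + 1 / 2 > 0" using m by simp
    then show "abel_lam m + i + 1 / 2 \<notin> \<int>\<^sub>\<le>\<^sub>0" by (auto elim!: nonpos_Ints_cases)
  qed
  then show ?thesis by (simp add: abel_lam_def field_simps)
qed

lemma abel_mass_pos: "m \<ge> 1 \<Longrightarrow> abel_mass (abel_lam m) > 0"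
  unfolding Beta_def by (intro divide_pos_pos mult_pos_pos Gamma_real_pos) (use abel_lam_gt[of m] in auto)

text \<open>The multiplier of degree \<open>j\<close> apart from the common factor
  \<open>abel_mass\<close>. It vanishes at \<open>j = 0\<close>, since constants have constant Abel
  means.\<close>

definition lift_factor :: "nat \<Rightarrow> nat \<Rightarrow> real" where
  "lift_factor m j = j * (real j + m - 1) / (2 * real j + m - 1)"

text \<open>After multiplication by 1 + x the derivative weights the i-th coefficient by i, which is
  the left side of \<open>shifted_ultra_transfer\<close> for the coefficients multiplied by the Beta
  ratios.\<close>

lemma abel_mean_ultra_deriv:
  assumes m: "m \<ge> 1" and x: "x \<in> {-1<..<1}"
  shows "(abel_mean (abel_lam m) (poly (ultra m j)) has_real_derivative
    abel_mass (abel_lam m) * lift_factor m j * (poly (ultra (m + 1) j) x + poly (ultra (m + 1) (j - 1)) x) / (1 + x)) (at x)"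
proof -
  define lam where "lam = abel_lam m"
  have lam: "lam > - 1 / 2" using abel_lam_gt[OF m] by (simp add: lam_def)
  define Y where "Y = shifted_ultra m j"
  define d where "d = max (degree Y) (max (degree (shifted_ultra (m + 1) j)) (degree (shifted_ultra (m + 1) (j - 1))))"
  have expand: "poly p y = (\<Sum>i\<le>d. coeff p i * y ^ i)" if "degree p \<le> d" for p :: "real poly" and y
    unfolding poly_altdef using that by (intro sum.mono_neutral_left) (auto simp: coeff_eq_0)
  have mean: "abel_mean lam (poly (ultra m j)) t = (\<Sum>i\<le>d. coeff Y i * abel_mass (lam + i) * (1 + t) ^ i)" if t: "t \<in> {-1..1}" for t
  proof -
    have "poly (ultra m j) = (\<lambda>t. \<Sum>i\<le>d. coeff Y i * (1 + t) ^ i)"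
      by (rule ext) (simp add: poly_shifted_ultra[symmetric] Y_def[symmetric] expand d_def)
    moreover have "continuous_on {-1..1} (\<lambda>t::real. (1 + t) ^ i)" for i by (intro continuous_intros)
    from abel_mean_sum[OF lam finite_atMost this t, where c = "coeff Y"]
    have "abel_mean lam (\<lambda>t. \<Sum>i\<le>d. coeff Y i * (1 + t) ^ i) t = (\<Sum>i\<le>d. coeff Y i * abel_mean lam (\<lambda>t. (1 + t) ^ i) t)" .
    ultimately have "abel_mean lam (poly (ultra m j)) t = (\<Sum>i\<le>d. coeff Y i * abel_mean lam (\<lambda>t. (1 + t) ^ i) t)" by (simp only:)
    then show ?thesis by (simp add: abel_mean_power[OF lam t] mult.assoc)
  qed
  have eqi: "real i * (coeff Y i * abel_mass (lam + i)) = abel_mass lam * lift_factor m j *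
     (coeff (shifted_ultra (m + 1) j) i + coeff (shifted_ultra (m + 1) (j - 1)) i)" for i
  proof (cases "j = 0")
    case True
    have "coeff Y i = 0" if "i \<ge> 1" using that True by (simp add: Y_def shifted_ultra_def pcompose_1)
    then show ?thesis using True by (cases i) (auto simp: lift_factor_def)
  next
    case False
    then have j: "j \<ge> 1" by simp
    have mp: "abel_mass lam > 0" using abel_mass_pos[OF m] by (simp add: lam_def)
    define u where "u i = coeff Y i * abel_mass (lam + i) / abel_mass lam" for i
    have "real i * u i = lift_factor m j * (coeff (shifted_ultra (m + 1) j) i + coeff (shifted_ultra (m + 1) (j - 1)) i)"
      unfolding lift_factor_def
    proof (rule shifted_ultra_transfer[OF m j])
      show "u 0 = (-1) ^ j" using mp by (simp add: u_def Y_def shifted_ultra_coeff_0)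
      fix i
      have "(real i + 1) * (2 * real i + m + 1) * (coeff Y (Suc i) * abel_mass (lam + Suc i)) =
        (real i + 1) * coeff Y (Suc i) * (abel_mass (lam + Suc i) * (2 * real i + m + 1))" by (simp add: mult_ac)
      also have "\<dots> = ((real i + 1) * (2 * real i + m) * coeff Y (Suc i)) * abel_mass (lam + i)"
        unfolding lam_def abel_mass_Suc[OF m] by (simp add: mult_ac)
      also have "\<dots> = (real i - real j) * (real i + real j + m - 1) * (coeff Y i * abel_mass (lam + i))"
        unfolding Y_def shifted_ultra_coeff_Suc[OF m] by (simp add: mult_ac)
      finally show "(real i + 1) * (2 * real i + m + 1) * u (Suc i) = (real i - real j) * (real i + real j + m - 1) * u i"
        unfolding u_def times_divide_eq_right by (simp only:)
    qed
    then show ?thesis using mp by (simp add: u_def field_simps)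
  qed
  have "((\<lambda>t. \<Sum>i\<le>d. coeff Y i * abel_mass (lam + i) * (1 + t) ^ i) has_real_derivative
     (\<Sum>i\<le>d. coeff Y i * abel_mass (lam + i) * (real i * (1 + x) ^ (i - 1)))) (at x)"
    by (rule DERIV_sum) (rule derivative_eq_intros refl | simp)+
  moreover have "(\<Sum>i\<le>d. coeff Y i * abel_mass (lam + i) * (real i * (1 + x) ^ (i - 1))) =
    abel_mass lam * lift_factor m j * (poly (ultra (m + 1) j) x + poly (ultra (m + 1) (j - 1)) x) / (1 + x)"
  proof -
    have x1: "1 + x > 0" using x by simp
    have "(1 + x) * (\<Sum>i\<le>d. coeff Y i * abel_mass (lam + i) * (real i * (1 + x) ^ (i - 1))) =
      (\<Sum>i\<le>d. (real i * (coeff Y i * abel_mass (lam + i))) * (1 + x) ^ i)"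
      unfolding sum_distrib_left
    proof (intro sum.cong refl)
      fix i
      show "(1 + x) * (coeff Y i * abel_mass (lam + i) * (real i * (1 + x) ^ (i - 1))) = (real i * (coeff Y i * abel_mass (lam + i))) * (1 + x) ^ i"
        by (cases i) (simp_all add: mult_ac)
    qed
    also have "\<dots> = abel_mass lam * lift_factor m j * ((\<Sum>i\<le>d. coeff (shifted_ultra (m + 1) j) i * (1 + x) ^ i) + (\<Sum>i\<le>d. coeff (shifted_ultra (m + 1) (j - 1)) i * (1 + x) ^ i))"
      unfolding eqi sum.distrib[symmetric] sum_distrib_left by (intro sum.cong refl) (simp add: algebra_simps)
    also have "\<dots> = abel_mass lam * lift_factor m j * (poly (ultra (m + 1) j) x + poly (ultra (m + 1) (j - 1)) x)"
    proof -
      have "degree (shifted_ultra (m + 1) j) \<le> d" "degree (shifted_ultra (m + 1) (j - 1)) \<le> d"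
        by (simp_all add: d_def)
      then show ?thesis unfolding poly_shifted_ultra[symmetric] by (simp only: expand)
    qed
    finally show ?thesis using x1 by (simp add: field_simps)
  qed
  moreover have "\<forall>\<^sub>F t in nhds x. abel_mean lam (poly (ultra m j)) t = (\<Sum>i\<le>d. coeff Y i * abel_mass (lam + i) * (1 + t) ^ i)"
  proof -
    have "\<forall>\<^sub>F t in nhds x. t \<in> {-1<..<1}" using x by (intro eventually_nhds_in_open) auto
    then show ?thesis by eventually_elim (rule mean, auto)
  qed
  ultimately show ?thesis unfolding lam_def[symmetric] by (subst DERIV_cong_ev[OF refl _ refl]) auto
qed

section \<open>Coefficients of the derivative as bounded functionals of the Abel mean\<close>

text \<open>The factor [:1, 1:], that is 1 + cos, cancels the denominator in H' = E / (1 + x). The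
  power of the sine is one below the weight of S^(m+1), because the derivative of the cosine
  supplies another sine.\<close>

definition parts_weight :: "nat \<Rightarrow> real poly \<Rightarrow> real \<Rightarrow> real" where
  "parts_weight m P \<theta> = sin \<theta> ^ (m - 1) * poly ([:1, 1:] * P) (cos \<theta>)"

text \<open>For \<open>m = 1\<close> the exponent \<open>m - 2\<close> is truncated to 0, but then
  the factor \<open>m - 1\<close> is 0.\<close>

definition parts_weight_deriv :: "nat \<Rightarrow> real poly \<Rightarrow> real \<Rightarrow> real" where
  "parts_weight_deriv m P \<theta> = real (m - 1) * sin \<theta> ^ (m - 2) * cos \<theta> * poly ([:1, 1:] * P) (cos \<theta>)
     - sin \<theta> ^ (m - 1) * (sin \<theta> * poly (pderiv ([:1, 1:] * P)) (cos \<theta>))"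

text \<open>The pairing of (1 + x) H' with \<open>P\<close> on S^(m+1), written without the
  derivative of H. It is thereby defined for every continuous H and bounded in the supremum
  norm.\<close>

definition parts_functional :: "nat \<Rightarrow> real poly \<Rightarrow> (real \<Rightarrow> real) \<Rightarrow> real" where
  "parts_functional m P H = integral {0..pi} (\<lambda>\<theta>. parts_weight_deriv m P \<theta> * H (cos \<theta>))
     - (parts_weight m P pi * H (-1) - parts_weight m P 0 * H 1)"

lemma DERIV_parts_weight: "(parts_weight m P has_real_derivative parts_weight_deriv m P \<theta>) (at \<theta>)"
proof -
  have "((\<lambda>\<theta>. sin \<theta> ^ (m - 1)) has_real_derivative real (m - 1) * sin \<theta> ^ (m - 2) * cos \<theta>) (at \<theta>)"
    by (auto intro!: derivative_eq_intros simp: numeral_2_eq_2)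
  moreover have "((\<lambda>\<theta>. poly ([:1, 1:] * P) (cos \<theta>)) has_real_derivative poly (pderiv ([:1, 1:] * P)) (cos \<theta>) * (- sin \<theta>)) (at \<theta>)"
    by (rule DERIV_chain2[OF poly_DERIV DERIV_cos])
  ultimately have "((\<lambda>\<theta>. sin \<theta> ^ (m - 1) * poly ([:1, 1:] * P) (cos \<theta>)) has_real_derivative
    real (m - 1) * sin \<theta> ^ (m - 2) * cos \<theta> * poly ([:1, 1:] * P) (cos \<theta>) + poly (pderiv ([:1, 1:] * P)) (cos \<theta>) * (- sin \<theta>) * sin \<theta> ^ (m - 1)) (at \<theta>)"
    by (rule DERIV_mult)
  then show ?thesis unfolding parts_weight_def[abs_def] parts_weight_deriv_def by (simp only: mult_ac mult_minus_right mult_minus_left) simp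
qed

lemma parts_weight_deriv_continuous: "continuous_on S (parts_weight_deriv m P)"
  unfolding parts_weight_deriv_def[abs_def] by (intro continuous_intros)

lemma zonal_int_parts:
  assumes m: "m \<ge> 1" and H: "continuous_on {-1..1} H" and E: "continuous_on {-1..1} E"
    and der: "\<And>x. x \<in> {-1<..<1} \<Longrightarrow> (H has_real_derivative E x / (1 + x)) (at x)"
  shows "zonal_int (m + 1) (\<lambda>t. E t * poly P t) = parts_functional m P H"
proof -
  define F where "F \<theta> = parts_weight m P \<theta> * H (cos \<theta>)" for \<theta>
  have "((\<lambda>\<theta>. parts_weight_deriv m P \<theta> * H (cos \<theta>) - E (cos \<theta>) * poly P (cos \<theta>) * sin \<theta> ^ m) has_integral F pi - F 0) {0..pi}"
  proof (rule fundamental_theorem_of_calculus_interior)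
    have "continuous_on {0..pi} (parts_weight m P)" unfolding parts_weight_def[abs_def] by (intro continuous_intros)
    then show "continuous_on {0..pi} F" unfolding F_def by (intro continuous_intros continuous_on_compose_cos H)
    fix \<theta> assume \<theta>: "\<theta> \<in> {0<..<pi}"
    have c: "cos \<theta> \<in> {-1<..<1}"
      using \<theta> cos_monotone_0_pi[of 0 \<theta>] cos_monotone_0_pi[of \<theta> pi] by auto
    have "((\<lambda>\<theta>. H (cos \<theta>)) has_real_derivative E (cos \<theta>) / (1 + cos \<theta>) * (- sin \<theta>)) (at \<theta>)"
      by (rule DERIV_chain2[OF der[OF c] DERIV_cos])
    from DERIV_mult[OF DERIV_parts_weight[of m P \<theta>] this]
    have D: "(F has_real_derivative parts_weight_deriv m P \<theta> * H (cos \<theta>) + E (cos \<theta>) / (1 + cos \<theta>) * (- sin \<theta>) * parts_weight m P \<theta>) (at \<theta>)"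
      by (simp add: F_def[abs_def])
    have sm: "sin \<theta> * sin \<theta> ^ (m - 1) = sin \<theta> ^ m" using m by (cases m) auto
    have "E (cos \<theta>) / (1 + cos \<theta>) * (- sin \<theta>) * parts_weight m P \<theta> = - (E (cos \<theta>) * poly P (cos \<theta>) * (sin \<theta> * sin \<theta> ^ (m - 1)))"
    proof -
      have pw: "parts_weight m P \<theta> = sin \<theta> ^ (m - 1) * ((1 + cos \<theta>) * poly P (cos \<theta>))"
        by (simp add: parts_weight_def algebra_simps)
      show ?thesis unfolding pw using c by simp
    qed
    then show "(F has_vector_derivative parts_weight_deriv m P \<theta> * H (cos \<theta>) - E (cos \<theta>) * poly P (cos \<theta>) * sin \<theta> ^ m) (at \<theta>)"
      using D unfolding sm has_real_derivative_iff_has_vector_derivative[symmetric] by simp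
  qed simp
  then have "integral {0..pi} (\<lambda>\<theta>. parts_weight_deriv m P \<theta> * H (cos \<theta>) - E (cos \<theta>) * poly P (cos \<theta>) * sin \<theta> ^ m) = F pi - F 0"
    by (rule integral_unique)
  moreover have "integral {0..pi} (\<lambda>\<theta>. parts_weight_deriv m P \<theta> * H (cos \<theta>) - E (cos \<theta>) * poly P (cos \<theta>) * sin \<theta> ^ m) =
     integral {0..pi} (\<lambda>\<theta>. parts_weight_deriv m P \<theta> * H (cos \<theta>)) - integral {0..pi} (\<lambda>\<theta>. E (cos \<theta>) * poly P (cos \<theta>) * sin \<theta> ^ m)"
    by (intro integral_diff integrable_continuous_real continuous_intros parts_weight_deriv_continuous continuous_on_compose_cos H E)
  ultimately show ?thesis by (simp add: zonal_int_def parts_functional_def F_def)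
qed

lemma parts_functional_combine:
  assumes H: "continuous_on {-1..1} H" and G: "continuous_on {-1..1} G"
    and K: "\<And>x. x \<in> {-1..1} \<Longrightarrow> K x = a * H x + b * G x"
  shows "parts_functional m P K = a * parts_functional m P H + b * parts_functional m P G"
proof -
  let ?I = "\<lambda>H. integral {0..pi} (\<lambda>\<theta>. parts_weight_deriv m P \<theta> * H (cos \<theta>))"
  have int: "(\<lambda>\<theta>. c * (parts_weight_deriv m P \<theta> * H (cos \<theta>))) integrable_on {0..pi}" if "continuous_on {-1..1} H" for H c
    by (intro integrable_continuous_real continuous_intros parts_weight_deriv_continuous continuous_on_compose_cos that)
  have "?I K = integral {0..pi} (\<lambda>\<theta>. a * (parts_weight_deriv m P \<theta> * H (cos \<theta>)) + b * (parts_weight_deriv m P \<theta> * G (cos \<theta>)))"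
    by (intro integral_cong) (simp add: K algebra_simps)
  also have "\<dots> = a * ?I H + b * ?I G"
    using integral_add[OF int[OF H, of a] int[OF G, of b]] by simp
  finally show ?thesis unfolding parts_functional_def using K[of 1] K[of "-1"] by (simp add: algebra_simps)
qed

lemma parts_functional_bound:
  "\<exists>C\<ge>0. \<forall>H B. continuous_on {-1..1} H \<longrightarrow> (\<forall>t\<in>{-1..1}. \<bar>H t\<bar> \<le> B) \<longrightarrow> \<bar>parts_functional m P H\<bar> \<le> C * B"
proof -
  define J where "J = integral {0..pi} (\<lambda>\<theta>. \<bar>parts_weight_deriv m P \<theta>\<bar>)"
  define C where "C = J + \<bar>parts_weight m P pi\<bar> + \<bar>parts_weight m P 0\<bar>"
  have Jnn: "J \<ge> 0" unfolding J_def
    by (intro integral_nonneg integrable_continuous_real continuous_intros parts_weight_deriv_continuous) auto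
  have "\<bar>parts_functional m P H\<bar> \<le> C * B" if H: "continuous_on {-1..1} H" and B: "\<forall>t\<in>{-1..1}. \<bar>H t\<bar> \<le> B" for H B
  proof -
    let ?I = "integral {0..pi} (\<lambda>\<theta>. parts_weight_deriv m P \<theta> * H (cos \<theta>))"
    have "norm ?I \<le> integral {0..pi} (\<lambda>\<theta>. \<bar>parts_weight_deriv m P \<theta>\<bar> * B)"
      by (rule integral_norm_bound_integral)
        (use B in \<open>auto intro!: integrable_continuous_real continuous_intros parts_weight_deriv_continuous continuous_on_compose_cos H mult_left_mono simp: abs_mult\<close>)
    also have "\<dots> = J * B" by (simp add: J_def)
    finally have "\<bar>?I\<bar> \<le> J * B" by simp
    moreover have "\<bar>parts_weight m P pi * H (-1)\<bar> \<le> \<bar>parts_weight m P pi\<bar> * B" "\<bar>parts_weight m P 0 * H 1\<bar> \<le> \<bar>parts_weight m P 0\<bar> * B"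
      using B by (auto simp: abs_mult intro!: mult_left_mono)
    ultimately show ?thesis unfolding parts_functional_def C_def distrib_right by linarith
  qed
  moreover have "C \<ge> 0" using Jnn by (simp add: C_def)
  ultimately show ?thesis by blast
qed

lemma abel_mean_continuous:
  assumes lam: "lam > - 1 / 2" and f: "continuous_on {-1..1} f"
  shows "continuous_on {-1..1} (abel_mean lam f)"
  unfolding continuous_on_iff
proof (intro ballI allI impI)
  fix x e :: real assume x: "x \<in> {-1..1}" and e: "e > 0"
  define K where "K = abel_mass lam + 1"
  have K: "K > 0" using abel_mass_nonneg[OF lam] by (simp add: K_def)
  have "uniformly_continuous_on {-1..1} f" by (rule compact_uniformly_continuous[OF f compact_Icc])
  from this[unfolded uniformly_continuous_on_def, THEN spec, of "e / K", THEN mp, OF divide_pos_pos[OF e K]]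
  obtain d where d0: "d > 0" and dd: "\<forall>s\<in>{-1..1}. \<forall>t\<in>{-1..1}. dist t s < d \<longrightarrow> dist (f t) (f s) < e / K"
    by (elim exE conjE)
  have d: "\<bar>f t - f s\<bar> < e / K" if "s \<in> {-1..1}" "t \<in> {-1..1}" "\<bar>t - s\<bar> < d" for s t
    using dd that unfolding dist_real_def by blast
  show "\<exists>d>0. \<forall>y\<in>{-1..1}. dist y x < d \<longrightarrow> dist (abel_mean lam f y) (abel_mean lam f x) < e"
  proof (intro exI[of _ d] conjI ballI impI d0)
    fix y assume y: "y \<in> {-1..1}" "dist y x < d"
    have "abel_mean lam f y - abel_mean lam f x = integral {0..1} (\<lambda>u. abel_kernel lam u * (f (-1 + (1 + y) * u) - f (-1 + (1 + x) * u)))"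
      unfolding abel_mean_def right_diff_distrib
      by (rule integral_diff[symmetric]) (intro abel_kernel_integrable lam dilate_continuous f x y)+
    also have "\<bar>\<dots>\<bar> \<le> abel_mass lam * (e / K)"
    proof (rule abel_mean_le[OF lam])
      show "continuous_on {0..1} (\<lambda>u. f (-1 + (1 + y) * u) - f (-1 + (1 + x) * u))"
        by (intro continuous_intros dilate_continuous f x y)
      fix u :: real assume u: "u \<in> {0..1}"
      have "(-1 + (1 + y) * u) - (-1 + (1 + x) * u) = (y - x) * u" by (simp add: algebra_simps)
      then have "\<bar>(-1 + (1 + y) * u) - (-1 + (1 + x) * u)\<bar> = \<bar>y - x\<bar> * u" using u by (simp add: abs_mult)
      also have "\<dots> \<le> \<bar>y - x\<bar>" using u by (intro mult_left_le) auto
      also have "\<dots> < d" using y by (simp add: dist_real_def)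
      finally show "\<bar>f (-1 + (1 + y) * u) - f (-1 + (1 + x) * u)\<bar> \<le> e / K"
        using d[OF dilate_bounds[OF x u] dilate_bounds[OF y(1) u]] by simp
    qed
    also have "\<dots> < e" using e K by (simp add: K_def field_simps)
    finally show "dist (abel_mean lam f y) (abel_mean lam f x) < e" by (simp add: dist_real_def)
  qed
qed

text \<open>The ultraspherical polynomials span all polynomials, these are dense, and the bound
  carries the vanishing to the uniform limit.\<close>

lemma functional_zero:
  fixes T :: "(real \<Rightarrow> real) \<Rightarrow> real"
  assumes k: "k \<ge> 1"
    and lin: "\<And>f g a b. continuous_on {-1..1} f \<Longrightarrow> continuous_on {-1..1} g \<Longrightarrow> T (\<lambda>t. a * f t + b * g t) = a * T f + b * T g"
    and bound: "\<And>f B. continuous_on {-1..1} f \<Longrightarrow> (\<forall>t\<in>{-1..1}. \<bar>f t\<bar> \<le> B) \<Longrightarrow> \<bar>T f\<bar> \<le> C * B"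
    and zero: "\<And>j. T (poly (ultra k j)) = 0"
    and f: "continuous_on {-1..1} f"
  shows "T f = 0"
proof (rule eq_if_all_close)
  fix e :: real assume "e > 0"
  then obtain p where p: "\<And>t. -1 \<le> t \<Longrightarrow> t \<le> 1 \<Longrightarrow> \<bar>f t - poly p t\<bar> < e" using weierstrass_poly[OF f] by blast
  obtain b where b: "p = (\<Sum>n\<le>degree p. smult (b n) (ultra k n))" using ultra_span[OF k order_refl] .
  have "T (\<lambda>t. \<Sum>n\<le>d. b n * poly (ultra k n) t) = 0" for d
  proof (induction d)
    case 0
    show ?case using lin[of "poly (ultra k 0)" "poly (ultra k 0)" "b 0" 0] zero[of 0] by (simp add: continuous_intros)
  next
    case (Suc d)
    show ?case using lin[of "\<lambda>t. \<Sum>n\<le>d. b n * poly (ultra k n) t" "poly (ultra k (Suc d))" 1 "b (Suc d)"] zero Suc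
      by (simp add: continuous_intros)
  qed
  moreover have "poly p = (\<lambda>t. \<Sum>n\<le>degree p. b n * poly (ultra k n) t)" by (rule ext, subst b) (simp add: poly_sum)
  ultimately have Tp: "T (poly p) = 0" by simp
  have cp: "continuous_on {-1..1} (poly p)" by (intro continuous_intros)
  have "T f = T (\<lambda>t. 1 * f t + (-1) * poly p t)" using lin[OF f cp, of 1 "-1"] Tp by simp
  also have "\<bar>\<dots>\<bar> \<le> C * e"
    by (rule bound) (use p in \<open>auto intro!: continuous_intros f cp less_imp_le\<close>)
  finally show "\<bar>T f - 0\<bar> \<le> C * e" by simp
qed

text \<open>The expected coefficient of D_+ f: only the degrees n and n + 1 on S^m contribute to
  degree n on S^(m+1).\<close>

definition lifted_coeff :: "nat \<Rightarrow> nat \<Rightarrow> (real \<Rightarrow> real) \<Rightarrow> real" where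
  "lifted_coeff m n f = abel_mass (abel_lam m) * ultra_norm (m + 1) n *
     (lift_factor m n / ultra_norm m n * zonal_coeff m f n
      + lift_factor m (n + 1) / ultra_norm m (n + 1) * zonal_coeff m f (n + 1))"

lemma zonal_coeff_lin:
  assumes "continuous_on {-1..1} f" "continuous_on {-1..1} g"
  shows "zonal_coeff k (\<lambda>t. a * f t + b * g t) n = a * zonal_coeff k f n + b * zonal_coeff k g n"
proof -
  have "zonal_coeff k (\<lambda>t. a * f t + b * g t) n = zonal_int k (\<lambda>t. a * (f t * poly (ultra k n) t) + b * (g t * poly (ultra k n) t))"
    unfolding zonal_coeff_def by (simp add: algebra_simps)
  also have "\<dots> = a * zonal_coeff k f n + b * zonal_coeff k g n"
    unfolding zonal_coeff_def by (subst zonal_int_add) (auto intro!: continuous_intros assms simp: zonal_int_cmult)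
  finally show ?thesis .
qed

lemma zonal_coeff_ultra:
  assumes "k \<ge> 1"
  shows "zonal_coeff k (poly (ultra k j)) n = (if j = n then ultra_norm k n else 0)"
  using ultra_orthogonal[OF assms, of j n] by (simp add: zonal_coeff_def ultra_norm_def power2_eq_square)

text \<open>Both sides are linear and bounded in the supremum norm as functionals of
  \<open>f\<close>, so the identity passes from the polynomials, where the derivative of the Abel
  mean is explicit, to every continuous \<open>f\<close>.\<close>

lemma parts_functional_abel:
  assumes m: "m \<ge> 1" and f: "continuous_on {-1..1} f"
  shows "parts_functional m (ultra (m + 1) n) (abel_mean (abel_lam m) f) = lifted_coeff m n f"
proof -
  define lam where "lam = abel_lam m"
  have lam: "lam > - 1 / 2" using abel_lam_gt[OF m] by (simp add: lam_def)
  define A where "A = abel_mass lam * ultra_norm (m + 1) n"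
  define P where "P = ultra (m + 1) n"
  define T where "T f = parts_functional m P (abel_mean lam f) - lifted_coeff m n f" for f
  obtain C0 where C0: "C0 \<ge> 0" "\<And>H B. continuous_on {-1..1} H \<Longrightarrow> (\<forall>t\<in>{-1..1}. \<bar>H t\<bar> \<le> B) \<Longrightarrow> \<bar>parts_functional m P H\<bar> \<le> C0 * B"
    using parts_functional_bound[of m P] by blast
  define c1 c2 where "c1 = A * (lift_factor m n / ultra_norm m n)" and "c2 = A * (lift_factor m (n + 1) / ultra_norm m (n + 1))"
  have lc: "lifted_coeff m n f = c1 * zonal_coeff m f n + c2 * zonal_coeff m f (n + 1)" for f
    by (simp add: lifted_coeff_def c1_def c2_def A_def lam_def distrib_left mult.assoc)
  have lin: "T (\<lambda>t. a * f t + b * g t) = a * T f + b * T g"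
    if fg: "continuous_on {-1..1} f" "continuous_on {-1..1} g" for f g a b
  proof -
    have "abel_mean lam (\<lambda>t. a * f t + b * g t) x = a * abel_mean lam f x + b * abel_mean lam g x" if "x \<in> {-1..1}" for x
      using abel_mean_sum[OF lam, of "{True, False}" "\<lambda>i. if i then f else g" x "\<lambda>i. if i then a else b"] fg that by simp
    then have "parts_functional m P (abel_mean lam (\<lambda>t. a * f t + b * g t)) =
        a * parts_functional m P (abel_mean lam f) + b * parts_functional m P (abel_mean lam g)"
      by (intro parts_functional_combine abel_mean_continuous lam fg)
    then show ?thesis unfolding T_def lc zonal_coeff_lin[OF fg] by (simp add: algebra_simps)
  qed
  have bound: "\<bar>T f\<bar> \<le> (C0 * abel_mass lam + (\<bar>c1\<bar> + \<bar>c2\<bar>) * zonal_int m (\<lambda>_. 1)) * B"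
    if f: "continuous_on {-1..1} f" and B: "\<forall>t\<in>{-1..1}. \<bar>f t\<bar> \<le> B" for f B
  proof -
    have "\<bar>parts_functional m P (abel_mean lam f)\<bar> \<le> C0 * (abel_mass lam * B)"
      using B by (intro C0(2) abel_mean_continuous lam f ballI abel_mean_abs_le) auto
    moreover have zc: "\<bar>zonal_coeff m f i\<bar> \<le> B * zonal_int m (\<lambda>_. 1)" for i
      unfolding zonal_coeff_def
    proof (rule zonal_int_abs_le)
      show "continuous_on {-1..1} (\<lambda>t. f t * poly (ultra m i) t)" by (intro continuous_intros f)
      fix t :: real assume t: "-1 \<le> t" "t \<le> 1"
      have "\<bar>f t * poly (ultra m i) t\<bar> \<le> B * 1"
        unfolding abs_mult using B t ultra_abs_le_1[OF m t, of i] by (intro mult_mono) auto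
      then show "\<bar>f t * poly (ultra m i) t\<bar> \<le> B" by simp
    qed
    have "\<bar>c1 * zonal_coeff m f n\<bar> \<le> \<bar>c1\<bar> * (B * zonal_int m (\<lambda>_. 1))" "\<bar>c2 * zonal_coeff m f (n + 1)\<bar> \<le> \<bar>c2\<bar> * (B * zonal_int m (\<lambda>_. 1))"
      unfolding abs_mult by (intro mult_left_mono zc abs_ge_zero)+
    ultimately have "\<bar>T f\<bar> \<le> C0 * (abel_mass lam * B) + (\<bar>c1\<bar> * (B * zonal_int m (\<lambda>_. 1)) + \<bar>c2\<bar> * (B * zonal_int m (\<lambda>_. 1)))"
      unfolding T_def lc by linarith
    then show ?thesis by (simp add: algebra_simps)
  qed
  have zero: "T (poly (ultra m j)) = 0" for j
  proof -
    define E where "E t = abel_mass lam * lift_factor m j * (poly (ultra (m + 1) j) t + poly (ultra (m + 1) (j - 1)) t)" for t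
    have cE: "continuous_on {-1..1} E" unfolding E_def by (intro continuous_intros)
    have "zonal_int (m + 1) (\<lambda>t. E t * poly P t) = parts_functional m P (abel_mean lam (poly (ultra m j)))"
      by (rule zonal_int_parts[OF m abel_mean_continuous[OF lam] cE])
         (use abel_mean_ultra_deriv[OF m, of _ j] in \<open>auto simp only: E_def lam_def intro!: continuous_intros\<close>)
    moreover have "zonal_int (m + 1) (\<lambda>t. E t * poly P t) = abel_mass lam * lift_factor m j *
       (zonal_coeff (m + 1) (poly (ultra (m + 1) j)) n + zonal_coeff (m + 1) (poly (ultra (m + 1) (j - 1))) n)"
      using zonal_coeff_lin[of "poly (ultra (m + 1) j)" "poly (ultra (m + 1) (j - 1))" "m + 1" "abel_mass lam * lift_factor m j" "abel_mass lam * lift_factor m j" n]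
      unfolding zonal_coeff_def[of _ "\<lambda>t. _ * _ t + _ * _ t"] E_def P_def
      by (simp add: continuous_intros distrib_left)
    moreover have "\<dots> = lifted_coeff m n (poly (ultra m j))"
    proof -
      have n1: "ultra_norm m i > 0" for i by (rule ultra_norm_pos[OF m])
      have "lift_factor m 0 = 0" by (simp add: lift_factor_def)
      then show ?thesis
        unfolding lc zonal_coeff_ultra[OF m] zonal_coeff_ultra[OF le_add2] c1_def c2_def A_def
        using n1[of n] n1[of "n + 1"] by (cases j) (auto simp: mult_ac)
    qed
    ultimately show ?thesis by (simp add: T_def)
  qed
  have "T f = 0" by (rule functional_zero[OF m lin bound zero f])
  then show ?thesis by (simp add: T_def P_def lam_def)
qed

section \<open>Separation of the two operators by reflection\<close>

lemma zonal_int_reflect: "zonal_int k (\<lambda>t. g (- t)) = zonal_int k g"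
proof (cases "k = 0")
  case False
  define G where "G \<theta> = g (cos \<theta>) * sin \<theta> ^ (k - 1)" for \<theta>
  have "integral {0..pi} (\<lambda>\<theta>. G (pi - \<theta>)) = integral {-pi..-0} (\<lambda>\<theta>. G (pi - - \<theta>))"
    using Henstock_Kurzweil_Integration.integral_reflect_real[of pi 0 "\<lambda>\<theta>. G (pi - \<theta>)"] by simp
  also have "\<dots> = integral {0..pi} G"
    using integral_shift_Icc_real[of "-pi" 0 G pi] by (simp add: o_def)
  finally show ?thesis using False by (simp add: zonal_int_def G_def[abs_def])
qed (simp add: zonal_int_def)

lemma zonal_coeff_reflect: "zonal_coeff k (\<lambda>t. g (- t)) n = (-1) ^ n * zonal_coeff k g n"
proof -
  have "zonal_coeff k (\<lambda>t. g (- t)) n = zonal_int k (\<lambda>t. (\<lambda>t. g t * poly (ultra k n) (- t)) (- t))"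
    by (simp add: zonal_coeff_def)
  also have "\<dots> = zonal_int k (\<lambda>t. g t * poly (ultra k n) (- t))" by (rule zonal_int_reflect)
  also have "\<dots> = zonal_int k (\<lambda>t. (-1) ^ n * (g t * poly (ultra k n) t))"
    by (simp add: ultra_parity mult_ac)
  finally show ?thesis by (simp add: zonal_int_cmult zonal_coeff_def)
qed

text \<open>\<open>abs_cont_C1\<close> upgrades the identity almost everywhere to a derivative at
  every interior point, which is what the integration by parts requires.\<close>

lemma lifted_coeff_of_ae_deriv:
  assumes m: "m \<ge> 1" and f: "continuous_on {-1..1} f" and ac: "abs_cont_on {-1..1} f"
    and E: "continuous_on {-1..1} E" and N: "negligible N"
    and der: "\<And>x. x \<in> {-1<..<1} - N \<Longrightarrow> (1 + x) * deriv (abel_mean (abel_lam m) f) x = E x"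
  shows "zonal_coeff (m + 1) E n = lifted_coeff m n f"
proof -
  note lam = abel_lam_gt[OF m]
  have "(abel_mean (abel_lam m) f has_real_derivative E x / (1 + x)) (at x)" if x: "x \<in> {-1<..<1}" for x
  proof (rule abs_cont_C1[OF abel_mean_abs_cont[OF lam f ac] _ N _ x])
    show "continuous_on {-1<..<1} (\<lambda>x. E x / (1 + x))"
      by (intro continuous_intros continuous_on_subset[OF E]) auto
    fix y assume y: "y \<in> {-1<..<1} - N"
    then have "1 + y > 0" by simp
    then show "deriv (abel_mean (abel_lam m) f) y = E y / (1 + y)" using der[OF y] by (simp add: field_simps)
  qed
  from zonal_int_parts[OF m abel_mean_continuous[OF lam f] E this, of "ultra (m + 1) n"]
  show ?thesis by (simp add: zonal_coeff_def parts_functional_abel[OF m f, simplified])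
qed

lemma lift_factor_pos: "m \<ge> 1 \<Longrightarrow> n \<ge> 1 \<Longrightarrow> lift_factor m n > 0"
  by (simp add: lift_factor_def)

lemma lift_factor_nonneg: "m \<ge> 1 \<Longrightarrow> lift_factor m n \<ge> 0"
  using lift_factor_pos[of m n] by (cases "n = 0") (auto simp: lift_factor_def)

text \<open>Reflection turns D_- f into minus D_+ of the reflected function and multiplies the n-th
  coefficient by (-1)^n. The lifted coefficients of \<open>f\<close> and of its reflection are thus,
  up to sign, multiples of P + Q and P - Q; their sum and difference isolate the contributions of
  degree n and n + 1.\<close>

lemma coefficients_of_representatives:
  assumes m: "m \<ge> 1" and f: "continuous_on {-1..1} f" and ac: "abs_cont_on {-1..1} f"
    and Gp: "cont_rep (DDp (abel_lam m) f) Gp" and Gm: "cont_rep (DDm (abel_lam m) f) Gm"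
  shows "zonal_coeff (m + 1) Gm n = 2 * abel_mass (abel_lam m) * ultra_norm (m + 1) n *
      (lift_factor m n / ultra_norm m n * zonal_coeff m f n)"
    and "zonal_coeff (m + 1) Gp n = 2 * abel_mass (abel_lam m) * ultra_norm (m + 1) n *
      (lift_factor m (n + 1) / ultra_norm m (n + 1) * zonal_coeff m f (n + 1))"
proof -
  define lam where "lam = abel_lam m"
  have lam: "lam > - 1 / 2" using abel_lam_gt[OF m] by (simp add: lam_def)
  define f' where "f' t = f (- t)" for t
  have f': "continuous_on {-1..1} f'" unfolding f'_def
    by (rule continuous_on_compose2[OF f]) (auto intro!: continuous_intros)
  have ac': "abs_cont_on {-1..1} f'" unfolding f'_def by (rule abs_cont_on_reflect[OF ac])
  define A A' where "A = abel_mean lam f" and "A' = abel_mean lam f'"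
  have cG: "continuous_on {-1..1} Gp" "continuous_on {-1..1} Gm" using Gp Gm by (auto simp: cont_rep_def)
  have cG': "continuous_on {-1..1} (\<lambda>x. Gp (- x))" "continuous_on {-1..1} (\<lambda>x. Gm (- x))"
    by (rule continuous_on_compose2[OF cG(1)] continuous_on_compose2[OF cG(2)]; auto intro!: continuous_intros)+
  obtain N1 where N1: "negligible N1" "{x. \<not> (x \<in> {-1<..<1} \<longrightarrow> Gp x = DDp lam f x)} \<subseteq> N1"
    using Gp unfolding cont_rep_def eventually_ae_filter_negligible lam_def by blast
  obtain N2 where N2: "negligible N2" "{x. \<not> (x \<in> {-1<..<1} \<longrightarrow> Gm x = DDm lam f x)} \<subseteq> N2"
    using Gm unfolding cont_rep_def eventually_ae_filter_negligible lam_def by blast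
  \<comment> \<open>The rule for \<open>deriv\<close> under t -> -t needs an actual derivative of
    the reflected mean; the points without one are reflected and added to the null set.\<close>
  define N3 where "N3 = {x \<in> {-1<..<1}. \<not> A' field_differentiable at x}"
  have N3: "negligible N3" unfolding N3_def A'_def
    by (rule abs_cont_differentiable[OF abel_mean_abs_cont[OF lam f' ac']])
  have neg_reflect: "negligible (uminus ` S)" if "negligible S" for S :: "real set"
    by (rule negligible_differentiable_image_negligible[OF order_refl that]) (auto intro!: derivative_intros)
  define N where "N = N1 \<union> N2 \<union> uminus ` N3"
  have N: "negligible N" unfolding N_def by (intro negligible_Un N1 N2 neg_reflect N3)
  have main: "Gp x = (1 + x) * deriv A x - (1 - x) * deriv A' (- x)" "Gm x = (1 + x) * deriv A x + (1 - x) * deriv A' (- x)"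
    if x: "x \<in> {-1<..<1} - N" for x
  proof -
    have x': "x \<in> {-1<..<1}" using x by blast
    have p: "Gp x = DDp lam f x" "Gm x = DDm lam f x" using x N1(2) N2(2) by (auto simp: N_def)
    have "- x \<notin> N3" using x by (force simp: N_def)
    then obtain D where D: "(A' has_real_derivative D) (at (- x))" using x' by (auto simp: N3_def field_differentiable_def)
    have "((\<lambda>t. A' (- t)) has_real_derivative D * (- 1)) (at x)"
      by (rule DERIV_chain2[where f = A' and g = "\<lambda>t. - t", OF D]) (auto intro!: derivative_eq_intros)
    then have "deriv (\<lambda>t. A' (- t)) x = - deriv A' (- x)" using DERIV_imp_deriv[OF D] by (simp add: DERIV_imp_deriv)
    then have "Dm lam f x = - ((1 - x) * deriv A' (- x))"
      using Dm_eq[OF lam f x'] unfolding f'_def[symmetric] A'_def[symmetric] by simp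
    moreover have "Dp lam f x = (1 + x) * deriv A x" unfolding A_def by (rule Dp_eq[OF lam f x'])
    ultimately show "Gp x = (1 + x) * deriv A x - (1 - x) * deriv A' (- x)" "Gm x = (1 + x) * deriv A x + (1 - x) * deriv A' (- x)"
      unfolding p DDp_def DDm_def by simp_all
  qed
  define E1 where "E1 x = (1 / 2) * Gp x + (1 / 2) * Gm x" for x
  define E2 where "E2 x = (1 / 2) * Gm (- x) + (- 1 / 2) * Gp (- x)" for x
  have "zonal_coeff (m + 1) E1 n = lifted_coeff m n f"
  proof (rule lifted_coeff_of_ae_deriv[OF m f ac _ N])
    show "continuous_on {-1..1} E1" unfolding E1_def by (intro continuous_intros cG)
    show "(1 + x) * deriv (abel_mean (abel_lam m) f) x = E1 x" if "x \<in> {-1<..<1} - N" for x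
    proof -
      have "(1 / 2) * (p - q) + (1 / 2) * (p + q) = p" for p q :: real by (simp add: field_simps)
      then show ?thesis unfolding E1_def main[OF that] by (simp add: A_def lam_def)
    qed
  qed
  moreover have "zonal_coeff (m + 1) E1 n = (1 / 2) * zonal_coeff (m + 1) Gp n + (1 / 2) * zonal_coeff (m + 1) Gm n"
    unfolding E1_def by (rule zonal_coeff_lin[OF cG])
  ultimately have e1: "zonal_coeff (m + 1) Gp n + zonal_coeff (m + 1) Gm n = 2 * lifted_coeff m n f" by simp
  have "zonal_coeff (m + 1) E2 n = lifted_coeff m n f'"
  proof (rule lifted_coeff_of_ae_deriv[OF m f' ac' _ neg_reflect[OF N]])
    show "continuous_on {-1..1} E2" unfolding E2_def by (intro continuous_intros cG')
    fix x :: real assume x: "x \<in> {-1<..<1} - uminus ` N"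
    then have mx: "- x \<in> {-1<..<1} - N" by force
    have "(1 / 2) * (p + q) + (- 1 / 2) * (p - q) = q" for p q :: real by (simp add: field_simps)
    then show "(1 + x) * deriv (abel_mean (abel_lam m) f') x = E2 x"
      unfolding E2_def main[OF mx] by (simp add: A'_def lam_def)
  qed
  moreover have "zonal_coeff (m + 1) E2 n = (1 / 2) * ((-1) ^ n * zonal_coeff (m + 1) Gm n) + (- 1 / 2) * ((-1) ^ n * zonal_coeff (m + 1) Gp n)"
    unfolding E2_def zonal_coeff_lin[OF cG'(2,1)] zonal_coeff_reflect ..
  ultimately have e2: "(-1) ^ n * (zonal_coeff (m + 1) Gm n - zonal_coeff (m + 1) Gp n) = 2 * lifted_coeff m n f'"
    by (simp add: algebra_simps)
  define M where "M = abel_mass (abel_lam m) * ultra_norm (m + 1) n"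
  define P where "P = lift_factor m n / ultra_norm m n * zonal_coeff m f n"
  define Q where "Q = lift_factor m (n + 1) / ultra_norm m (n + 1) * zonal_coeff m f (n + 1)"
  have l: "lifted_coeff m n f = M * (P + Q)" by (simp add: lifted_coeff_def M_def P_def Q_def)
  have l': "lifted_coeff m n f' = (-1) ^ n * (M * (P - Q))"
    unfolding lifted_coeff_def f'_def zonal_coeff_reflect by (simp add: M_def P_def Q_def algebra_simps)
  have "(-1) ^ n * (zonal_coeff (m + 1) Gm n - zonal_coeff (m + 1) Gp n) = (-1) ^ n * (2 * (M * (P - Q)))"
    unfolding e2 l' by simp
  then have e2': "zonal_coeff (m + 1) Gm n - zonal_coeff (m + 1) Gp n = 2 * (M * (P - Q))" by simp
  have "zonal_coeff (m + 1) Gm n = 2 * M * P" "zonal_coeff (m + 1) Gp n = 2 * M * Q"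
    using e1 e2' unfolding l by (simp_all add: algebra_simps)
  then show "zonal_coeff (m + 1) Gm n = 2 * abel_mass (abel_lam m) * ultra_norm (m + 1) n *
      (lift_factor m n / ultra_norm m n * zonal_coeff m f n)"
    and "zonal_coeff (m + 1) Gp n = 2 * abel_mass (abel_lam m) * ultra_norm (m + 1) n *
      (lift_factor m (n + 1) / ultra_norm m (n + 1) * zonal_coeff m f (n + 1))"
    by (simp_all add: M_def P_def Q_def mult.assoc)
qed

theorem theorem2p4:
  fixes m :: nat and f Gp Gm :: "real \<Rightarrow> real"
  assumes "m \<ge> 1"
    and "f \<in> Lambda m"
    and "abs_cont_on {-1..1} f"
    and "cont_rep (DDp ((real m - 1) / 2) f) Gp"
    and "cont_rep (DDm ((real m - 1) / 2) f) Gm"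
  shows "Gp \<in> Lambda (m + 1) \<and> Gm \<in> Lambda (m + 1) \<and>
         (f \<in> Lambda_plus m \<longrightarrow> Gp \<in> Lambda_plus (m + 1) \<and> Gm \<in> Lambda_plus (m + 1))"
proof -
  note m = assms(1)
  have f: "continuous_on {-1..1} f" "zonal_pd m f" using assms(2) by (auto simp: Lambda_iff)
  have G: "continuous_on {-1..1} Gp" "continuous_on {-1..1} Gm" using assms(4,5) by (auto simp: cont_rep_def)
  define a where "a n = zonal_coeff m f n" for n
  define \<mu> where "\<mu> n = 2 * abel_mass (abel_lam m) * ultra_norm (m + 1) n" for n
  define l where "l n = lift_factor m n / ultra_norm m n" for n
  have a: "a n \<ge> 0" for n unfolding a_def zonal_coeff_def by (rule zonal_coeff_nonneg[OF m f])
  have \<mu>: "\<mu> n > 0" for n using abel_mass_pos[OF m] ultra_norm_pos[of "m + 1" n] by (simp add: \<mu>_def)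
  have l: "l n \<ge> 0" "n \<ge> 1 \<Longrightarrow> l n > 0" for n
    using lift_factor_nonneg[OF m, of n] lift_factor_pos[OF m, of n] ultra_norm_pos[OF m, of n] by (auto simp: l_def)
  note coeffs = coefficients_of_representatives[OF m f(1) assms(3) assms(4,5)[folded abel_lam_def]]
  have cm: "zonal_coeff (m + 1) Gm n = \<mu> n * (l n * a n)" and cp: "zonal_coeff (m + 1) Gp n = \<mu> n * (l (n + 1) * a (n + 1))" for n
    unfolding coeffs by (simp_all add: \<mu>_def l_def a_def)
  have nn: "zonal_coeff (m + 1) Gm n \<ge> 0" "zonal_coeff (m + 1) Gp n \<ge> 0" for n
    unfolding cm cp using \<mu>[of n] l a by (simp_all add: less_imp_le)
  have pd: "zonal_pd (m + 1) Gp" "zonal_pd (m + 1) Gm"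
    by (rule zonal_pd_of_coeffs; use G nn in simp)+
  have "zonal_spd (m + 1) Gp \<and> zonal_spd (m + 1) Gm" if "f \<in> Lambda_plus m"
  proof -
    have spd: "zonal_spd m f" using that by (simp add: Lambda_plus_iff)
    \<comment> \<open>The bound \<open>n \<ge> 1\<close> matters because the multiplier of degree 0
      is 0; asking for a degree of at least 2N + 2 secures it together with the parity.\<close>
    have ev: "\<exists>n\<ge>N. even n \<and> n \<ge> 1 \<and> a n > 0" for N
    proof -
      obtain n where "n \<ge> 2 * N + 2" "even n = even (2 * N + 2)" "a n > 0"
        using zonal_spd_coeff_pos[OF m f(1) spd, of "2 * N + 2"] unfolding a_def by auto
      then show ?thesis by (intro exI[of _ n]) simp
    qed
    have od: "\<exists>n\<ge>N. odd n \<and> n \<ge> 1 \<and> a n > 0" for N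
    proof -
      obtain n where "n \<ge> 2 * N + 1" "even n = even (2 * N + 1)" "a n > 0"
        using zonal_spd_coeff_pos[OF m f(1) spd, of "2 * N + 1"] unfolding a_def by auto
      then show ?thesis by (intro exI[of _ n]) simp
    qed
    \<comment> \<open>The source may be the circle, but the target sphere always has dimension at
      least 2, where the sufficient condition is available.\<close>
    have k: "m + 1 \<ge> 2" using m by simp
    have "zonal_spd (m + 1) Gm"
    proof (rule zonal_spd_of_coeffs[OF k G(2) nn(1)])
      fix N
      obtain n where "n \<ge> N" "even n" "n \<ge> 1" "a n > 0" using ev by blast
      then show "\<exists>n\<ge>N. even n \<and> zonal_coeff (m + 1) Gm n > 0"
        unfolding cm using \<mu> l(2) by (intro exI[of _ n]) simp
      obtain n where "n \<ge> N" "odd n" "n \<ge> 1" "a n > 0" using od by blast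
      then show "\<exists>n\<ge>N. odd n \<and> zonal_coeff (m + 1) Gm n > 0"
        unfolding cm using \<mu> l(2) by (intro exI[of _ n]) simp
    qed
    moreover have "zonal_spd (m + 1) Gp"
    proof (rule zonal_spd_of_coeffs[OF k G(1) nn(2)])
      fix N
      \<comment> \<open>Degree j of \<open>Gp\<close> stems from degree j + 1 of \<open>f\<close>:
        parities are exchanged, and starting from \<open>N + 1\<close> keeps j at least
        \<open>N\<close>.\<close>
      obtain n where n: "n \<ge> N + 1" "odd n" "n \<ge> 1" "a n > 0" using od by blast
      then obtain j where "n = j + 1" by (cases n) auto
      then show "\<exists>n\<ge>N. even n \<and> zonal_coeff (m + 1) Gp n > 0"
        unfolding cp using n \<mu> l(2) by (intro exI[of _ j]) simp
      obtain n where n: "n \<ge> N + 1" "even n" "n \<ge> 1" "a n > 0" using ev by blast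
      then obtain j where "n = j + 1" by (cases n) auto
      then show "\<exists>n\<ge>N. odd n \<and> zonal_coeff (m + 1) Gp n > 0"
        unfolding cp using n \<mu> l(2) by (intro exI[of _ j]) simp
    qed
    ultimately show ?thesis by blast
  qed
  then show ?thesis using pd G unfolding Lambda_iff Lambda_plus_iff by blast
qed

end
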